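(* Let $c$ be a vertical column of the mesh, and let $V^t_h(c)$, $V^{2,v}_h(c)$, $V^3_h(c)$ be the restrictions to $c$ of the potential temperature space $V_h^t(\Omega)$, of the vertical part $V_h^{2,v}(\Omega)$ of the velocity space, and of $V_h^3(\Omega)$. Define $$\bar V^3_h(c)=\Big\{\rho\in V^3_h(c):\int_c\rho\,dx=0\Big\},\qquad \mathring V^t_h(c)=\big\{\theta\in V^t_h(c):\theta|_{top}=\theta|_{bottom}=0\big\},$$ where $\theta|_{top}$, $\theta|_{bottom}$ are the restrictions of $\theta$ to the top and bottom surfaces of $c$. Let $\Pi\in\bar V_h^3(c)$ be such that the upward jump of $\Pi$ satisfies $\hat r\cdot[\![\Pi]\!]>0$ on $\Gamma_c$, the set of interior facets in the column $c$; further, if $V_h^3(\Omega)$ is of degree $p\ge1$ in the vertical direction, let $\frac{\partial\Pi}{\partial z}>0$ in each cell. Then the discrete hydrostatic balance equation $$0=-\int_c\nabla_h\cdot(\theta w)\,\Pi\,dx-\int_c w\cdot\hat r\,g\,dx\qquad\text{for all } w\in V^{2,v}_h(c)$$ has a unique solution $\theta\in\mathring V^t_h(c)$.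
   Context: Mesh: the domain $\Omega$ is meshed by triangular prisms or hexahedra arranged in vertical columns; all cells have side walls aligned with the vertical direction (top and bottom faces of cells may slope), and the mesh is non-degenerate. $\hat r$ is the unit upward vector, $z$ the coordinate in the direction $\hat r$, and $g>0$ is the (constant) gravitational acceleration. A column $c$ is the union of the cells lying above one another; its interior facets $\Gamma_c$ are those shared by two vertically neighbouring cells. $\hat r\cdot[\![\Pi]\!]$ on such a facet denotes (up to a positive factor) the value of $\Pi$ from the cell above minus the value from the cell below. $\nabla_h\cdot$ is the divergence evaluated cell by cell. Spaces: compatible spaces $V_h^2(\Omega)\subset H(\mathrm{div};\Omega)$ (velocity) and $V_h^3(\Omega)\subset L^2(\Omega)$ (density, pressure) with $\nabla\cdot V_h^2\subset V_h^3$, obtained from a reference cell $\hat K=\hat T\times\hat S$ ($\hat T$ a triangle or square, $\hat S$ an interval) by tensor products: the space on $\hat K$ for $V_h^2$ is the sum of a vertical part $V^{2,v}_h(\hat K)=DG(\hat T)\otimes CG_s(\hat S)\,\hat z$ (pointing in the vertical direction $\hat z$) and a horizontal part $V^{2,h}_h(\hat K)=W(\hat T)\otimes DG_{s-1}(\hat S)$, and that for $V_h^3$ is $DG(\hat T)\otimes DG_{s-1}(\hat S)$ (of vertical degree $p=s-1$), where $s\ge1$, $DG(\hat T)$ is a polynomial space on $\hat T$ and $W(\hat T)$ is a compatible $H(\mathrm{div})$ space (e.g. Raviart–Thomas or BDM). On a physical cell $K=F_K(\hat K)$ with $J=DF_K$ the velocity space is the image under $v\mapsto (Jv/\det J)\circ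 F_K^{-1}$ (so elements of $V_h^{2,v}$ point in the vertical direction $\hat r$), and the $V_h^3$ space is the image under $\rho\mapsto(\rho/\det J)\circ F_K^{-1}$. $V_h^{2,v}(\Omega)$ is the part of $V_h^2(\Omega)$ built from vertical parts; the rigid-lid boundary condition is imposed: $w\cdot n=0$ at the top and bottom boundaries for all $w\in V_h^{2,v}(\Omega)$. Temperature space: $V_h^t(\hat K)=\{\theta:\theta\hat z\in V_h^{2,v}(\hat K)\}$ on the reference cell; $V_h^t(K)=\{\theta:\theta\circ F_K\in V_h^t(\hat K)\}$ on cells, and $V_h^t(\Omega)$ consists of scalar functions that are in $V_h^t(K)$ on each cell and continuous in the vertical direction (no continuity imposed between columns, and no boundary condition imposed at top and bottom). *)

theory Defs
  imports "HOL-Analysis.Analysis" "HOL-Computational_Algebra.Polynomial"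
begin

section \<open>Calculus\<close>

definition jac :: "(real^'n \<Rightarrow> real^'n) \<Rightarrow> real^'n \<Rightarrow> real^'n^'n" where
  "jac F x = matrix (frechet_derivative F (at x))"

definition divergence :: "(real^'n \<Rightarrow> real^'n) \<Rightarrow> real^'n \<Rightarrow> real" where
  "divergence v x = trace (jac v x)"

text \<open>Real functions with partial derivatives of all orders, all of them differentiable.\<close>

coinductive smooth :: "('a::euclidean_space \<Rightarrow> real) \<Rightarrow> bool" where
  "\<lbrakk>\<And>x. f differentiable (at x);
    \<And>b. b \<in> Basis \<Longrightarrow> smooth (\<lambda>x. frechet_derivative f (at x) b)\<rbrakk> \<Longrightarrow> smooth f"

definition test_function :: "('a::euclidean_space) set \<Rightarrow> ('a \<Rightarrow> real) \<Rightarrow> bool" where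
  "test_function U \<phi> \<longleftrightarrow> smooth \<phi> \<and> (\<exists>C. compact C \<and> C \<subseteq> U \<and> (\<forall>x. x \<notin> C \<longrightarrow> \<phi> x = 0))"

definition square_integrable ::
    "('a::euclidean_space) set \<Rightarrow> ('a \<Rightarrow> 'b::euclidean_space) \<Rightarrow> bool" where
  "square_integrable S f \<longleftrightarrow>
     set_borel_measurable lebesgue S f \<and> set_integrable lebesgue S (\<lambda>x. (norm (f x))\<^sup>2)"


section \<open>Reference cell and reference spaces\<close>

text \<open>
  Both on the reference cell and in physical space the third coordinate is the vertical one;
  \<open>up\<close> is the unit vector called z-hat on the reference cell and r-hat in physical space.
\<close>

abbreviation up :: "real^3" where
  "up \<equiv> axis 3 1"

definition horiz :: "real^3 \<Rightarrow> real^2" where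
  "horiz y = vector [y $ 1, y $ 2]"

definition horiz_embed :: "real^2 \<Rightarrow> real^3" where
  "horiz_embed u = vector [u $ 1, u $ 2, 0]"

datatype base_shape = Triangle | Square

fun ref_base :: "base_shape \<Rightarrow> (real^2) set" where
  "ref_base Triangle = convex hull {0, axis 1 1, axis 2 1}"
| "ref_base Square = cbox 0 1"

definition ref_slice :: "(real^2) set \<Rightarrow> real set \<Rightarrow> (real^3) set" where
  "ref_slice B I = {y. horiz y \<in> B \<and> y $ 3 \<in> I}"

definition ref_cell :: "base_shape \<Rightarrow> (real^3) set" where
  "ref_cell S = ref_slice (ref_base S) {0..1}"

text \<open>
  Functions on the reference cell are all polynomial, and are represented by polynomial
  functions on the whole space.
\<close>

definition polynomial_space :: "('a::real_normed_vector \<Rightarrow> 'b::euclidean_space) set \<Rightarrow> bool" where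
  "polynomial_space X \<longleftrightarrow>
     (\<exists>B. finite B \<and> (\<forall>b\<in>B. polynomial_function b) \<and>
          X = {f. \<exists>c. f = (\<lambda>x. \<Sum>b\<in>B. c b *\<^sub>R b x)})"

text \<open>On a single interval, \<open>CG\<^sub>n\<close> and \<open>DG\<^sub>n\<close> are the same space.\<close>

definition interval_space :: "nat \<Rightarrow> (real \<Rightarrow> real) set" where
  "interval_space n = {poly q | q. degree q \<le> n}"

definition tensor :: "(real^2 \<Rightarrow> 'b::real_vector) set \<Rightarrow> (real \<Rightarrow> real) set \<Rightarrow> (real^3 \<Rightarrow> 'b) set" where
  "tensor A B = {f. \<exists>n::nat. \<exists>a b. (\<forall>i<n. a i \<in> A \<and> b i \<in> B) \<and>
                   f = (\<lambda>y. \<Sum>i<n. b i (y $ 3) *\<^sub>R a i (horiz y))}"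

text \<open>
  \<open>base_DG\<close> and \<open>base_W\<close> are the spaces \<open>DG\<close> and \<open>W\<close> on the reference base, \<open>vdeg\<close> is the
  degree \<open>s\<close> of the vertical continuous space.
\<close>

record element =
  base_DG :: "(real^2 \<Rightarrow> real) set"
  base_W :: "(real^2 \<Rightarrow> real^2) set"
  vdeg :: nat

definition compatible_element :: "element \<Rightarrow> bool" where
  "compatible_element E \<longleftrightarrow>
     polynomial_space (base_DG E) \<and> polynomial_space (base_W E) \<and>
     (\<forall>u\<in>base_W E. divergence u \<in> base_DG E) \<and> 1 \<le> vdeg E"

definition ref_V2v :: "element \<Rightarrow> (real^3 \<Rightarrow> real^3) set" where
  "ref_V2v E = {\<lambda>y. f y *\<^sub>R up | f. f \<in> tensor (base_DG E) (interval_space (vdeg E))}"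

definition ref_V2h :: "element \<Rightarrow> (real^3 \<Rightarrow> real^3) set" where
  "ref_V2h E = {\<lambda>y. horiz_embed (u y) | u. u \<in> tensor (base_W E) (interval_space (vdeg E - 1))}"

definition ref_V2 :: "element \<Rightarrow> (real^3 \<Rightarrow> real^3) set" where
  "ref_V2 E = {\<lambda>y. v y + u y | v u. v \<in> ref_V2v E \<and> u \<in> ref_V2h E}"

definition ref_V3 :: "element \<Rightarrow> (real^3 \<Rightarrow> real) set" where
  "ref_V3 E = tensor (base_DG E) (interval_space (vdeg E - 1))"

definition ref_Vt :: "element \<Rightarrow> (real^3 \<Rightarrow> real) set" where
  "ref_Vt E = {\<theta>. (\<lambda>y. \<theta> y *\<^sub>R up) \<in> ref_V2v E}"


section \<open>Meshes\<close>

text \<open>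
  The cells of column \<open>c\<close> are \<open>(c, 0), \<dots>, (c, layers M c - 1)\<close>, numbered upwards.
\<close>

record 'c mesh =
  shape :: base_shape
  columns :: "'c set"
  layers :: "'c \<Rightarrow> nat"
  cell_map :: "'c \<times> nat \<Rightarrow> real^3 \<Rightarrow> real^3"

definition cells :: "'c mesh \<Rightarrow> ('c \<times> nat) set" where
  "cells M = (SIGMA c : columns M. {..<layers M c})"

definition cell :: "'c mesh \<Rightarrow> 'c \<times> nat \<Rightarrow> (real^3) set" where
  "cell M K = cell_map M K ` ref_cell (shape M)"

definition domain :: "'c mesh \<Rightarrow> (real^3) set" where
  "domain M = interior (\<Union>K\<in>cells M. cell M K)"

text \<open>The functions interpolating vertex values: P1 on a triangle, Q1 on a square.\<close>

fun vertex_space :: "base_shape \<Rightarrow> (real^2 \<Rightarrow> real) set" where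
  "vertex_space Triangle = {\<lambda>x. a0 + a1 * x $ 1 + a2 * x $ 2 | a0 a1 a2. True}"
| "vertex_space Square = {\<lambda>x. a0 + a1 * x $ 1 + a2 * x $ 2 + a3 * x $ 1 * x $ 2 | a0 a1 a2 a3. True}"

text \<open>
  The map of a prism or hexahedron interpolates its vertices.  The side walls are vertical iff
  the lateral edges are; by interpolation, every reference vertical line is then mapped to a
  vertical line.
\<close>

definition column_cell_map :: "base_shape \<Rightarrow> (real^3 \<Rightarrow> real^3) \<Rightarrow> bool" where
  "column_cell_map S F \<longleftrightarrow>
     (\<forall>i. (\<lambda>y. F y $ i) \<in> tensor (vertex_space S) (interval_space 1)) \<and>
     inj_on F (ref_cell S) \<and>
     (\<forall>y\<in>ref_cell S. det (jac F y) \<noteq> 0) \<and>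
     (\<forall>y\<in>ref_cell S. \<exists>h>0. jac F y *v up = h *\<^sub>R up)"

text \<open>
  The last condition says that distinct columns do not overlap; together with the vertical
  matching it implies that distinct cells have disjoint interiors.
\<close>

definition column_mesh :: "'c mesh \<Rightarrow> bool" where
  "column_mesh M \<longleftrightarrow>
     finite (columns M) \<and>
     (\<forall>c\<in>columns M. 1 \<le> layers M c) \<and>
     (\<forall>K\<in>cells M. column_cell_map (shape M) (cell_map M K)) \<and>
     (\<forall>c\<in>columns M. \<forall>k. Suc k < layers M c \<longrightarrow>
        (\<forall>y\<in>ref_slice (ref_base (shape M)) {1}.
           cell_map M (c, k) y = cell_map M (c, Suc k) (y - up))) \<and>
     (\<forall>c\<in>columns M. \<forall>c'\<in>columns M. c \<noteq> c' \<longrightarrow>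
        interior (horiz ` cell M (c, 0)) \<inter> interior (horiz ` cell M (c', 0)) = {})"

definition upper_face :: "'c mesh \<Rightarrow> 'c \<times> nat \<Rightarrow> (real^3) set" where
  "upper_face M K = cell_map M K ` ref_slice (ref_base (shape M)) {1}"

definition lower_face :: "'c mesh \<Rightarrow> 'c \<times> nat \<Rightarrow> (real^3) set" where
  "lower_face M K = cell_map M K ` ref_slice (ref_base (shape M)) {0}"

text \<open>
  The facet between the cells \<open>(c, k)\<close> and \<open>(c, Suc k)\<close>, taken without its edges.
\<close>

definition interior_facet :: "'c mesh \<Rightarrow> 'c \<Rightarrow> nat \<Rightarrow> (real^3) set" where
  "interior_facet M c k = cell_map M (c, k) ` ref_slice (interior (ref_base (shape M))) {1}"


section \<open>Finite element spaces on cells\<close>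

definition ref_point :: "'c mesh \<Rightarrow> 'c \<times> nat \<Rightarrow> real^3 \<Rightarrow> real^3" where
  "ref_point M K = inv_into (ref_cell (shape M)) (cell_map M K)"

definition piola :: "'c mesh \<Rightarrow> 'c \<times> nat \<Rightarrow> (real^3 \<Rightarrow> real^3) \<Rightarrow> real^3 \<Rightarrow> real^3" where
  "piola M K v = (\<lambda>x\<in>cell M K. let y = ref_point M K x; J = jac (cell_map M K) y
                                in (1 / det J) *\<^sub>R (J *v v y))"

definition cell_V2 :: "element \<Rightarrow> 'c mesh \<Rightarrow> 'c \<times> nat \<Rightarrow> (real^3 \<Rightarrow> real^3) set" where
  "cell_V2 E M K = piola M K ` ref_V2 E"

definition cell_V2v :: "element \<Rightarrow> 'c mesh \<Rightarrow> 'c \<times> nat \<Rightarrow> (real^3 \<Rightarrow> real^3) set" where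
  "cell_V2v E M K = piola M K ` ref_V2v E"

definition cell_V3 :: "element \<Rightarrow> 'c mesh \<Rightarrow> 'c \<times> nat \<Rightarrow> (real^3 \<Rightarrow> real) set" where
  "cell_V3 E M K = {\<lambda>x\<in>cell M K. let y = ref_point M K x in \<rho> y / det (jac (cell_map M K) y)
                     | \<rho>. \<rho> \<in> ref_V3 E}"

definition cell_Vt :: "element \<Rightarrow> 'c mesh \<Rightarrow> 'c \<times> nat \<Rightarrow> (real^3 \<Rightarrow> real) set" where
  "cell_Vt E M K = {\<theta> \<in> extensional (cell M K).
                     \<exists>\<theta>'\<in>ref_Vt E. \<forall>y\<in>ref_cell (shape M). \<theta> (cell_map M K y) = \<theta>' y}"


section \<open>Finite element spaces on the domain\<close>

text \<open>
  A function on the domain that may jump between cells is a family indexed by the cells, whose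
  member at \<open>K\<close> is the function on the closed cell \<open>K\<close>; this gives it one trace per cell on each
  facet.  Membership in H(div) is that of the function the family defines almost everywhere:
  its distributional divergence is square integrable.
\<close>

definition in_Hdiv :: "'c mesh \<Rightarrow> ('c \<times> nat \<Rightarrow> real^3 \<Rightarrow> real^3) \<Rightarrow> bool" where
  "in_Hdiv M v \<longleftrightarrow>
     (\<forall>K\<in>cells M. square_integrable (cell M K) (v K)) \<and>
     (\<exists>d :: real^3 \<Rightarrow> real. square_integrable (domain M) d \<and>
        (\<forall>\<phi>. test_function (domain M) \<phi> \<longrightarrow>
           (\<Sum>K\<in>cells M. LINT x:cell M K|lebesgue. frechet_derivative \<phi> (at x) (v K x))
             = - (LINT x:domain M|lebesgue. d x * \<phi> x)))"

definition V2 :: "element \<Rightarrow> 'c mesh \<Rightarrow> ('c \<times> nat \<Rightarrow> real^3 \<Rightarrow> real^3) set" where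
  "V2 E M = {v \<in> Pi\<^sub>E (cells M) (cell_V2 E M). in_Hdiv M v}"

definition V3 :: "element \<Rightarrow> 'c mesh \<Rightarrow> ('c \<times> nat \<Rightarrow> real^3 \<Rightarrow> real) set" where
  "V3 E M = Pi\<^sub>E (cells M) (cell_V3 E M)"

text \<open>A unit normal to the image of a horizontal slice of the reference cell.\<close>

definition face_normal :: "'c mesh \<Rightarrow> 'c \<times> nat \<Rightarrow> real^3 \<Rightarrow> real^3" where
  "face_normal M K y =
     sgn (cross3 (jac (cell_map M K) y *v axis 1 1) (jac (cell_map M K) y *v axis 2 1))"

definition rigid_lid :: "'c mesh \<Rightarrow> ('c \<times> nat \<Rightarrow> real^3 \<Rightarrow> real^3) \<Rightarrow> bool" where
  "rigid_lid M w \<longleftrightarrow>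
     (\<forall>c\<in>columns M.
        (\<forall>y\<in>ref_slice (ref_base (shape M)) {1}.
           w (c, layers M c - 1) (cell_map M (c, layers M c - 1) y)
             \<bullet> face_normal M (c, layers M c - 1) y = 0) \<and>
        (\<forall>y\<in>ref_slice (ref_base (shape M)) {0}.
           w (c, 0) (cell_map M (c, 0) y) \<bullet> face_normal M (c, 0) y = 0))"

definition V2v :: "element \<Rightarrow> 'c mesh \<Rightarrow> ('c \<times> nat \<Rightarrow> real^3 \<Rightarrow> real^3) set" where
  "V2v E M = {w \<in> V2 E M. (\<forall>K\<in>cells M. w K \<in> cell_V2v E M K) \<and> rigid_lid M w}"

definition Vt :: "element \<Rightarrow> 'c mesh \<Rightarrow> ('c \<times> nat \<Rightarrow> real^3 \<Rightarrow> real) set" where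
  "Vt E M = {\<theta> \<in> Pi\<^sub>E (cells M) (cell_Vt E M).
               \<forall>c\<in>columns M. \<forall>k. Suc k < layers M c \<longrightarrow>
                 (\<forall>x\<in>upper_face M (c, k). \<theta> (c, k) x = \<theta> (c, Suc k) x)}"


section \<open>Restrictions to a column\<close>

definition column_restrict :: "'c mesh \<Rightarrow> 'c \<Rightarrow> ('c \<times> nat \<Rightarrow> 'b) \<Rightarrow> nat \<Rightarrow> 'b" where
  "column_restrict M c f = (\<lambda>k\<in>{..<layers M c}. f (c, k))"

definition column_integral :: "'c mesh \<Rightarrow> 'c \<Rightarrow> (nat \<Rightarrow> real^3 \<Rightarrow> real) \<Rightarrow> real" where
  "column_integral M c f = (\<Sum>k<layers M c. LINT x:cell M (c, k)|lebesgue. f k x)"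

definition V2v_col :: "element \<Rightarrow> 'c mesh \<Rightarrow> 'c \<Rightarrow> (nat \<Rightarrow> real^3 \<Rightarrow> real^3) set" where
  "V2v_col E M c = column_restrict M c ` V2v E M"

definition V3_col :: "element \<Rightarrow> 'c mesh \<Rightarrow> 'c \<Rightarrow> (nat \<Rightarrow> real^3 \<Rightarrow> real) set" where
  "V3_col E M c = column_restrict M c ` V3 E M"

definition Vt_col :: "element \<Rightarrow> 'c mesh \<Rightarrow> 'c \<Rightarrow> (nat \<Rightarrow> real^3 \<Rightarrow> real) set" where
  "Vt_col E M c = column_restrict M c ` Vt E M"

definition V3_bar :: "element \<Rightarrow> 'c mesh \<Rightarrow> 'c \<Rightarrow> (nat \<Rightarrow> real^3 \<Rightarrow> real) set" where
  "V3_bar E M c = {\<rho> \<in> V3_col E M c. column_integral M c \<rho> = 0}"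

definition Vt_ring :: "element \<Rightarrow> 'c mesh \<Rightarrow> 'c \<Rightarrow> (nat \<Rightarrow> real^3 \<Rightarrow> real) set" where
  "Vt_ring E M c = {\<theta> \<in> Vt_col E M c.
     (\<forall>x\<in>upper_face M (c, layers M c - 1). \<theta> (layers M c - 1) x = 0) \<and>
     (\<forall>x\<in>lower_face M (c, 0). \<theta> 0 x = 0)}"

definition vertical_derivative :: "(real^3 \<Rightarrow> real) \<Rightarrow> real^3 \<Rightarrow> real" where
  "vertical_derivative f x = deriv (\<lambda>t. f (x + t *\<^sub>R up)) 0"

definition hydrostatic_balance ::
    "element \<Rightarrow> 'c mesh \<Rightarrow> 'c \<Rightarrow> real \<Rightarrow> (nat \<Rightarrow> real^3 \<Rightarrow> real) \<Rightarrow> (nat \<Rightarrow> real^3 \<Rightarrow> real) \<Rightarrow> bool" where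
  "hydrostatic_balance E M c g P \<theta> \<longleftrightarrow>
     (\<forall>w\<in>V2v_col E M c.
        0 = - column_integral M c (\<lambda>k x. divergence (\<lambda>x. \<theta> k x *\<^sub>R w k x) x * P k x)
            - column_integral M c (\<lambda>k x. (w k x \<bullet> up) * g))"

end

theory Submission
  imports Defs "HOL-Library.Function_Algebras"
begin

text \<open>
  Since the side walls are vertical, a cell map has the form \<open>(u, t) \<mapsto> (G u, r u + t * m u)\<close>
  with the same \<open>G\<close> on all cells of a column, and its Jacobian determinant is \<open>D u * m u\<close> with
  \<open>D = det DG\<close>.  Pulled back to the reference cell, a temperature is a function \<open>U\<close>, a velocity is
  \<open>V / D\<close> times the vertical, the divergence of their product is the vertical derivative of
  \<open>U * V\<close> divided by \<open>D * m\<close>, and both \<open>U\<close> and \<open>V\<close> range over the same space of vertically continuous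
  functions vanishing at top and bottom.  So the balance is a square linear system, for the form
  that sends \<open>(U, V)\<close> to minus the integral of the vertical derivative of \<open>U * V\<close> against the
  pressure.  Integrating by parts in the vertical direction, this form is the integral of
  \<open>U * V\<close> against the vertical derivative of the pressure plus the integrals over the facets
  of \<open>U * V\<close> against its upward jump; under the hypotheses it is symmetric and positive definite.

  That a field in H(div) has continuous normal component across a facet follows by testing
  with smooth functions supported in the two adjacent cells.
\<close>

section \<open>The reference cell\<close>

text \<open>That trial and test space coincide rests on the two pullbacks. Temperatures are pulled
  back by composition; for vertical fields the Piola factor is \<open>m / (D * m) = 1 / D\<close>,
  the same on both sides of a facet, so continuity of the normal component is plain equality of
  reference values and the rigid lid is plain vanishing. Since \<open>D\<close> has no zero on the
  connected base, its sign is one constant for the column and drops out of the equation.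

  Definiteness has two regimes. When the pressure has positive vertical degree, its derivative alone
  controls \<open>U\<close> in each cell. In the lowest order that derivative is zero and only the
  jumps are left: they make \<open>U\<close> vanish on the facets, and since \<open>U\<close> then
  has vertical degree one, vanishing on two faces is enough.

  Membership in H(div) only provides an unknown square integrable divergence. After integration by
  parts the weak identity contains the values of the test function but not its gradient; so the
  cut-offs near a facet need only converge pointwise and boundedly, with no control of their
  derivatives.\<close>

definition pt :: "real^2 \<Rightarrow> real \<Rightarrow> real^3" where
  "pt u t = vector [u $ 1, u $ 2, t]"

lemma pt_nth [simp]: "pt u t $ 1 = u $ 1" "pt u t $ 2 = u $ 2" "pt u t $ 3 = t"
  by (simp_all add: pt_def)

lemma horiz_nth [simp]: "horiz y $ 1 = y $ 1" "horiz y $ 2 = y $ 2"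
  by (simp_all add: horiz_def)

lemma horiz_pt [simp]: "horiz (pt u t) = u"
  by (simp add: vec_eq_iff forall_2)

lemma pt_horiz [simp]: "pt (horiz y) (y $ 3) = y"
  by (simp add: vec_eq_iff forall_3)

lemma pt_eq_iff [simp]: "pt u t = pt v s \<longleftrightarrow> u = v \<and> t = s"
  by (metis horiz_pt pt_nth(3))

lemma vec3_eqI: "x $ 1 = y $ 1 \<Longrightarrow> x $ 2 = y $ 2 \<Longrightarrow> x $ 3 = y $ 3 \<Longrightarrow> x = (y::real^3)"
  by (simp add: vec_eq_iff forall_3)

lemma up_nth [simp]: "up $ 1 = 0" "up $ 2 = 0" "up $ 3 = 1"
  by (simp_all add: axis_def)

lemma pt_add_up: "pt u t + s *\<^sub>R up = pt u (t + s)"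
  by (rule vec3_eqI) simp_all

lemma pt_diff_up: "pt u t - up = pt u (t - 1)"
  by (rule vec3_eqI) simp_all

lemma linear_horiz: "linear horiz"
  by (rule linearI) (simp_all add: vec_eq_iff forall_2)

lemma horiz_add_up [simp]: "horiz (y + s *\<^sub>R up) = horiz y"
  by (simp add: vec_eq_iff forall_2)

lemma continuous_on_horiz [continuous_intros]:
  "continuous_on S f \<Longrightarrow> continuous_on S (\<lambda>x. horiz (f x))"
  by (rule bounded_linear.continuous_on[OF linear_horiz[unfolded linear_conv_bounded_linear]])

lemma pt_alt: "pt u t = u $ 1 *\<^sub>R axis 1 1 + u $ 2 *\<^sub>R axis 2 1 + t *\<^sub>R up"
  by (rule vec3_eqI) (simp_all add: axis_def)

lemma continuous_on_pt [continuous_intros]: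
  "continuous_on S f \<Longrightarrow> continuous_on S g \<Longrightarrow> continuous_on S (\<lambda>x. pt (f x) (g x))"
  unfolding pt_alt by (intro continuous_intros)

lemma surj_horiz: "surj horiz"
  by (rule surjI[of horiz "\<lambda>u. pt u 0"]) simp

lemma open_horiz_image: "open S \<Longrightarrow> open (horiz ` S)"
  by (rule open_surjective_linear_image[OF _ linear_horiz surj_horiz])

lemma Basis_real2: "(Basis :: (real^2) set) = {axis 1 1, axis 2 1}"
  by (auto simp: Basis_vec_def UNIV_2)

lemma ref_base_Triangle: "ref_base Triangle = convex hull (insert 0 Basis)"
  by (simp add: Basis_real2)

lemma compact_ref_base: "compact (ref_base S)"
proof (cases S)
  case Triangle
  then show ?thesis
    unfolding Triangle ref_base_Triangle
    by (intro compact_convex_hull finite_imp_compact) simp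
qed auto

lemma convex_ref_base: "convex (ref_base S)"
  by (cases S) (simp_all add: convex_box)

lemma interior_ref_base: "interior (ref_base S) \<noteq> {}"
proof (cases S)
  case Triangle
  then show ?thesis
    using interior_std_simplex_nonempty unfolding Triangle ref_base_Triangle by blast
next
  case Square
  have "(1/2::real) *\<^sub>R 1 \<in> box 0 (1::real^2)"
    by (auto simp: mem_box_cart)
  then show ?thesis unfolding Square by auto
qed

lemma corners_in_ref_base: "0 \<in> ref_base S" "axis 1 1 \<in> ref_base S" "axis 2 1 \<in> ref_base S"
  by (cases S; auto simp: hull_inc mem_box_cart axis_def)+

lemma corner_in_ref_base_Square: "1 \<in> ref_base Square"
  by (auto simp: mem_box_cart)

lemma ref_base_closure: "ref_base S \<subseteq> closure (interior (ref_base S))"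
  using convex_closure_interior[OF convex_ref_base interior_ref_base] closure_subset by blast

lemma ref_slice_iff [simp]: "y \<in> ref_slice B I \<longleftrightarrow> horiz y \<in> B \<and> y $ 3 \<in> I"
  by (simp add: ref_slice_def)

lemma ref_cell_iff: "y \<in> ref_cell S \<longleftrightarrow> horiz y \<in> ref_base S \<and> 0 \<le> y $ 3 \<and> y $ 3 \<le> 1"
  by (simp add: ref_cell_def)

lemma pt_in_ref_cell: "pt u t \<in> ref_cell S \<longleftrightarrow> u \<in> ref_base S \<and> 0 \<le> t \<and> t \<le> 1"
  by (simp add: ref_cell_iff)

lemma ref_cell_eq_image: "ref_cell S = (\<lambda>(u, t). pt u t) ` (ref_base S \<times> {0..1})"
proof (intro equalityI subsetI)
  fix y assume "y \<in> ref_cell S"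
  then have "(horiz y, y $ 3) \<in> ref_base S \<times> {0..1}" and "y = (\<lambda>(u, t). pt u t) (horiz y, y $ 3)"
    by (auto simp: ref_cell_iff)
  then show "y \<in> (\<lambda>(u, t). pt u t) ` (ref_base S \<times> {0..1})" by (rule rev_image_eqI)
qed (auto simp: ref_cell_iff)

lemma compact_ref_cell: "compact (ref_cell S)"
  unfolding ref_cell_eq_image case_prod_beta
  by (intro compact_continuous_image continuous_intros compact_Times compact_ref_base) auto

lemma convex_ref_cell: "convex (ref_cell S)"
proof -
  have "ref_cell S = horiz -` ref_base S \<inter> {y. axis 3 1 \<bullet> y \<le> 1} \<inter> {y. axis 3 1 \<bullet> y \<ge> 0}"
    by (auto simp: ref_cell_iff inner_axis' inner_axis)
  then show ?thesis
    by (simp only:) (intro convex_Int convex_halfspace_le convex_halfspace_ge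
        convex_linear_vimage linear_horiz convex_ref_base)
qed

text \<open>\<open>horiz\<close> is an open map, so it sends the interior of the cell into that of
  the base; moving a little along \<open>up\<close> in both directions gives the strict bounds.
  Conversely the right-hand side is open and lies in the cell.\<close>

lemma interior_ref_cell: "interior (ref_cell S) = {y. horiz y \<in> interior (ref_base S) \<and> 0 < y $ 3 \<and> y $ 3 < 1}"
proof (intro equalityI subsetI)
  fix y assume y: "y \<in> interior (ref_cell S)"
  have "horiz ` interior (ref_cell S) \<subseteq> ref_base S"
    using interior_subset by (fastforce simp: ref_cell_iff)
  then have "horiz ` interior (ref_cell S) \<subseteq> interior (ref_base S)"
    by (intro interior_maximal open_horiz_image open_interior)
  then have 1: "horiz y \<in> interior (ref_base S)" using y by blast
  obtain e where e: "e > 0" "ball y e \<subseteq> ref_cell S"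
    using y by (meson mem_interior)
  have "y + (e/2) *\<^sub>R up \<in> ball y e" "y + (- (e/2)) *\<^sub>R up \<in> ball y e"
    using e by (auto simp: dist_norm)
  then have "y + (e/2) *\<^sub>R up \<in> ref_cell S" "y + (- (e/2)) *\<^sub>R up \<in> ref_cell S"
    using e by blast+
  then have "y $ 3 + e/2 \<le> 1" "0 \<le> y $ 3 - e/2"
    by (auto simp: ref_cell_iff)
  then show "y \<in> {y. horiz y \<in> interior (ref_base S) \<and> 0 < y $ 3 \<and> y $ 3 < 1}" using 1 e by auto
next
  fix y assume y: "y \<in> {y. horiz y \<in> interior (ref_base S) \<and> 0 < y $ 3 \<and> y $ 3 < 1}"
  have "open {y. horiz y \<in> interior (ref_base S) \<and> 0 < y $ 3 \<and> y $ 3 < 1}"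
  proof -
    have "{y. horiz y \<in> interior (ref_base S) \<and> 0 < y $ 3 \<and> y $ 3 < 1}
       = horiz -` interior (ref_base S) \<inter> {y. 0 < y $ 3} \<inter> {y. y $ 3 < 1}" by auto
    moreover have "open (horiz -` interior (ref_base S))"
      by (intro open_vimage open_interior continuous_on_horiz continuous_on_id)
    ultimately show ?thesis
      by (auto intro!: open_Int open_Collect_less continuous_intros)
  qed
  moreover have "{y. horiz y \<in> interior (ref_base S) \<and> 0 < y $ 3 \<and> y $ 3 < 1} \<subseteq> ref_cell S"
    using interior_subset by (fastforce simp: ref_cell_iff)
  ultimately show "y \<in> interior (ref_cell S)" using y interior_maximal by blast
qed

lemma interior_ref_cell_ne: "interior (ref_cell S) \<noteq> {}"
proof -
  obtain u where "u \<in> interior (ref_base S)" using interior_ref_base by blast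
  then have "pt u (1/2) \<in> interior (ref_cell S)" by (simp add: interior_ref_cell)
  then show ?thesis by blast
qed

lemma ref_cell_closure: "closure (interior (ref_cell S)) = ref_cell S"
  using convex_closure_interior[OF convex_ref_cell interior_ref_cell_ne, of S]
    compact_imp_closed[OF compact_ref_cell, of S] by simp

lemma negligible_frontier_ref_cell: "negligible (ref_cell S - interior (ref_cell S))"
  using negligible_convex_frontier[OF convex_ref_cell, of S]
  by (simp add: frontier_def compact_imp_closed[OF compact_ref_cell])

text \<open>The interior of a convex body is dense in it, so continuity carries the value zero to
  the boundary. The hypotheses on the pressure hold on open sets, and this is how conclusions drawn
  there reach the closed base.\<close>

lemma ref_base_ext:
  assumes "continuous_on (ref_base S) f" and "\<And>u. u \<in> interior (ref_base S) \<Longrightarrow> f u = (0::real)"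
    and "u \<in> ref_base S"
  shows "f u = 0"
  using continuous_constant_on_closure[of "interior (ref_base S)" f 0 u]
    continuous_on_subset[OF assms(1)] assms
  by (metis closure_minimal compact_imp_closed compact_ref_base interior_subset ref_base_closure subsetD)

lemma ref_cell_ext:
  assumes "continuous_on (ref_cell S) f" and "\<And>u. u \<in> interior (ref_cell S) \<Longrightarrow> f u = (0::real)"
    and "u \<in> ref_cell S"
  shows "f u = 0"
  using continuous_constant_on_closure[of "interior (ref_cell S)" f 0 u] assms
  by (simp add: ref_cell_closure)

text \<open>Integrals over a face are written throughout as \<open>ref_int\<close> of a function
  that does not depend on the height; the reference interval has length one, so the value is that of
  the integral over the base.\<close>

lemma continuous_on_face:
  assumes "continuous_on (ref_cell S) f" "t = 0 \<or> t = 1"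
  shows "continuous_on (ref_cell S) (\<lambda>y. f (pt (horiz y) t))"
proof (rule continuous_on_compose2[OF assms(1)])
  show "continuous_on (ref_cell S) (\<lambda>y. pt (horiz y) t)" by (intro continuous_intros)
qed (use assms(2) in \<open>auto simp: pt_in_ref_cell ref_cell_iff\<close>)

section \<open>Integration over the reference cell\<close>

definition ref_int :: "base_shape \<Rightarrow> (real^3 \<Rightarrow> real) \<Rightarrow> real" where
  "ref_int S h = (LINT y:ref_cell S|lborel. h y)"

lemma set_integrable_ref_cell:
  "continuous_on (ref_cell S) (h::_\<Rightarrow>real) \<Longrightarrow> set_integrable lborel (ref_cell S) h"
  unfolding set_integrable_def by (rule borel_integrable_compact[OF compact_ref_cell])

lemma ref_int_cong: "(\<And>y. y \<in> ref_cell S \<Longrightarrow> h y = k y) \<Longrightarrow> ref_int S h = ref_int S k"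
  unfolding ref_int_def by (rule set_lebesgue_integral_cong) (auto simp: compact_ref_cell borel_compact)

lemma ref_int_add:
  assumes "continuous_on (ref_cell S) h" "continuous_on (ref_cell S) k"
  shows "ref_int S (\<lambda>y. h y + k y) = ref_int S h + ref_int S k"
  unfolding ref_int_def by (intro set_integral_add set_integrable_ref_cell assms)

lemma ref_int_diff:
  assumes "continuous_on (ref_cell S) h" "continuous_on (ref_cell S) k"
  shows "ref_int S (\<lambda>y. h y - k y) = ref_int S h - ref_int S k"
  unfolding ref_int_def by (intro set_integral_diff set_integrable_ref_cell assms)

lemma ref_int_cmult: "ref_int S (\<lambda>y. c * h y) = c * ref_int S h"
  unfolding ref_int_def by simp

lemma ref_int_0 [simp]: "ref_int S (\<lambda>y. 0) = 0"
  unfolding ref_int_def by simp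

lemma ref_int_zero: "(\<And>y. y \<in> ref_cell S \<Longrightarrow> h y = 0) \<Longrightarrow> ref_int S h = 0"
  using ref_int_cong[of S h "\<lambda>y. 0"] by simp

lemma ref_int_nonneg:
  assumes "\<And>y. y \<in> ref_cell S \<Longrightarrow> 0 \<le> h y"
  shows "0 \<le> ref_int S h"
  unfolding ref_int_def set_lebesgue_integral_def
  by (rule Bochner_Integration.integral_nonneg) (auto simp: indicator_def assms)

text \<open>A vanishing integral of a nonnegative function gives zero almost everywhere. The zero
  set is closed by continuity, and a closed set that contains almost all of an open set contains all
  of it; the boundary follows by density.\<close>

lemma ref_int_eq_0:
  assumes c: "continuous_on (ref_cell S) h" and nn: "\<And>y. y \<in> ref_cell S \<Longrightarrow> 0 \<le> h y"
    and 0: "ref_int S h = 0" and y: "y \<in> ref_cell S"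
  shows "h y = 0"
proof (rule ref_cell_ext[OF c _ y])
  fix x assume x: "x \<in> interior (ref_cell S)"
  have i: "integrable lborel (\<lambda>y. indicator (ref_cell S) y *\<^sub>R h y)"
    using set_integrable_ref_cell[OF c] unfolding set_integrable_def .
  have "AE y in lborel. indicator (ref_cell S) y *\<^sub>R h y = 0"
    using integral_nonneg_eq_0_iff_AE[OF i] 0 nn
    unfolding ref_int_def set_lebesgue_integral_def by (auto simp: indicator_def)
  then have AE: "AE y in lebesgue. indicator (ref_cell S) y *\<^sub>R h y = 0"
    by (rule AE_completion)
  let ?C = "{y \<in> ref_cell S. h y = 0}"
  have "closed ?C"
    using continuous_closed_preimage_constant[OF c compact_imp_closed[OF compact_ref_cell]] .
  then have "x \<in> ?C"
  proof (rule mem_closed_if_AE_lebesgue_open[OF open_interior _ _ x])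
    show "AE y\<in>interior (ref_cell S) in lebesgue. y \<in> ?C"
      using AE by eventually_elim (use interior_subset in \<open>fastforce\<close>)
  qed
  then show "h x = 0" by simp
qed

lemma measurable_pt: "(\<lambda>(u, t). pt u t) \<in> borel_measurable (borel \<Otimes>\<^sub>M borel)"
proof -
  have "continuous_on UNIV (\<lambda>p. pt (fst p) (snd p))" by (intro continuous_intros)
  then show ?thesis
    by (simp add: borel_prod case_prod_beta borel_measurable_continuous_onI)
qed

text \<open>Lebesgue measure is determined by its values on boxes, and the preimage of a box under
  \<open>pt\<close> is the product of a base box and an interval. This opens the way to Fubini in
  the vertical direction.\<close>

lemma lborel_pt: "distr (lborel \<Otimes>\<^sub>M lborel) borel (\<lambda>(u, t). pt u t) = lborel"
proof (rule lborel_eqI[symmetric])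
  fix l u :: "real^3" assume *: "\<And>b. b \<in> Basis \<Longrightarrow> l \<bullet> b \<le> u \<bullet> b"
  have le: "l $ i \<le> u $ i" for i using *[of "axis i 1"] by (simp add: inner_axis)
  have eq: "(\<lambda>(u, t). pt u t) -` box l u = box (horiz l) (horiz u) \<times> box (l $ 3) (u $ 3)"
    by (auto simp: mem_box_cart forall_3 forall_2)
  have B3: "(Basis :: (real^3) set) = {axis 1 1, axis 2 1, axis 3 1}"
    by (auto simp: Basis_vec_def UNIV_3)
  have ax: "axis 1 1 \<noteq> (axis 2 1::real^2)" "axis 1 1 \<noteq> (axis 2 1::real^3)"
      "axis 1 1 \<noteq> (axis 3 1::real^3)" "axis 2 1 \<noteq> (axis 3 1::real^3)"
    by (simp_all add: axis_eq_axis)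
  have "emeasure (distr (lborel \<Otimes>\<^sub>M lborel) borel (\<lambda>(u, t). pt u t)) (box l u)
      = emeasure (lborel \<Otimes>\<^sub>M lborel) (box (horiz l) (horiz u) \<times> box (l $ 3) (u $ 3))"
    using measurable_pt by (subst emeasure_distr) (auto simp: space_pair_measure eq
      cong: measurable_cong_sets)
  also have "\<dots> = emeasure lborel (box (horiz l) (horiz u)) * emeasure lborel (box (l $ 3) (u $ 3))"
    by (rule lborel.emeasure_pair_measure_Times) auto
  also have "\<dots> = ennreal (\<Prod>b\<in>Basis. (u - l) \<bullet> b)"
    using le ax by (simp add: emeasure_lborel_box_eq Basis_real2 B3 inner_axis algebra_simps
      flip: ennreal_mult')
  finally show "emeasure (distr (lborel \<Otimes>\<^sub>M lborel) borel (\<lambda>(u, t). pt u t)) (box l u)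
     = ennreal (\<Prod>b\<in>Basis. (u - l) \<bullet> b)" .
qed simp

lemma ref_int_Fubini:
  assumes c: "continuous_on (ref_cell S) h"
  shows "ref_int S h = (LINT u|lborel. indicator (ref_base S) u * (LINT t:{0..1}|lborel. h (pt u t)))"
proof -
  let ?k = "\<lambda>y. indicator (ref_cell S) y *\<^sub>R h y"
  have i: "integrable lborel ?k"
    using set_integrable_ref_cell[OF c] unfolding set_integrable_def .
  have m: "(\<lambda>(u, t). pt u t) \<in> lborel \<Otimes>\<^sub>M lborel \<rightarrow>\<^sub>M borel"
    using measurable_pt by (simp cong: measurable_cong_sets)
  have mk: "?k \<in> borel_measurable borel" using i by auto
  have i2: "integrable (lborel \<Otimes>\<^sub>M lborel) (\<lambda>p. ?k (pt (fst p) (snd p)))"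
    using integrable_distr[OF m, of ?k] i lborel_pt by (simp add: case_prod_beta)
  have "ref_int S h = integral\<^sup>L (distr (lborel \<Otimes>\<^sub>M lborel) borel (\<lambda>(u, t). pt u t)) ?k"
    unfolding ref_int_def set_lebesgue_integral_def lborel_pt ..
  also have "\<dots> = integral\<^sup>L (lborel \<Otimes>\<^sub>M lborel) (\<lambda>p. ?k (pt (fst p) (snd p)))"
    by (subst integral_distr[OF m mk]) (simp add: case_prod_beta)
  also have "\<dots> = (LINT u|lborel. LINT t|lborel. ?k (pt u t))"
    using lborel_pair.integral_fst'[OF i2] by simp
  also have "\<dots> = (LINT u|lborel. indicator (ref_base S) u * (LINT t:{0..1}|lborel. h (pt u t)))"
    unfolding set_lebesgue_integral_def
    by (intro Bochner_Integration.integral_cong refl, subst integral_mult_right_zero[symmetric])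
       (intro Bochner_Integration.integral_cong refl, auto simp: indicator_def pt_in_ref_cell)
  finally show ?thesis .
qed

text \<open>The fundamental theorem of calculus on each vertical line, integrated over the base by
  Fubini. Every integration by parts below goes through it; only the lower and upper faces
  contribute because the derivative is vertical.\<close>

lemma ref_int_vertical_derivative:
  assumes der: "\<And>u t. u \<in> ref_base S \<Longrightarrow> 0 \<le> t \<Longrightarrow> t \<le> 1 \<Longrightarrow>
      ((\<lambda>s. H (pt u s)) has_real_derivative H' (pt u t)) (at t)"
    and c: "continuous_on (ref_cell S) H" and c': "continuous_on (ref_cell S) H'"
  shows "ref_int S H' = ref_int S (\<lambda>y. H (pt (horiz y) 1)) - ref_int S (\<lambda>y. H (pt (horiz y) 0))"
proof -
  have *: "(LINT t:{0..1}|lborel. H' (pt u t)) = H (pt u 1) - H (pt u 0)" if u: "u \<in> ref_base S" for u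
  proof -
    have "continuous_on {0..1} (\<lambda>t. H' (pt u t))"
      by (rule continuous_on_compose2[OF c']) (use u in \<open>auto simp: pt_in_ref_cell intro!: continuous_intros\<close>)
    then have "integral\<^sup>L lborel (\<lambda>x. indicator {0..1} x *\<^sub>R H' (pt u x)) = H (pt u 1) - H (pt u 0)"
      by (intro integral_FTC_Icc) (use der[OF u] in \<open>auto intro: DERIV_subset
         simp flip: has_real_derivative_iff_has_vector_derivative\<close>)
    then show ?thesis by (simp add: set_lebesgue_integral_def)
  qed
  have "ref_int S H' = (LINT u|lborel. indicator (ref_base S) u * (H (pt u 1) - H (pt u 0)))"
    unfolding ref_int_Fubini[OF c']
    by (intro Bochner_Integration.integral_cong refl) (auto simp: * indicator_def)
  also have "\<dots> = ref_int S (\<lambda>y. H (pt (horiz y) 1) - H (pt (horiz y) 0))"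
    by (subst ref_int_Fubini) (auto intro!: continuous_on_diff continuous_on_face c simp: set_lebesgue_integral_def)
  finally show ?thesis by (simp add: ref_int_diff continuous_on_face c)
qed

section \<open>Smooth functions and test functions\<close>

text \<open>The invariant for coinduction on \<open>smooth\<close>. The product rule turns a
  derivative into a sum of products, so a class closed under products and partial derivatives has to
  contain sums too; it is then enough to check the partial derivatives of the generators.\<close>

inductive smooth_algebra :: "('a::euclidean_space \<Rightarrow> real) set \<Rightarrow> ('a \<Rightarrow> real) \<Rightarrow> bool"
  for S where
  base: "f \<in> S \<Longrightarrow> smooth_algebra S f"
| const: "smooth_algebra S (\<lambda>x. c)"
| add: "smooth_algebra S f \<Longrightarrow> smooth_algebra S g \<Longrightarrow> smooth_algebra S (\<lambda>x. f x + g x)"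
| mult: "smooth_algebra S f \<Longrightarrow> smooth_algebra S g \<Longrightarrow> smooth_algebra S (\<lambda>x. f x * g x)"

lemma smooth_algebra_smooth:
  assumes S: "\<And>f x. f \<in> S \<Longrightarrow> f differentiable (at x)"
    "\<And>f b. f \<in> S \<Longrightarrow> b \<in> Basis \<Longrightarrow> smooth_algebra S (\<lambda>x. frechet_derivative f (at x) b)"
  and f: "smooth_algebra S f"
  shows "smooth f"
proof -
  have *: "(\<forall>x. f differentiable (at x)) \<and> (\<forall>b\<in>Basis. smooth_algebra S (\<lambda>x. frechet_derivative f (at x) b))"
    if "smooth_algebra S f" for f
    using that
  proof induction
    case (base f)
    then show ?case using S by blast
  next
    case (const c)
    have "(\<lambda>x. frechet_derivative (\<lambda>x. c) (at x) b) = (\<lambda>x. 0)" for b :: 'a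
      by (simp add: frechet_derivative_const)
    then show ?case by (auto intro: smooth_algebra.const)
  next
    case (add f g)
    have d: "((\<lambda>x. f x + g x) has_derivative
        (\<lambda>h. frechet_derivative f (at x) h + frechet_derivative g (at x) h)) (at x)" for x
      using add.IH by (intro has_derivative_add) (auto simp flip: frechet_derivative_works)
    have "(\<lambda>x. frechet_derivative (\<lambda>x. f x + g x) (at x) b)
        = (\<lambda>x. frechet_derivative f (at x) b + frechet_derivative g (at x) b)" for b
      using frechet_derivative_at[OF d, symmetric] by (intro ext) simp
    then show ?case using d add.IH by (auto intro: smooth_algebra.add simp: differentiable_def)
  next
    case (mult f g)
    have d: "((\<lambda>x. f x * g x) has_derivative
        (\<lambda>h. f x * frechet_derivative g (at x) h + frechet_derivative f (at x) h * g x)) (at x)" for x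
      using mult.IH by (intro has_derivative_mult) (auto simp flip: frechet_derivative_works)
    have "(\<lambda>x. frechet_derivative (\<lambda>x. f x * g x) (at x) b)
        = (\<lambda>x. f x * frechet_derivative g (at x) b + frechet_derivative f (at x) b * g x)" for b
      using frechet_derivative_at[OF d, symmetric] by (intro ext) simp
    then show ?case using d mult
      by (auto intro!: smooth_algebra.add smooth_algebra.mult simp: differentiable_def)
  qed
  show ?thesis
    using f by (coinduction arbitrary: f) (use * in blast)
qed

lemma smooth_differentiable: "smooth f \<Longrightarrow> f differentiable (at x)"
  by (erule smooth.cases) blast

lemma smooth_partial: "smooth f \<Longrightarrow> b \<in> Basis \<Longrightarrow> smooth (\<lambda>x. frechet_derivative f (at x) b)"
  by (erule smooth.cases) blast

lemma smooth_algebra_Collect_smooth: "smooth_algebra (Collect smooth) f \<Longrightarrow> smooth f"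
  by (rule smooth_algebra_smooth[of "Collect smooth"])
    (auto intro: smooth_algebra.base smooth_differentiable smooth_partial)

lemma smooth_const: "smooth (\<lambda>x. c)"
  by (intro smooth_algebra_Collect_smooth smooth_algebra.const)

lemma smooth_add: "smooth f \<Longrightarrow> smooth g \<Longrightarrow> smooth (\<lambda>x. f x + g x)"
  by (intro smooth_algebra_Collect_smooth smooth_algebra.add smooth_algebra.base) auto

lemma smooth_mult: "smooth f \<Longrightarrow> smooth g \<Longrightarrow> smooth (\<lambda>x. f x * g x)"
  by (intro smooth_algebra_Collect_smooth smooth_algebra.mult smooth_algebra.base) auto

lemma smooth_one_minus: "smooth f \<Longrightarrow> smooth (\<lambda>x. 1 - f x)"
  using smooth_add[OF smooth_const[of 1] smooth_mult[OF smooth_const[of "-1"], of f]] by simp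

lemma smooth_prod: "(\<And>i. i \<in> I \<Longrightarrow> smooth (f i)) \<Longrightarrow> smooth (\<lambda>x. \<Prod>i\<in>I. f i x)"
  by (induction I rule: infinite_finite_induct) (simp_all add: smooth_const smooth_mult)

lemma smooth_continuous_on: "smooth f \<Longrightarrow> continuous_on S f"
  by (simp add: continuous_at_imp_continuous_on differentiable_imp_continuous_within smooth_differentiable)

text \<open>The classical function \<open>exp (- 1 / t)\<close>, extended by zero. The powers in the
  denominator make the family closed under differentiation up to linear combinations, as
  \<open>DERIV_flat\<close> shows, so its affine pullbacks can generate a
  \<open>smooth_algebra\<close>.\<close>

definition flat :: "nat \<Rightarrow> real \<Rightarrow> real" where
  "flat k t = (if t > 0 then exp (- 1 / t) / t ^ k else 0)"

lemma flat_nonneg: "0 \<le> flat k t"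
  by (simp add: flat_def)

text \<open>The inequality \<open>(1 + x / n) ^ n \<le> exp x\<close> at \<open>x = 1 / t\<close>
  and \<open>n = k + 2\<close> provides two powers of \<open>t\<close> more than the denominator
  takes. A quadratic bound suffices for the derivative at 0.\<close>

lemma flat_le_square:
  "flat k t \<le> (real (k + 2)) ^ (k + 2) * t\<^sup>2"
proof (cases "t > 0")
  case True
  define n where "n = k + 2"
  have n: "real n > 0" by (simp add: n_def)
  have "(1 / t / real n) ^ n \<le> (1 + 1 / t / real n) ^ n"
    using True by (intro power_mono) auto
  also have "\<dots> \<le> exp (1 / t)"
    using True n by (intro exp_ge_one_plus_x_over_n_power_n) (auto intro: order_trans[of _ 0])
  finally have "(1 / t / real n) ^ n * (t * real n) ^ n \<le> exp (1 / t) * (t * real n) ^ n"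
    using True by (intro mult_right_mono) auto
  moreover have "(1 / t / real n) ^ n * (t * real n) ^ n = 1"
    using True n by (simp flip: power_mult_distrib)
  ultimately have "exp (- 1 / t) \<le> (t * real n) ^ n"
    by (simp add: exp_minus field_simps)
  also have "\<dots> = real n ^ n * t\<^sup>2 * t ^ k"
    by (simp add: power_mult_distrib power_add n_def power2_eq_square mult_ac del: of_nat_add)
  finally show ?thesis using True by (simp add: flat_def pos_divide_le_eq n_def)
qed (simp add: flat_def)

lemma DERIV_flat:
  "(flat k has_real_derivative (flat (k + 2) t - k * flat (k + 1) t)) (at t)"
proof -
  consider "t > 0" | "t < 0" | "t = 0" by linarith
  then show ?thesis
  proof cases
    case 1
    have "((\<lambda>t. exp (- 1 / t) / t ^ k) has_real_derivative
        (exp (- 1 / t) * (1 / t\<^sup>2) * t ^ k - exp (- 1 / t) * (real k * t ^ (k - 1))) / (t ^ k * t ^ k)) (at t)"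
      using 1 by (auto intro!: derivative_eq_intros simp: power2_eq_square)
    moreover have kt: "real k * t ^ (k - 1) = real k * t ^ k / t"
      using 1 by (cases k) auto
    moreover have "(exp (- 1 / t) * (1 / t\<^sup>2) * t ^ k - exp (- 1 / t) * (real k * t ^ (k - 1))) / (t ^ k * t ^ k)
        = flat (k + 2) t - k * flat (k + 1) t"
      unfolding right_diff_distrib kt by (use 1 in \<open>simp add: flat_def field_simps power2_eq_square\<close>)
    ultimately have "((\<lambda>t. exp (- 1 / t) / t ^ k) has_real_derivative (flat (k + 2) t - k * flat (k + 1) t)) (at t)"
      by simp
    then show ?thesis
      by (rule DERIV_cong_ev[THEN iffD1, rotated -1])
        (use 1 in \<open>auto intro!: eventually_mono[OF eventually_nhds_in_open[of "{0<..}"]] simp: flat_def\<close>)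
  next
    case 2
    have "((\<lambda>t. 0) has_real_derivative (flat (k + 2) t - k * flat (k + 1) t)) (at t)"
      using 2 by (simp add: flat_def)
    then show ?thesis
      by (rule DERIV_cong_ev[THEN iffD1, rotated -1])
        (use 2 in \<open>auto intro!: eventually_mono[OF eventually_nhds_in_open[of "{..<0}"]] simp: flat_def\<close>)
  next
    case 3
    have "((\<lambda>h. flat k h / h) \<longlongrightarrow> 0) (at 0)"
    proof (rule Lim_null_comparison)
      show "\<forall>\<^sub>F h in at 0. norm (flat k h / h) \<le> (real (k + 2)) ^ (k + 2) * \<bar>h\<bar>"
      proof (intro always_eventually allI)
        fix h :: real
        have "\<bar>flat k h\<bar> \<le> (real (k + 2)) ^ (k + 2) * \<bar>h\<bar> * \<bar>h\<bar>"
          using flat_le_square[of k h] flat_nonneg[of k h] by (simp add: power2_eq_square mult.assoc)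
        then show "norm (flat k h / h) \<le> (real (k + 2)) ^ (k + 2) * \<bar>h\<bar>"
          by (cases "h = 0") (simp_all add: divide_simps)
      qed
      show "((\<lambda>h. (real (k + 2)) ^ (k + 2) * \<bar>h\<bar>) \<longlongrightarrow> 0) (at 0)"
        by (auto intro!: tendsto_eq_intros)
    qed
    then show ?thesis using 3 by (simp add: DERIV_def flat_def)
  qed
qed

lemma smooth_flat_affine: "smooth (\<lambda>x. flat k (x \<bullet> v + c))"
proof -
  let ?S = "{\<lambda>x. flat k (x \<bullet> v + c) | k (v::'a) c. True}"
  have d: "((\<lambda>x. flat k (x \<bullet> v + c)) has_derivative
      (\<lambda>h. (h \<bullet> v) * (flat (k + 2) (x \<bullet> v + c) + (- real k) * flat (k + 1) (x \<bullet> v + c)))) (at x)"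
      for k c and v x :: 'a
    by (rule has_derivative_eq_rhs[OF has_derivative_compose[OF _ DERIV_flat[unfolded has_field_derivative_def],
         of "\<lambda>x. x \<bullet> v + c" "\<lambda>h. h \<bullet> v"]])
       (auto intro!: derivative_eq_intros simp: algebra_simps)
  show ?thesis
  proof (rule smooth_algebra_smooth[of ?S])
    fix f :: "'a \<Rightarrow> real" and x assume "f \<in> ?S"
    then show "f differentiable at x" using d unfolding differentiable_def by blast
  next
    fix f :: "'a \<Rightarrow> real" and b :: 'a assume "f \<in> ?S"
    then obtain k v c where f: "f = (\<lambda>x. flat k (x \<bullet> v + c))" by blast
    have "(\<lambda>x. frechet_derivative f (at x) b)
      = (\<lambda>x. (b \<bullet> v) * (flat (k + 2) (x \<bullet> v + c) + (- real k) * flat (k + 1) (x \<bullet> v + c)))"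
      unfolding f using frechet_derivative_at[OF d, symmetric] by (intro ext) simp
    moreover have "smooth_algebra ?S (\<lambda>x. flat j (x \<bullet> v + c))" for j
      by (rule smooth_algebra.base) blast
    ultimately show "smooth_algebra ?S (\<lambda>x. frechet_derivative f (at x) b)"
      by (simp only:) (intro smooth_algebra.mult smooth_algebra.add smooth_algebra.const)
  qed (rule smooth_algebra.base, blast)
qed

text \<open>For every \<open>r > 0\<close> this is positive exactly on the open box. Growing
  \<open>r\<close> steepens it: each factor \<open>exp (- 1 / (r * s))\<close> with
  \<open>s > 0\<close> tends to 1, so the bumps converge pointwise to the indicator of the
  box.\<close>

definition box_bump :: "real \<Rightarrow> 'a::euclidean_space \<Rightarrow> 'a \<Rightarrow> 'a \<Rightarrow> real" where
  "box_bump r a c x = (\<Prod>b\<in>Basis. flat 0 (r * (x \<bullet> b - a \<bullet> b)) * flat 0 (r * (c \<bullet> b - x \<bullet> b)))"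

lemma smooth_box_bump: "smooth (box_bump r a c)"
proof -
  have "smooth (\<lambda>x. \<Prod>b\<in>Basis. flat 0 (x \<bullet> (r *\<^sub>R b) + - r * (a \<bullet> b)) * flat 0 (x \<bullet> (- r *\<^sub>R b) + r * (c \<bullet> b)))"
    by (intro smooth_prod smooth_mult smooth_flat_affine)
  also have "(\<lambda>x. \<Prod>b\<in>Basis. flat 0 (x \<bullet> (r *\<^sub>R b) + - r * (a \<bullet> b)) * flat 0 (x \<bullet> (- r *\<^sub>R b) + r * (c \<bullet> b)))
     = box_bump r a c"
    by (simp add: box_bump_def fun_eq_iff algebra_simps)
  finally show ?thesis .
qed

lemma flat_0_le_1: "flat 0 t \<le> 1"
  by (simp add: flat_def)

lemma box_bump_bounds: "0 \<le> box_bump r a c x" "box_bump r a c x \<le> 1"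
  unfolding box_bump_def
  by (auto intro!: prod_nonneg prod_le_1 mult_le_one simp: flat_nonneg flat_0_le_1)

lemma box_bump_pos_iff: "0 < r \<Longrightarrow> 0 < box_bump r a c x \<longleftrightarrow> x \<in> box a c"
proof -
  assume r: "0 < r"
  have f: "flat 0 t \<noteq> 0 \<longleftrightarrow> 0 < t" for t by (simp add: flat_def)
  have "0 < box_bump r a c x \<longleftrightarrow> box_bump r a c x \<noteq> 0"
    using box_bump_bounds(1)[of r a c x] by linarith
  also have "\<dots> \<longleftrightarrow> (\<forall>b\<in>Basis. 0 < r * (x \<bullet> b - a \<bullet> b) \<and> 0 < r * (c \<bullet> b - x \<bullet> b))"
    by (simp add: box_bump_def f)
  also have "\<dots> \<longleftrightarrow> x \<in> box a c"
    using r by (simp add: mem_box zero_less_mult_iff)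
  finally show ?thesis .
qed

lemma box_bump_outside: "0 < r \<Longrightarrow> x \<notin> box a c \<Longrightarrow> box_bump r a c x = 0"
  using box_bump_pos_iff[of r a c x] box_bump_bounds(1)[of r a c x] by linarith

lemma box_bump_tendsto:
  fixes x :: "'a::euclidean_space"
  assumes "x \<in> box a c"
  shows "(\<lambda>m. box_bump (real m) a c x) \<longlonglongrightarrow> 1"
proof -
  have *: "(\<lambda>m. flat 0 (real m * s)) \<longlonglongrightarrow> 1" if s: "s > 0" for s
  proof -
    have "(\<lambda>m. - 1 / (real m * s)) \<longlonglongrightarrow> 0"
      using lim_const_over_n[of "- 1 / s"] by (simp add: field_simps)
    then have "(\<lambda>m. exp (- 1 / (real m * s))) \<longlonglongrightarrow> exp 0"
      by (rule tendsto_exp)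
    moreover have "\<forall>\<^sub>F m in sequentially. exp (- 1 / (real m * s)) = flat 0 (real m * s)"
      using s by (intro eventually_mono[OF eventually_gt_at_top[of 0]]) (simp add: flat_def)
    ultimately show ?thesis using Lim_transform_eventually by fastforce
  qed
  have "(\<lambda>m. box_bump (real m) a c x) \<longlonglongrightarrow> (\<Prod>b\<in>(Basis::'a set). 1 * 1)"
    unfolding box_bump_def by (intro tendsto_prod tendsto_mult *) (use assms in \<open>auto simp: mem_box\<close>)
  then show ?thesis by simp
qed

section \<open>Test functions and approximation of indicators\<close>

lemma test_function_smooth: "test_function U \<phi> \<Longrightarrow> smooth \<phi>"
  by (simp add: test_function_def)

lemma test_function_mono: "test_function U \<phi> \<Longrightarrow> U \<subseteq> V \<Longrightarrow> test_function V \<phi>"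
  unfolding test_function_def by blast

lemma test_function_outside: "test_function U \<phi> \<Longrightarrow> x \<notin> U \<Longrightarrow> \<phi> x = 0"
  unfolding test_function_def by blast

lemma test_function_mult: "test_function U \<phi> \<Longrightarrow> smooth \<psi> \<Longrightarrow> test_function U (\<lambda>x. \<phi> x * \<psi> x)"
  unfolding test_function_def by (auto intro: smooth_mult)

lemma test_function_bounded:
  assumes "test_function U \<phi>"
  obtains B where "B > 0" "\<And>x. \<bar>\<phi> x\<bar> \<le> B"
proof -
  obtain C where C: "compact C" "\<And>x. x \<notin> C \<Longrightarrow> \<phi> x = 0"
    using assms by (auto simp: test_function_def)
  have "bounded (\<phi> ` C)"
    using C(1) assms by (intro compact_imp_bounded compact_continuous_image smooth_continuous_on)
      (auto simp: test_function_def)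
  then obtain B where "B > 0" "\<And>x. x \<in> C \<Longrightarrow> \<bar>\<phi> x\<bar> \<le> B"
    unfolding bounded_pos by auto
  then show ?thesis using C(2) that[of B] by (metis abs_zero less_eq_real_def)
qed

lemma test_function_box_bump:
  assumes "0 < r" "cbox a c \<subseteq> U"
  shows "test_function U (box_bump r a c)"
  unfolding test_function_def
  using assms box_subset_cbox by (auto intro!: smooth_box_bump exI[of _ "cbox a c"] box_bump_outside)

text \<open>Lindelof's theorem, applied to the open boxes whose closed boxes lie in
  \<open>U\<close>; these closed boxes will be the compact supports.\<close>

lemma open_eq_Union_boxes:
  fixes U :: "'a::euclidean_space set"
  assumes "open U"
  shows "\<exists>a c :: nat \<Rightarrow> 'a. (\<forall>j. cbox (a j) (c j) \<subseteq> U) \<and> (\<Union>j. box (a j) (c j)) = U"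
proof -
  let ?F = "{box a c | a c. cbox a c \<subseteq> U}"
  obtain F where F: "F \<subseteq> ?F" "countable F" "\<Union>F = \<Union>?F"
    by (rule Lindelof[of ?F]) (auto simp: open_box)
  have U: "\<Union>?F = U"
  proof (intro equalityI subsetI)
    fix x assume "x \<in> U"
    with assms obtain a c where "cbox a c \<subseteq> U" "x \<in> box a c"
      using open_contains_cbox by metis
    then show "x \<in> \<Union>?F" by blast
  qed (use box_subset_cbox in blast)
  \<comment> \<open>An enumeration by the naturals needs a nonempty family, also when
    \<open>U\<close> is empty; the empty box serves as filler.\<close>
  have e: "{} \<in> ?F"
  proof -
    have "box One (0::'a) = {}" "cbox One (0::'a) = {}"
      using nonempty_Basis by (auto simp: box_eq_empty ex_in_conv)
    then show ?thesis by force
  qed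
  let ?G = "insert {} F"
  have r: "range (from_nat_into ?G) = ?G"
    using F(2) by (intro range_from_nat_into) auto
  then have "\<exists>a c. from_nat_into ?G j = box a c \<and> cbox a c \<subseteq> U" for j
    using F(1) e by blast
  then obtain a c where ac: "\<And>j. from_nat_into ?G j = box (a j) (c j)" "\<And>j. cbox (a j) (c j) \<subseteq> U"
    by metis
  have "(\<Union>j. box (a j) (c j)) = \<Union>(range (from_nat_into ?G))"
    by (simp add: ac(1))
  then have "(\<Union>j. box (a j) (c j)) = U"
    using r F(3) U by simp
  with ac(2) show ?thesis by auto
qed

text \<open>The bumps of the first \<open>m\<close> boxes are united as probabilities of independent
  events are: 1 minus the product of the complements. The result stays between 0 and 1, is supported
  in finitely many closed boxes, and at a point of \<open>U\<close> the factor of a single box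
  around it already forces the product to 0.\<close>

lemma smooth_indicator_approx:
  fixes U :: "'a::euclidean_space set"
  assumes "open U"
  obtains \<eta> :: "nat \<Rightarrow> 'a \<Rightarrow> real" where "\<And>m. test_function U (\<eta> m)"
    "\<And>m x. 0 \<le> \<eta> m x" "\<And>m x. \<eta> m x \<le> 1" "\<And>x. (\<lambda>m. \<eta> m x) \<longlonglongrightarrow> indicator U x"
proof -
  obtain a c :: "nat \<Rightarrow> 'a" where ac': "(\<forall>j. cbox (a j) (c j) \<subseteq> U) \<and> (\<Union>j. box (a j) (c j)) = U"
    using open_eq_Union_boxes[OF assms] by (elim exE) (rule that)
  then have ac: "\<And>j. cbox (a j) (c j) \<subseteq> U" "(\<Union>j. box (a j) (c j)) = U" by simp_all
  define \<eta> where "\<eta> m x = 1 - (\<Prod>j<m. 1 - box_bump (real m) (a j) (c j) x)" for m x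
  have out: "\<eta> m x = 0" if "x \<notin> (\<Union>j<m. box (a j) (c j))" for m x
    using that by (auto simp: \<eta>_def box_bump_outside)
  have le: "0 \<le> (\<Prod>j<m. 1 - box_bump (real m) (a j) (c j) x)"
    "(\<Prod>j<m. 1 - box_bump (real m) (a j) (c j) x) \<le> 1" for m x
    by (auto intro!: prod_nonneg prod_le_1 simp: box_bump_bounds)
  show ?thesis
  proof
    fix m
    have "smooth (\<eta> m)"
      unfolding \<eta>_def by (intro smooth_one_minus smooth_prod smooth_box_bump)
    moreover have "compact (\<Union>j<m. cbox (a j) (c j))" by (intro compact_UN) auto
    moreover have "(\<Union>j<m. cbox (a j) (c j)) \<subseteq> U" using ac(1) by blast
    moreover have "\<eta> m x = 0" if "x \<notin> (\<Union>j<m. cbox (a j) (c j))" for x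
      using out[of x m] that box_subset_cbox by blast
    ultimately show "test_function U (\<eta> m)" unfolding test_function_def by blast
  next
    fix m x
    show "0 \<le> \<eta> m x" "\<eta> m x \<le> 1" using le[of m x] by (auto simp: \<eta>_def)
  next
    fix x
    show "(\<lambda>m. \<eta> m x) \<longlonglongrightarrow> indicator U x"
    proof (cases "x \<in> U")
      case True
      then obtain i where i: "x \<in> box (a i) (c i)" using ac(2) by blast
      have "(\<lambda>m. \<Prod>j<m. 1 - box_bump (real m) (a j) (c j) x) \<longlonglongrightarrow> 0"
      proof (rule Lim_null_comparison)
        have "(\<Prod>j<m. 1 - box_bump (real m) (a j) (c j) x) \<le> 1 - box_bump (real m) (a i) (c i) x" if "m > i" for m
        proof -
          have "(\<Prod>j<m. 1 - box_bump (real m) (a j) (c j) x)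
             = (1 - box_bump (real m) (a i) (c i) x) * (\<Prod>j\<in>{..<m} - {i}. 1 - box_bump (real m) (a j) (c j) x)"
            using that by (subst prod.remove[of _ i]) auto
          also have "\<dots> \<le> (1 - box_bump (real m) (a i) (c i) x) * 1"
            by (intro mult_left_mono prod_le_1) (auto simp: box_bump_bounds)
          finally show ?thesis by simp
        qed
        then show "\<forall>\<^sub>F m in sequentially. norm (\<Prod>j<m. 1 - box_bump (real m) (a j) (c j) x)
            \<le> 1 - box_bump (real m) (a i) (c i) x"
          using le by (intro eventually_mono[OF eventually_gt_at_top[of i]]) auto
        show "(\<lambda>m. 1 - box_bump (real m) (a i) (c i) x) \<longlonglongrightarrow> 0"
          using tendsto_diff[OF tendsto_const box_bump_tendsto[OF i], of 1] by simp
      qed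
      then show ?thesis
        using True tendsto_diff[OF tendsto_const, of _ 0 sequentially 1] by (simp add: \<eta>_def)
    next
      case False
      then have "\<eta> m x = 0" for m using out[of x m] ac(2) by auto
      then show ?thesis using False by simp
    qed
  qed
qed

section \<open>Linear problems on finite-dimensional spaces\<close>

text \<open>Gram-Schmidt by induction on the spanning set. The functional is left general because
  the induction hypothesis is applied twice, to \<open>L\<close> and to \<open>a v\<close>.
  Definiteness is asked only modulo the radical: a vector with \<open>a x x = 0\<close> is
  orthogonal to all others and \<open>L\<close> kills it.\<close>

lemma (in vector_space) representer_on_span:
  fixes a :: "'b \<Rightarrow> 'b \<Rightarrow> 'a" and L :: "'b \<Rightarrow> 'a"
  assumes V: "subspace V"
    and add: "\<And>x y z. x \<in> V \<Longrightarrow> y \<in> V \<Longrightarrow> z \<in> V \<Longrightarrow> a (x + y) z = a x z + a y z"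
    and scale: "\<And>c x z. x \<in> V \<Longrightarrow> z \<in> V \<Longrightarrow> a (scale c x) z = c * a x z"
    and sym: "\<And>x y. x \<in> V \<Longrightarrow> y \<in> V \<Longrightarrow> a x y = a y x"
    and null: "\<And>x z. x \<in> V \<Longrightarrow> z \<in> V \<Longrightarrow> a x x = 0 \<Longrightarrow> a z x = 0"
    and T: "finite T" "T \<subseteq> V"
    and L: "\<And>x y. x \<in> V \<Longrightarrow> y \<in> V \<Longrightarrow> L (x + y) = L x + L y"
      "\<And>c x. x \<in> V \<Longrightarrow> L (scale c x) = c * L x" "\<And>x. x \<in> V \<Longrightarrow> a x x = 0 \<Longrightarrow> L x = 0"
  shows "\<exists>u\<in>span T. \<forall>v\<in>span T. a u v = L v"
  using T L
proof (induction T arbitrary: L rule: finite_induct)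
  case empty
  have "0 \<in> V" using V by (rule subspace_0)
  then have "L 0 = 0" "a 0 0 = 0" using empty.prems(3)[of 0 0] scale[of 0 0 0] empty.prems(3)[of 0 0]
    using empty.prems(2)[of 0 0] L(2)[of 0 0] empty by auto
  then show ?case by simp
next
  case (insert v T)
  have vV: "v \<in> V" and TV: "T \<subseteq> V" using insert.prems by auto
  have sV: "x \<in> V" if "x \<in> span T" for x
    using that span_minimal[OF TV V] by blast
  have aR: "a z (x + y) = a z x + a z y" if "x \<in> V" "y \<in> V" "z \<in> V" for x y z
    using add that sym subspace_add[OF V] by metis
  have sR: "a z (scale c x) = c * a z x" if "x \<in> V" "z \<in> V" for c x z
    using scale that sym subspace_scale[OF V] by metis
  obtain u0 where u0: "u0 \<in> span T" "\<And>x. x \<in> span T \<Longrightarrow> a u0 x = L x"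
    using insert.IH[of L] TV insert.prems by metis
  \<comment> \<open>Applied to the functional \<open>a v\<close>, the induction hypothesis yields an
    orthogonal projection \<open>p\<close> of \<open>v\<close> onto \<open>span T\<close>.\<close>
  have "\<exists>p\<in>span T. \<forall>x\<in>span T. a p x = a v x"
    by (rule insert.IH[OF TV]) (auto simp: aR sR vV null)
  then obtain p where p: "p \<in> span T" "\<And>x. x \<in> span T \<Longrightarrow> a p x = a v x" by blast
  define r where "r = v - p"
  have rV: "r \<in> V" and pV: "p \<in> V" unfolding r_def using sV p vV subspace_diff[OF V] by auto
  have v_eq: "v = r + p" by (simp add: r_def)
  have r0: "a r x = 0" if "x \<in> span T" for x
  proof -
    have "a v x = a r x + a p x" unfolding v_eq using add[OF rV pV] sV that by blast
    then show ?thesis using p that by simp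
  qed
  have dec: "\<exists>k. \<exists>y\<in>span T. x = scale k r + y" if x: "x \<in> span (insert v T)" for x
  proof -
    obtain k where k: "x - scale k v \<in> span T" using x span_breakdown_eq by blast
    have "x = scale k r + (scale k p + (x - scale k v))"
      by (simp add: r_def scale_right_diff_distrib)
    moreover have "scale k p + (x - scale k v) \<in> span T"
      using k p by (intro span_add span_scale)
    ultimately show ?thesis by blast
  qed
  have ins: "span T \<subseteq> span (insert v T)" by (intro span_mono) auto
  have rS: "r \<in> span (insert v T)"
    unfolding r_def using ins p by (intro span_diff) (auto intro: span_base)
  show ?case
  proof (cases "a r r = 0")
    \<comment> \<open>Here \<open>r\<close> lies in the radical, so the solution on the smaller span
      still serves.\<close>
    case True
    have "a u0 x = L x" if x: "x \<in> span (insert v T)" for x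
    proof -
      obtain k y where y: "y \<in> span T" "x = scale k r + y" using dec[OF x] by blast
      have "a u0 x = k * a u0 r + a u0 y"
        using y aR sR sV rV u0 subspace_scale[OF V] by simp
      also have "\<dots> = L y" using r0[OF u0(1)] sym[of u0 r] sV u0 rV y by simp
      also have "\<dots> = L x"
        using insert.prems y rV sV True subspace_scale[OF V] by simp
      finally show ?thesis .
    qed
    then show ?thesis using u0 ins by blast
  next
    case False
    \<comment> \<open>The coefficient is the one that gives \<open>a ?u r = L r\<close>;
      orthogonality of \<open>r\<close> to \<open>span T\<close> leaves the values there
      unchanged.\<close>
    let ?u = "u0 + scale (L r / a r r) r"
    have "a ?u x = L x" if x: "x \<in> span (insert v T)" for x
    proof -
      obtain k y where y: "y \<in> span T" "x = scale k r + y" using dec[OF x] by blast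
      have xV: "x \<in> V" using y sV rV subspace_scale[OF V] subspace_add[OF V] by simp
      have 1: "a u0 x = k * a u0 r + a u0 y" "a r x = k * a r r + a r y"
        using y aR sR sV rV u0 subspace_scale[OF V] by simp_all
      have "a u0 r = 0" using r0[OF u0(1)] sym[of u0 r] sV u0 rV by simp
      then have 2: "a u0 x = L y" "a r x = k * a r r" using 1 r0 u0 y by simp_all
      have "a ?u x = a u0 x + (L r / a r r) * a r x"
        using add scale u0 sV rV xV subspace_scale[OF V] by simp
      also have "\<dots> = L y + k * L r" using False 2 by simp
      also have "\<dots> = L x"
        using insert.prems y rV sV subspace_scale[OF V] by simp
      finally show ?thesis .
    qed
    moreover have "?u \<in> span (insert v T)"
      using u0 ins rS by (intro span_add span_scale) auto
    ultimately show ?thesis by blast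
  qed
qed

lemma (in vector_space) representer_on_subspace:
  fixes a :: "'b \<Rightarrow> 'b \<Rightarrow> 'a" and L :: "'b \<Rightarrow> 'a"
  assumes V: "subspace V" and S: "finite S" "V \<subseteq> span S"
    and add: "\<And>x y z. x \<in> V \<Longrightarrow> y \<in> V \<Longrightarrow> z \<in> V \<Longrightarrow> a (x + y) z = a x z + a y z"
    and scale: "\<And>c x z. x \<in> V \<Longrightarrow> z \<in> V \<Longrightarrow> a (scale c x) z = c * a x z"
    and sym: "\<And>x y. x \<in> V \<Longrightarrow> y \<in> V \<Longrightarrow> a x y = a y x"
    and null: "\<And>x z. x \<in> V \<Longrightarrow> z \<in> V \<Longrightarrow> a x x = 0 \<Longrightarrow> a z x = 0"
    and L: "\<And>x y. x \<in> V \<Longrightarrow> y \<in> V \<Longrightarrow> L (x + y) = L x + L y"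
      "\<And>c x. x \<in> V \<Longrightarrow> L (scale c x) = c * L x" "\<And>x. x \<in> V \<Longrightarrow> a x x = 0 \<Longrightarrow> L x = 0"
  shows "\<exists>u\<in>V. \<forall>v\<in>V. a u v = L v"
proof -
  obtain B where B: "B \<subseteq> V" "independent B" "V \<subseteq> span B"
    using maximal_independent_subset by blast
  have "finite B"
    using independent_span_bound[OF S(1) B(2)] B(1) S(2) by blast
  then have "\<exists>u\<in>span B. \<forall>v\<in>span B. a u v = L v"
    by (intro representer_on_span[OF V]) (use B assms in auto)
  moreover have "span B = V" using B V span_minimal by blast
  ultimately show ?thesis by simp
qed

interpretation fun_space: vector_space "\<lambda>c (f :: 'x \<Rightarrow> real) x. c * f x"
  by unfold_locales (auto simp: fun_eq_iff algebra_simps)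

section \<open>Cells with vertical side walls\<close>

definition d3 :: "(real^3 \<Rightarrow> real) \<Rightarrow> real^3 \<Rightarrow> real" where
  "d3 f y = frechet_derivative f (at y) up"

lemma DERIV_d3:
  assumes "f differentiable (at (pt u t))"
  shows "((\<lambda>s. f (pt u s)) has_real_derivative d3 f (pt u t)) (at t)"
proof -
  have 1: "((\<lambda>s. pt u s) has_derivative (\<lambda>h. h *\<^sub>R up)) (at t)"
    unfolding pt_alt by (auto intro!: derivative_eq_intros)
  have 2: "(f has_derivative frechet_derivative f (at (pt u t))) (at (pt u t))"
    using assms by (simp add: frechet_derivative_works)
  have "((\<lambda>s. f (pt u s)) has_derivative (\<lambda>h. frechet_derivative f (at (pt u t)) (h *\<^sub>R up))) (at t)"
    using has_derivative_compose[OF 1 2] .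
  moreover have "frechet_derivative f (at (pt u t)) (h *\<^sub>R up) = d3 f (pt u t) * h" for h
    using linear_scale[OF has_derivative_linear[OF 2]] by (simp add: d3_def)
  ultimately show ?thesis by (simp add: has_field_derivative_def)
qed

lemma d3_eqI:
  assumes "f differentiable (at (pt u t))" "((\<lambda>s. f (pt u s)) has_real_derivative d) (at t)"
  shows "d3 f (pt u t) = d"
  using DERIV_unique[OF DERIV_d3[OF assms(1)] assms(2)] .

lemma matrix_mult_linear: "linear f \<Longrightarrow> matrix f *v x = f (x :: real^'n)"
  by (simp add: matrix_works linear_matrix_vector_mul_eq)

text \<open>Coefficients with respect to \<open>1, x, y, x * y\<close>, so that both base shapes
  share one formula: P1 is the case \<open>c $ 4 = 0\<close>. \<open>bil1\<close> and
  \<open>bil2\<close> are the two partial derivatives.\<close>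

definition bil :: "real^4 \<Rightarrow> real^2 \<Rightarrow> real" where
  "bil c u = c $ 1 + c $ 2 * u $ 1 + c $ 3 * u $ 2 + c $ 4 * (u $ 1 * u $ 2)"

definition bil1 :: "real^4 \<Rightarrow> real^2 \<Rightarrow> real" where
  "bil1 c u = c $ 2 + c $ 4 * u $ 2"

definition bil2 :: "real^4 \<Rightarrow> real^2 \<Rightarrow> real" where
  "bil2 c u = c $ 3 + c $ 4 * u $ 1"

text \<open>The Jacobian determinant of \<open>base_map p q\<close>, the horizontal part of a cell
  map.\<close>

definition base_det :: "real^4 \<Rightarrow> real^4 \<Rightarrow> real^2 \<Rightarrow> real" where
  "base_det p q u = bil1 p u * bil2 q u - bil2 p u * bil1 q u"

definition base_map :: "real^4 \<Rightarrow> real^4 \<Rightarrow> real^2 \<Rightarrow> real^2" where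
  "base_map p q u = vector [bil p u, bil q u]"

lemma base_map_nth [simp]: "base_map p q u $ 1 = bil p u" "base_map p q u $ 2 = bil q u"
  by (simp_all add: base_map_def)

lemma continuous_on_vec_nth_comp [continuous_intros]:
  "continuous_on S f \<Longrightarrow> continuous_on S (\<lambda>x. f x $ i)"
  by (rule continuous_on_component)

lemma continuous_on_bil [continuous_intros]:
  "continuous_on S f \<Longrightarrow> continuous_on S (\<lambda>x. bil c (f x))"
  unfolding bil_def by (intro continuous_intros)

lemma continuous_on_base_det [continuous_intros]:
  "continuous_on S f \<Longrightarrow> continuous_on S (\<lambda>x. base_det p q (f x))"
  unfolding base_det_def bil1_def bil2_def by (intro continuous_intros)

lemma has_derivative_nth [derivative_intros]:
  "(f has_derivative f') F \<Longrightarrow> ((\<lambda>x. f x $ i) has_derivative (\<lambda>h. f' h $ i)) F"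
  by (rule bounded_linear.has_derivative[OF bounded_linear_vec_nth])

lemma bil_has_derivative:
  "((\<lambda>y. bil c (horiz y)) has_derivative (\<lambda>h. bil1 c (horiz y) * h $ 1 + bil2 c (horiz y) * h $ 2)) (at y)"
  unfolding bil_def bil1_def bil2_def horiz_nth
  by (auto intro!: derivative_eq_intros simp: algebra_simps)

text \<open>The midpoint rule is exact for quadratic polynomials.\<close>

lemma bil_diff:
  "bil c u - bil c v = bil1 c ((1/2) *\<^sub>R (u + v)) * (u $ 1 - v $ 1) + bil2 c ((1/2) *\<^sub>R (u + v)) * (u $ 2 - v $ 2)"
  by (simp add: bil_def bil1_def bil2_def field_simps)

text \<open>By the exact midpoint rule \<open>bil_diff\<close>, the difference of two image points
  is the Jacobian at the midpoint applied to \<open>u - v\<close>. Convexity puts the midpoint into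
  \<open>B\<close>, where that matrix is invertible.\<close>

lemma inj_on_base_map:
  assumes "convex B" and nz: "\<And>u. u \<in> B \<Longrightarrow> base_det p q u \<noteq> 0"
  shows "inj_on (base_map p q) B"
proof (rule inj_onI)
  fix u v assume uv: "u \<in> B" "v \<in> B" "base_map p q u = base_map p q v"
  let ?m = "(1/2) *\<^sub>R (u + v)"
  have "?m \<in> B" using convexD[OF assms(1) uv(1,2), of "1/2" "1/2"] by (simp add: scaleR_add_right)
  then have D: "base_det p q ?m \<noteq> 0" by (rule nz)
  let ?x = "u $ 1 - v $ 1" and ?y = "u $ 2 - v $ 2"
  have "bil p u - bil p v = 0" "bil q u - bil q v = 0"
    using uv(3) base_map_nth by (metis diff_self)+
  then have e: "bil1 p ?m * ?x + bil2 p ?m * ?y = 0" "bil1 q ?m * ?x + bil2 q ?m * ?y = 0"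
    by (simp_all only: bil_diff)
  \<comment> \<open>Cramer's rule at the midpoint.\<close>
  have "base_det p q ?m * ?x
      = bil2 q ?m * (bil1 p ?m * ?x + bil2 p ?m * ?y) - bil2 p ?m * (bil1 q ?m * ?x + bil2 q ?m * ?y)"
    "base_det p q ?m * ?y
      = bil1 p ?m * (bil1 q ?m * ?x + bil2 q ?m * ?y) - bil1 q ?m * (bil1 p ?m * ?x + bil2 p ?m * ?y)"
    unfolding base_det_def by algebra+
  then have "base_det p q ?m * ?x = 0" "base_det p q ?m * ?y = 0" unfolding e by simp_all
  with D show "u = v" by (simp add: vec_eq_iff forall_2)
qed

lemma vertex_space_bil:
  assumes "f \<in> vertex_space S"
  shows "\<exists>c. f = bil c \<and> (S = Triangle \<longrightarrow> c $ 4 = 0)"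
proof (cases S)
  case Triangle
  then obtain a0 a1 a2 where "f = (\<lambda>x. a0 + a1 * x $ 1 + a2 * x $ 2)" using assms by auto
  then show ?thesis
    by (intro exI[of _ "\<chi> i. if i = 1 then a0 else if i = 2 then a1 else if i = 3 then a2 else 0"])
       (auto simp: bil_def fun_eq_iff)
next
  case Square
  then obtain a0 a1 a2 a3 where "f = (\<lambda>x. a0 + a1 * x $ 1 + a2 * x $ 2 + a3 * x $ 1 * x $ 2)" using assms by auto
  then show ?thesis using Square
    by (intro exI[of _ "\<chi> i. if i = 1 then a0 else if i = 2 then a1 else if i = 3 then a2 else a3"])
       (auto simp: bil_def fun_eq_iff)
qed

lemma bil_add: "bil (c + d) u = bil c u + bil d u"
  by (simp add: bil_def algebra_simps)

lemma bil_scale: "bil (r *\<^sub>R c) u = r * bil c u"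
  by (simp add: bil_def algebra_simps)

text \<open>Three corners fix the affine coefficients; the product term is fixed by the fourth
  corner of the square and is absent on a triangle.\<close>

lemma bil_eqI:
  assumes "\<And>u. u \<in> ref_base S \<Longrightarrow> bil c u = bil d u"
    and "S = Triangle \<longrightarrow> c $ 4 = 0 \<and> d $ 4 = 0"
  shows "c = d"
proof -
  have 1: "c $ 1 = d $ 1" "c $ 2 = d $ 2" "c $ 3 = d $ 3"
    using assms(1)[OF corners_in_ref_base(1)] assms(1)[OF corners_in_ref_base(2)]
      assms(1)[OF corners_in_ref_base(3)] by (simp_all add: bil_def axis_def)
  moreover have "c $ 4 = d $ 4"
  proof (cases S)
    case Square
    then show ?thesis
      using assms(1)[of 1] corner_in_ref_base_Square 1 by (simp add: bil_def)
  qed (use assms in simp)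
  ultimately show ?thesis by (simp add: vec_eq_iff forall_4)
qed

lemma tensor_vertex_space:
  assumes "f \<in> tensor (vertex_space S) (interval_space 1)"
  shows "\<exists>r m. (\<forall>y. f y = bil r (horiz y) + y $ 3 * bil m (horiz y)) \<and>
     (S = Triangle \<longrightarrow> r $ 4 = 0 \<and> m $ 4 = 0)"
proof -
  obtain n :: nat and a b where ab: "\<And>i. i < n \<Longrightarrow> a i \<in> vertex_space S \<and> b i \<in> interval_space 1"
    and f: "f = (\<lambda>y. \<Sum>i<n. b i (y $ 3) *\<^sub>R a i (horiz y))"
    using assms unfolding tensor_def by blast
  have "\<exists>c. i < n \<longrightarrow> a i = bil c \<and> (S = Triangle \<longrightarrow> c $ 4 = 0)" for i
    using ab vertex_space_bil by blast
  then obtain c where c: "\<And>i. i < n \<Longrightarrow> a i = bil (c i)" "\<And>i. i < n \<Longrightarrow> S = Triangle \<Longrightarrow> c i $ 4 = 0"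
    by metis
  have "\<exists>v w. \<forall>t. i < n \<longrightarrow> b i t = v + w * t" for i
  proof (cases "i < n")
    case True
    then obtain q where q: "b i = poly q" "degree q \<le> 1"
      using ab unfolding interval_space_def by blast
    then have "q = [:coeff q 0, coeff q 1:]"
      by (intro poly_eqI) (auto simp: coeff_pCons coeff_eq_0 split: nat.split)
    then have "poly q t = coeff q 0 + coeff q 1 * t" for t
      by (metis mult.commute poly_pCons poly_0 mult_zero_right add.right_neutral)
    then show ?thesis
      by (intro exI[of _ "coeff q 0"] exI[of _ "coeff q 1"]) (simp add: q(1))
  qed blast
  then obtain v w where vw: "\<And>i t. i < n \<Longrightarrow> b i t = v i + w i * t" by metis
  have lin: "bil (\<Sum>i<k. e i *\<^sub>R c i) u = (\<Sum>i<k. e i * bil (c i) u)" for e u k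
    by (induction k) (simp_all add: bil_add bil_scale, simp add: bil_def)
  have "f y = bil (\<Sum>i<n. v i *\<^sub>R c i) (horiz y) + y $ 3 * bil (\<Sum>i<n. w i *\<^sub>R c i) (horiz y)" for y
    unfolding lin f sum_distrib_left sum.distrib[symmetric]
    by (intro sum.cong refl) (simp add: vw c algebra_simps)
  moreover have "S = Triangle \<longrightarrow> (\<Sum>i<n. e i *\<^sub>R c i) $ 4 = 0" for e
    using c(2) by (simp add: sum_component)
  ultimately show ?thesis by blast
qed

definition cell_deriv :: "real^4 \<Rightarrow> real^4 \<Rightarrow> real^4 \<Rightarrow> real^4 \<Rightarrow> real^3 \<Rightarrow> real^3 \<Rightarrow> real^3" where
  "cell_deriv p q r m y h = vector
     [bil1 p (horiz y) * h $ 1 + bil2 p (horiz y) * h $ 2,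
      bil1 q (horiz y) * h $ 1 + bil2 q (horiz y) * h $ 2,
      (bil1 r (horiz y) + y $ 3 * bil1 m (horiz y)) * h $ 1 +
      (bil2 r (horiz y) + y $ 3 * bil2 m (horiz y)) * h $ 2 + bil m (horiz y) * h $ 3]"

lemma cell_map_has_derivative:
  assumes F: "\<And>y. F y = pt (base_map p q (horiz y)) (bil r (horiz y) + y $ 3 * bil m (horiz y))"
  shows "(F has_derivative cell_deriv p q r m y) (at y)"
proof -
  have "((\<lambda>y. pt (base_map p q (horiz y)) (bil r (horiz y) + y $ 3 * bil m (horiz y)))
      has_derivative cell_deriv p q r m y) (at y)"
    unfolding pt_alt base_map_nth
    by (auto intro!: derivative_eq_intros bil_has_derivative vec3_eqI ext
        simp: cell_deriv_def axis_def algebra_simps)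
  then show ?thesis by (simp add: F[abs_def])
qed

text \<open>Each component is affine in the height with \<open>bil\<close> coefficients. Since the
  Jacobian maps \<open>up\<close> to a positive multiple of itself, the slopes of the two horizontal
  components vanish and that of the third is positive; the determinant then factors as
  \<open>base_det p q u * bil m u\<close>.\<close>

lemma column_cell_map_form:
  assumes "column_cell_map S F"
  shows "\<exists>p q r m. (\<forall>y. F y = pt (base_map p q (horiz y)) (bil r (horiz y) + y $ 3 * bil m (horiz y)))
     \<and> (S = Triangle \<longrightarrow> p $ 4 = 0 \<and> q $ 4 = 0 \<and> r $ 4 = 0 \<and> m $ 4 = 0)
     \<and> (\<forall>u\<in>ref_base S. bil m u > 0) \<and> (\<forall>u\<in>ref_base S. base_det p q u \<noteq> 0)"
proof -
  have t: "(\<lambda>y. F y $ i) \<in> tensor (vertex_space S) (interval_space 1)" for i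
    using assms by (simp add: column_cell_map_def)
  obtain p p' where p: "\<And>y. F y $ 1 = bil p (horiz y) + y $ 3 * bil p' (horiz y)"
    and p4: "S = Triangle \<longrightarrow> p $ 4 = 0 \<and> p' $ 4 = 0" using tensor_vertex_space[OF t] by blast
  obtain q q' where q: "\<And>y. F y $ 2 = bil q (horiz y) + y $ 3 * bil q' (horiz y)"
    and q4: "S = Triangle \<longrightarrow> q $ 4 = 0 \<and> q' $ 4 = 0" using tensor_vertex_space[OF t] by blast
  obtain r m where r: "\<And>y. F y $ 3 = bil r (horiz y) + y $ 3 * bil m (horiz y)"
    and r4: "S = Triangle \<longrightarrow> r $ 4 = 0 \<and> m $ 4 = 0" using tensor_vertex_space[OF t] by blast
  have F_eq: "F = (\<lambda>y. (bil p (horiz y) + y $ 3 * bil p' (horiz y)) *\<^sub>R axis 1 1 +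
      (bil q (horiz y) + y $ 3 * bil q' (horiz y)) *\<^sub>R axis 2 1 +
      (bil r (horiz y) + y $ 3 * bil m (horiz y)) *\<^sub>R up)"
    by (intro ext vec3_eqI) (simp_all add: p q r axis_def)
  have ex: "\<exists>F'. (F has_derivative F') (at y) \<and> F' up = pt (vector [bil p' (horiz y), bil q' (horiz y)]) (bil m (horiz y))" for y
    unfolding F_eq
    by (rule exI, rule conjI, (rule derivative_eq_intros bil_has_derivative refl)+)
       (intro vec3_eqI, simp_all add: axis_def)
  have J: "jac F y *v up = pt (vector [bil p' (horiz y), bil q' (horiz y)]) (bil m (horiz y))" for y
  proof -
    obtain F' where F': "(F has_derivative F') (at y)"
      "F' up = pt (vector [bil p' (horiz y), bil q' (horiz y)]) (bil m (horiz y))"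
      using ex by blast
    show ?thesis
      unfolding jac_def frechet_derivative_at[OF F'(1), symmetric]
      using F'(2) by (simp add: matrix_mult_linear has_derivative_linear[OF F'(1)])
  qed
  have *: "bil p' u = 0 \<and> bil q' u = 0 \<and> bil m u > 0" if "u \<in> ref_base S" for u
  proof -
    have "pt u 0 \<in> ref_cell S" using that by (simp add: pt_in_ref_cell)
    then obtain h where h: "h > 0" "jac F (pt u 0) *v up = h *\<^sub>R up"
      using assms unfolding column_cell_map_def by blast
    then have "h *\<^sub>R up = pt (vector [bil p' u, bil q' u]) (bil m u)" using J[of "pt u 0"] by simp
    then have "(h *\<^sub>R up) $ i = pt (vector [bil p' u, bil q' u]) (bil m u) $ i" for i by simp
    from this[of 1] this[of 2] this[of 3] show ?thesis using h(1) by simp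
  qed
  have "bil 0 u = 0" for u by (simp add: bil_def)
  then have z: "p' = 0" "q' = 0" using * p4 q4 by (auto intro!: bil_eqI[of S])
  have F: "F y = pt (base_map p q (horiz y)) (bil r (horiz y) + y $ 3 * bil m (horiz y))" for y
    by (rule vec3_eqI) (simp_all add: p q r z, simp_all add: bil_def)
  have D: "base_det p q u \<noteq> 0" if "u \<in> ref_base S" for u
  proof -
    have "pt u 0 \<in> ref_cell S" using that by (simp add: pt_in_ref_cell)
    then have "det (jac F (pt u 0)) \<noteq> 0" using assms unfolding column_cell_map_def by blast
    moreover have "det (jac F (pt u 0)) = base_det p q u * bil m u"
      unfolding jac_def frechet_derivative_at[OF cell_map_has_derivative[OF F], symmetric]
      by (simp add: det_3 matrix_def cell_deriv_def axis_def base_det_def algebra_simps)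
    ultimately show ?thesis by auto
  qed
  show ?thesis
    using F p4 q4 r4 * D by blast
qed

text \<open>Not tied to a mesh, because the union of two stacked cells will be a second kind of
  instance. Over a base point, \<open>r\<close> gives the height of the lower face and
  \<open>m\<close> the thickness.\<close>

locale vertical_cell =
  fixes S :: base_shape and F :: "real^3 \<Rightarrow> real^3" and p q r m :: "real^4"
  assumes F: "F y = pt (base_map p q (horiz y)) (bil r (horiz y) + y $ 3 * bil m (horiz y))"
    and m_pos: "u \<in> ref_base S \<Longrightarrow> bil m u > 0"
    and D_nz: "u \<in> ref_base S \<Longrightarrow> base_det p q u \<noteq> 0"
begin

abbreviation "D \<equiv> base_det p q"
abbreviation "G \<equiv> base_map p q"

lemma F_pt: "F (pt u t) = pt (G u) (bil r u + t * bil m u)"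
  by (simp add: F)

lemma F_add_up: "F y + t *\<^sub>R up = F (y + (t / bil m (horiz y)) *\<^sub>R up)" if "horiz y \<in> ref_base S"
  using m_pos[OF that] by (intro vec3_eqI) (simp_all add: F algebra_simps)

lemmas F_has_derivative = cell_map_has_derivative[OF F]

lemma F_continuous: "continuous_on A F"
  using F_has_derivative by (meson continuous_at_imp_continuous_on has_derivative_continuous)

lemma jac_F: "jac F y = matrix (cell_deriv p q r m y)"
  unfolding jac_def frechet_derivative_at[OF F_has_derivative, symmetric] ..

lemma jac_F_mult: "jac F y *v h = cell_deriv p q r m y h"
  unfolding jac_F using has_derivative_linear[OF F_has_derivative] by (rule matrix_mult_linear)

lemma det_jac: "det (jac F y) = D (horiz y) * bil m (horiz y)"
  unfolding jac_F by (simp add: det_3 matrix_def cell_deriv_def axis_def base_det_def algebra_simps)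

lemma jac_F_up: "jac F y *v up = bil m (horiz y) *\<^sub>R up"
  unfolding jac_F_mult by (intro vec3_eqI) (simp_all add: cell_deriv_def)

lemma G_inj: "inj_on G (ref_base S)"
  by (rule inj_on_base_map[OF convex_ref_base D_nz])

lemma F_inj: "inj_on F (ref_cell S)"
proof (rule inj_onI)
  fix y z assume yz: "y \<in> ref_cell S" "z \<in> ref_cell S" "F y = F z"
  then have b: "horiz y \<in> ref_base S" "horiz z \<in> ref_base S" by (auto simp: ref_cell_iff)
  have e: "G (horiz y) = G (horiz z)"
    "bil r (horiz y) + y $ 3 * bil m (horiz y) = bil r (horiz z) + z $ 3 * bil m (horiz z)"
    using yz(3) by (simp_all add: F)
  have h: "horiz y = horiz z" using e(1) b inj_onD[OF G_inj] by blast
  then have "y $ 3 = z $ 3" using e(2) m_pos[OF b(2)] by simp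
  with h show "y = z" by (metis pt_horiz)
qed

lemma open_F_interior: "open (F ` interior (ref_cell S))"
  by (rule invariance_of_domain[OF F_continuous open_interior inj_on_subset[OF F_inj interior_subset]])

lemma F_interior_subset: "F ` interior (ref_cell S) \<subseteq> interior (F ` ref_cell S)"
  by (intro interior_maximal open_F_interior image_mono interior_subset)

lemma compact_cell: "compact (F ` ref_cell S)"
  by (intro compact_continuous_image F_continuous compact_ref_cell)

lemma negligible_cell_diff: "negligible (F ` ref_cell S - F ` interior (ref_cell S))"
proof -
  have "F differentiable_on (ref_cell S - interior (ref_cell S))"
    using F_has_derivative unfolding differentiable_on_def
    by (meson differentiableI differentiable_at_withinI)
  then have "negligible (F ` (ref_cell S - interior (ref_cell S)))"
    using negligible_differentiable_image_negligible[OF order_refl negligible_frontier_ref_cell] by blast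
  then show ?thesis by (rule negligible_subset) auto
qed

lemma cell_subset_closure: "F ` ref_cell S \<subseteq> closure (F ` interior (ref_cell S))"
  using image_closure_subset[OF F_continuous closed_closure closure_subset, of "interior (ref_cell S)"]
  by (simp add: ref_cell_closure)

text \<open>The horizontal part \<open>G\<close> is injective, so the cell meets the vertical line
  through an image point only in the segment between its two faces. A point of a face can therefore
  be pushed out of the cell.\<close>

lemma face_notin_interior:
  assumes u: "u \<in> ref_base S" and t: "t = 0 \<or> t = 1"
  shows "F (pt u t) \<notin> interior (F ` ref_cell S)"
proof
  assume "F (pt u t) \<in> interior (F ` ref_cell S)"
  then obtain e where e: "e > 0" "ball (F (pt u t)) e \<subseteq> F ` ref_cell S" by (meson mem_interior)
  \<comment> \<open>Outward: up from the upper face, down from the lower one.\<close>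
  define s where "s = (if t = 1 then e / 2 else - e / 2)"
  have "F (pt u t) + s *\<^sub>R up \<in> ball (F (pt u t)) e"
    using e(1) by (simp add: dist_norm s_def)
  then obtain y where y: "y \<in> ref_cell S" "F (pt u t) + s *\<^sub>R up = F y" using e(2) by blast
  have "pt (G u) (bil r u + t * bil m u + s) = F y"
    using y(2) by (simp add: F_pt pt_add_up)
  then have "G u = G (horiz y)" and 3: "bil r u + t * bil m u + s = bil r (horiz y) + y $ 3 * bil m (horiz y)"
    by (simp_all add: F)
  then have "u = horiz y" using u y(1) inj_onD[OF G_inj] by (auto simp: ref_cell_iff)
  then have "(t - y $ 3) * bil m u = - s" using 3 by (simp add: algebra_simps)
  moreover have "0 \<le> y $ 3" "y $ 3 \<le> 1" using y(1) by (auto simp: ref_cell_iff)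
  moreover have "bil m u > 0" using m_pos[OF u] .
  ultimately have n: "0 \<le> (1 - y $ 3) * bil m u" "0 \<le> y $ 3 * bil m u"
    and e': "(t - y $ 3) * bil m u = - s" by auto
  from t show False
  proof
    assume "t = 0"
    with e' have "y $ 3 * bil m u = - e / 2" by (simp add: s_def)
    with n e(1) show False by linarith
  next
    assume "t = 1"
    with e' have "(1 - y $ 3) * bil m u = - e / 2" by (simp add: s_def)
    with n e(1) show False by linarith
  qed
qed

text \<open>Change of variables on the open cell; the remainder is a null set. Only interior values
  of \<open>h\<close> are prescribed, since cellwise functions are \<open>undefined\<close> off the
  closed cell and the divergence of such a function is meaningful in the interior only.\<close>

lemma cell_integral:
  assumes k: "continuous_on (ref_cell S) k" and h: "\<And>y. y \<in> interior (ref_cell S) \<Longrightarrow> h (F y) = k y"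
  shows "set_integrable lebesgue (F ` ref_cell S) h"
    and "(LINT x:F ` ref_cell S|lebesgue. h x) = ref_int S (\<lambda>y. \<bar>D (horiz y) * bil m (horiz y)\<bar> * k y)"
proof -
  let ?R = "ref_cell S" and ?I = "interior (ref_cell S)"
  let ?w = "\<lambda>y. \<bar>D (horiz y) * bil m (horiz y)\<bar> * k y"
  have cw: "continuous_on ?R ?w" by (intro continuous_intros k)
  have iw: "?w absolutely_integrable_on ?R"
    using set_integrable_ref_cell[OF cw] unfolding set_integrable_def
    by (intro integrable_completion[THEN iffD2]) (auto dest: borel_measurable_integrable)
  have nR: "negligible {x \<in> ?R - ?I. f x \<noteq> 0}" "negligible {x \<in> ?I - ?R. f x \<noteq> 0}" for f :: "real^3 \<Rightarrow> real"
    by (rule negligible_subset[OF negligible_frontier_ref_cell], use interior_subset in blast)+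
  have nC: "negligible {x \<in> F ` ?R - F ` ?I. f x \<noteq> 0}" "negligible {x \<in> F ` ?I - F ` ?R. f x \<noteq> 0}" for f :: "real^3 \<Rightarrow> real"
    by (rule negligible_subset[OF negligible_cell_diff], use interior_subset in blast)+
  have iwI: "?w absolutely_integrable_on ?I"
    using absolutely_integrable_spike_set_eq[OF nR] iw by blast
  have iwI': "integral ?I ?w = integral ?R ?w"
    by (rule integral_spike_set[OF nR(2) nR(1)])
  have eq: "integral ?R ?w = ref_int S ?w"
    unfolding ref_int_def set_lebesgue_integral_eq_integral(2)[OF iw, symmetric] set_lebesgue_integral_def
    using set_integrable_ref_cell[OF cw] unfolding set_integrable_def
    by (intro integral_completion) auto
  have S: "?I \<in> sets lebesgue" by auto
  \<comment> \<open>The change of variables theorem takes vector values, so the scalar integrand is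
    read as a function into \<open>real^1\<close>.\<close>
  have cv: "(\<lambda>y. \<bar>det (matrix (cell_deriv p q r m y))\<bar> *\<^sub>R vec (h (F y)) :: real^1) absolutely_integrable_on ?I \<and>
      integral ?I (\<lambda>y. \<bar>det (matrix (cell_deriv p q r m y))\<bar> *\<^sub>R vec (h (F y)) :: real^1) = vec b \<longleftrightarrow>
      (\<lambda>x. vec (h x) :: real^1) absolutely_integrable_on (F ` ?I) \<and> integral (F ` ?I) (\<lambda>x. vec (h x) :: real^1) = vec b" for b
    by (intro has_absolute_integral_change_of_variables S inj_on_subset[OF F_inj interior_subset]
        has_derivative_at_withinI[OF F_has_derivative])
  have "(\<lambda>y. \<bar>det (matrix (cell_deriv p q r m y))\<bar> * h (F y)) absolutely_integrable_on ?I \<and>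
      integral ?I (\<lambda>y. \<bar>det (matrix (cell_deriv p q r m y))\<bar> * h (F y)) = b \<longleftrightarrow>
      h absolutely_integrable_on (F ` ?I) \<and> integral (F ` ?I) h = b" for b
    using cv[of b] by (simp add: absolutely_integrable_on_1_iff integral_on_1_eq)
  moreover have "(\<lambda>y. \<bar>det (matrix (cell_deriv p q r m y))\<bar> * h (F y)) absolutely_integrable_on ?I
      \<longleftrightarrow> ?w absolutely_integrable_on ?I"
    by (rule set_integrable_cong) (auto simp: h det_jac simp flip: jac_F)
  moreover have "integral ?I (\<lambda>y. \<bar>det (matrix (cell_deriv p q r m y))\<bar> * h (F y)) = integral ?I ?w"
    by (rule Henstock_Kurzweil_Integration.integral_cong) (auto simp: h det_jac simp flip: jac_F)
  ultimately have hI: "h absolutely_integrable_on (F ` ?I)" "integral (F ` ?I) h = integral ?I ?w"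
    using iwI by blast+
  show 1: "set_integrable lebesgue (F ` ?R) h"
    using absolutely_integrable_spike_set_eq[OF nC] hI(1) by blast
  show "(LINT x:F ` ?R|lebesgue. h x) = ref_int S ?w"
    using set_lebesgue_integral_eq_integral(2)[OF 1] integral_spike_set[OF nC, of h] hI(2) iwI' eq by simp
qed

text \<open>On the cell \<open>h\<close> is \<open>s\<close> composed with the inverse of
  \<open>F\<close>, times \<open>up\<close>. Its divergence is the derivative of that composition
  along \<open>up\<close>, and since the Jacobian stretches \<open>up\<close> by the thickness, this
  is the reference derivative divided by the thickness.\<close>

lemma divergence_vertical_field:
  assumes y: "y \<in> interior (ref_cell S)" and s: "s differentiable (at y)"
    and h: "\<And>z. z \<in> ref_cell S \<Longrightarrow> h (F z) = s z *\<^sub>R up"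
  shows "divergence h (F y) = d3 s y / bil m (horiz y)"
proof -
  have yb: "horiz y \<in> ref_base S" using y interior_subset by (fastforce simp: ref_cell_iff)
  let ?J = "jac F y" and ?s = "frechet_derivative s (at y)"
  let ?g = "inv_into (ref_cell S) F"
  have "det ?J \<noteq> 0" using D_nz[OF yb] m_pos[OF yb] by (simp add: det_jac)
  then obtain J' where inv: "?J ** J' = mat 1" "J' ** ?J = mat 1"
    using invertible_det_nz unfolding invertible_def by blast
  have dF: "(F has_derivative (*v) ?J) (at y)"
  proof -
    have "(*v) ?J = cell_deriv p q r m y" by (rule ext) (rule jac_F_mult)
    then show ?thesis using F_has_derivative by simp
  qed
  have g: "(?g has_derivative (*v) J') (at (F y))"
    by (rule has_derivative_inverse_strong[OF open_interior y F_continuous _ dF])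
      (use F_inj interior_subset in \<open>auto simp: fun_eq_iff matrix_vector_mul_assoc inv intro!: inv_into_f_f\<close>)
  have gy: "?g (F y) = y" using y interior_subset F_inj by (auto intro!: inv_into_f_f)
  have "(s has_derivative ?s) (at (?g (F y)))" using s unfolding gy by (simp add: frechet_derivative_works)
  then have sg: "((\<lambda>x. s (?g x)) has_derivative (\<lambda>k. ?s (J' *v k))) (at (F y))"
    by (rule has_derivative_compose[OF g])
  have "((\<lambda>x. s (?g x) *\<^sub>R up) has_derivative (\<lambda>k. ?s (J' *v k) *\<^sub>R up)) (at (F y))"
    using sg by (rule has_derivative_scaleR_left)
  then have hd: "(h has_derivative (\<lambda>k. ?s (J' *v k) *\<^sub>R up)) (at (F y))"
  proof (rule has_derivative_transform_within_open[OF _ open_F_interior])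
    show "F y \<in> F ` interior (ref_cell S)" using y by blast
    fix x assume "x \<in> F ` interior (ref_cell S)"
    then obtain z where z: "z \<in> ref_cell S" "x = F z" using interior_subset by blast
    then show "s (?g x) *\<^sub>R up = h x" using h[OF z(1)] F_inj by simp
  qed
  have "J' *v up = (1 / bil m (horiz y)) *\<^sub>R up"
  proof -
    have "up = J' *v (?J *v up)" by (simp add: matrix_vector_mul_assoc inv)
    also have "\<dots> = bil m (horiz y) *\<^sub>R (J' *v up)"
      by (simp add: jac_F_up matrix_vector_mult_scaleR)
    finally have "(1 / bil m (horiz y)) *\<^sub>R up = (1 / bil m (horiz y)) *\<^sub>R (bil m (horiz y) *\<^sub>R (J' *v up))"
      by simp
    then show ?thesis using m_pos[OF yb] by simp
  qed
  moreover have "divergence h (F y) = ?s (J' *v up)"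
    unfolding divergence_def jac_def frechet_derivative_at[OF hd, symmetric]
    by (simp add: trace_def sum_3 matrix_def)
  moreover have "linear ?s" using s by (simp add: linear_frechet_derivative)
  ultimately show ?thesis by (simp add: d3_def linear_scale)
qed

lemma vertical_derivative_cell:
  assumes y: "y \<in> interior (ref_cell S)" and s: "s differentiable (at y)"
    and h: "\<And>z. z \<in> ref_cell S \<Longrightarrow> h (F z) = s z"
  shows "vertical_derivative h (F y) = d3 s y / bil m (horiz y)"
proof -
  have yb: "horiz y \<in> ref_base S" using y interior_subset by (fastforce simp: ref_cell_iff)
  let ?c = "bil m (horiz y)"
  have m: "?c > 0" using m_pos[OF yb] .
  have "((\<lambda>t. s (pt (horiz y) (y $ 3 + t / ?c))) has_real_derivative (d3 s y * (1 / ?c))) (at 0)"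
  proof -
    have "((\<lambda>t. y $ 3 + t / ?c) has_real_derivative 1 / ?c) (at 0)"
      using m by (auto intro!: derivative_eq_intros)
    moreover have "((\<lambda>t. s (pt (horiz y) t)) has_real_derivative d3 s y) (at (y $ 3 + 0 / ?c))"
      using DERIV_d3[of s "horiz y" "y $ 3"] s by simp
    ultimately show ?thesis using DERIV_chain2[of "\<lambda>t. s (pt (horiz y) t)" _ "\<lambda>t. y $ 3 + t / ?c" 0] by blast
  qed
  moreover have "\<forall>\<^sub>F t in nhds 0. h (F y + t *\<^sub>R up) = s (pt (horiz y) (y $ 3 + t / ?c))"
  proof -
    have "open {t. y + (t / ?c) *\<^sub>R up \<in> interior (ref_cell S)}"
    proof -
      have "continuous_on UNIV (\<lambda>t. y + (t / ?c) *\<^sub>R up)"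
        using m by (intro continuous_intros) auto
      then show ?thesis using open_vimage[OF open_interior] by (simp add: vimage_def)
    qed
    then have "\<forall>\<^sub>F t in nhds 0. t \<in> {t. y + (t / ?c) *\<^sub>R up \<in> interior (ref_cell S)}"
      using y by (intro eventually_nhds_in_open) auto
    then show ?thesis
    proof eventually_elim
      case (elim t)
      then have "y + (t / ?c) *\<^sub>R up \<in> ref_cell S" using interior_subset by blast
      then have "h (F (y + (t / ?c) *\<^sub>R up)) = s (y + (t / ?c) *\<^sub>R up)" by (rule h)
      moreover have "y + (t / ?c) *\<^sub>R up = pt (horiz y) (y $ 3 + t / ?c)"
        by (intro vec3_eqI) simp_all
      ultimately show ?case by (simp add: F_add_up[OF yb])
    qed
  qed
  ultimately have "((\<lambda>t. h (F y + t *\<^sub>R up)) has_real_derivative (d3 s y * (1 / ?c))) (at 0)"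
    by (subst DERIV_cong_ev[OF refl _ refl]) 
  then show ?thesis unfolding vertical_derivative_def by (simp add: DERIV_imp_deriv)
qed

text \<open>The third component of the cross product of the two tangents is \<open>D\<close>, so a
  vertical field is orthogonal to the normal of a sloping face only where it vanishes.\<close>

lemma face_normal_nth3:
  "face_normal M K y $ 3 \<noteq> 0" if "cell_map M K = F" "horiz y \<in> ref_base S"
  using D_nz[OF that(2)]
  by (simp add: face_normal_def that(1) jac_F_mult sgn_div_norm cross3_def cell_deriv_def axis_def
      base_det_def mult.commute, simp add: vec_eq_iff forall_3)

end

section \<open>Finite element functions on a column\<close>

lemma tensor_zero: "(\<lambda>y. 0) \<in> tensor A B"
  unfolding tensor_def by (auto intro!: exI[of _ 0])

lemma tensor_add:
  assumes "f \<in> tensor A B" "g \<in> tensor A B"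
  shows "(\<lambda>y. f y + g y) \<in> tensor A B"
proof -
  obtain n :: nat and a b where f: "\<And>i. i < n \<Longrightarrow> a i \<in> A \<and> b i \<in> B"
    "f = (\<lambda>y. \<Sum>i<n. b i (y $ 3) *\<^sub>R a i (horiz y))"
    using assms(1) unfolding tensor_def by blast
  obtain n' :: nat and a' b' where g: "\<And>i. i < n' \<Longrightarrow> a' i \<in> A \<and> b' i \<in> B"
    "g = (\<lambda>y. \<Sum>i<n'. b' i (y $ 3) *\<^sub>R a' i (horiz y))"
    using assms(2) unfolding tensor_def by blast
  let ?a = "\<lambda>i. if i < n then a i else a' (i - n)" and ?b = "\<lambda>i. if i < n then b i else b' (i - n)"
  have split: "(\<Sum>i<n + n'. h i) = (\<Sum>i<n. h i) + (\<Sum>i<n'. h (n + i))" for h :: "nat \<Rightarrow> 'a"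
    by (induction n') (simp_all add: algebra_simps)
  have "(\<lambda>y. f y + g y) = (\<lambda>y. \<Sum>i<n + n'. ?b i (y $ 3) *\<^sub>R ?a i (horiz y))"
    by (simp add: f g split)
  moreover have "\<forall>i<n + n'. ?a i \<in> A \<and> ?b i \<in> B" using f g by auto
  ultimately show ?thesis
    unfolding tensor_def mem_Collect_eq
    by (intro exI[of _ "n + n'"] exI[of _ ?a] exI[of _ ?b] conjI)
qed

lemma tensor_scale:
  assumes "f \<in> tensor A (interval_space n)"
  shows "(\<lambda>y. c *\<^sub>R f y) \<in> tensor A (interval_space n)"
proof -
  obtain N :: nat and a b where f: "\<And>i. i < N \<Longrightarrow> a i \<in> A \<and> b i \<in> interval_space n"
    "f = (\<lambda>y. \<Sum>i<N. b i (y $ 3) *\<^sub>R a i (horiz y))"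
    using assms(1) unfolding tensor_def by blast
  have sc: "(\<lambda>t. c * h t) \<in> interval_space n" if h: "h \<in> interval_space n" for h
  proof -
    obtain w where w: "h = poly w" "degree w \<le> n" using h unfolding interval_space_def by blast
    then have "(\<lambda>t. c * h t) = poly (smult c w)" "degree (smult c w) \<le> n"
      by (simp_all add: fun_eq_iff degree_smult_le[THEN order_trans])
    then show ?thesis unfolding interval_space_def by blast
  qed
  have "(\<lambda>y. c *\<^sub>R f y) = (\<lambda>y. \<Sum>i<N. (c * b i (y $ 3)) *\<^sub>R a i (horiz y))"
    by (simp add: f(2) scaleR_sum_right)
  then show ?thesis unfolding tensor_def using f sc
    by (auto intro!: exI[of _ N] exI[of _ a] exI[of _ "\<lambda>i t. c * b i t"])
qed

lemma polynomial_space_function: "polynomial_space X \<Longrightarrow> f \<in> X \<Longrightarrow> polynomial_function f"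
  unfolding polynomial_space_def
  by (auto intro!: polynomial_function_sum polynomial_function_cmul)

lemma tensor_polynomial_form:
  assumes "f \<in> tensor A (interval_space n)" "polynomial_space (A :: (real^2 \<Rightarrow> real) set)"
  obtains N :: nat and w :: "nat \<Rightarrow> real poly" and a where "\<And>i. i < N \<Longrightarrow> a i \<in> A"
    "\<And>i. i < N \<Longrightarrow> polynomial_function (a i)"
    "\<And>i. i < N \<Longrightarrow> degree (w i) \<le> n" "f = (\<lambda>y. \<Sum>i<N. poly (w i) (y $ 3) * a i (horiz y))"
proof -
  obtain N :: nat and a b where f: "\<And>i. i < N \<Longrightarrow> a i \<in> A \<and> b i \<in> interval_space n"
    "f = (\<lambda>y. \<Sum>i<N. b i (y $ 3) *\<^sub>R a i (horiz y))"
    using assms(1) unfolding tensor_def by blast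
  have "\<exists>w. i < N \<longrightarrow> b i = poly w \<and> degree w \<le> n" for i
    using f(1) unfolding interval_space_def by blast
  then obtain w where "\<And>i. i < N \<Longrightarrow> b i = poly (w i)" "\<And>i. i < N \<Longrightarrow> degree (w i) \<le> n" by metis
  with f assms(2) show ?thesis by (intro that[of N a w]) (auto intro: polynomial_space_function)
qed

lemma polynomial_function_horiz: "polynomial_function horiz"
  using linear_horiz by (simp add: polynomial_function_bounded_linear linear_conv_bounded_linear)

lemma tensor_polynomial_function:
  assumes "f \<in> tensor A (interval_space n)" "polynomial_space (A :: (real^2 \<Rightarrow> real) set)"
  shows "polynomial_function f"
proof -
  obtain N :: nat and w :: "nat \<Rightarrow> real poly" and a where a: "\<And>i. i < N \<Longrightarrow> polynomial_function (a i)"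
    and f: "f = (\<lambda>y. \<Sum>i<N. poly (w i) (y $ 3) * a i (horiz y))"
    using tensor_polynomial_form[OF assms] by metis
  have y3: "polynomial_function (\<lambda>y::real^3. y $ 3)"
    by (simp add: polynomial_function_bounded_linear bounded_linear_vec_nth)
  have "polynomial_function (\<lambda>y::real^3. poly v (y $ 3))" for v :: "real poly"
  proof (induction v)
    case (pCons c v)
    then show ?case
      using polynomial_function_mult[OF y3 pCons.IH] by (simp add: polynomial_function_add)
  qed simp
  then have "polynomial_function (\<lambda>y. poly (w i) (y $ 3) *\<^sub>R a i (horiz y))" if "i < N" for i
    using polynomial_function_compose[OF polynomial_function_horiz a[OF that]]
    by (intro polynomial_function_mult) (simp_all add: o_def)
  then show ?thesis
    unfolding f by (intro polynomial_function_sum) simp_all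
qed

lemma tensor_differentiable:
  assumes "f \<in> tensor A (interval_space n)" "polynomial_space (A :: (real^2 \<Rightarrow> real) set)"
  shows "f differentiable (at y)"
  using tensor_polynomial_function[OF assms] by (rule differentiable_at_polynomial_function)

lemma tensor_continuous_on:
  assumes "f \<in> tensor A (interval_space n)" "polynomial_space (A :: (real^2 \<Rightarrow> real) set)"
  shows "continuous_on T f"
  using tensor_polynomial_function[OF assms] by (rule continuous_on_polymonial_function)

text \<open>The second and third parts are for the lowest order: a pressure of vertical degree 0 has
  no vertical derivative, and a function of vertical degree 1 is the interpolation of its values at
  bottom and top.\<close>

lemma tensor_d3:
  assumes f: "f \<in> tensor A (interval_space n)" and A: "polynomial_space (A :: (real^2 \<Rightarrow> real) set)"
  shows "continuous_on T (d3 f)" and "n = 0 \<Longrightarrow> d3 f = (\<lambda>y. 0)"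
    and "n \<le> 1 \<Longrightarrow> f (pt u t) = (1 - t) * f (pt u 0) + t * f (pt u 1)"
proof -
  obtain N :: nat and w :: "nat \<Rightarrow> real poly" and a where "\<And>i. i < N \<Longrightarrow> a i \<in> A" and a: "\<And>i. i < N \<Longrightarrow> polynomial_function (a i)"
    and w: "\<And>i. i < N \<Longrightarrow> degree (w i) \<le> n"
    and f_eq: "f = (\<lambda>y. \<Sum>i<N. poly (w i) (y $ 3) * a i (horiz y))"
    by (rule tensor_polynomial_form[OF assms]) (rule that)
  have "((\<lambda>s. f (pt u s)) has_real_derivative (\<Sum>i<N. poly (pderiv (w i)) t * a i u)) (at t)" for u t
    unfolding f_eq horiz_pt pt_nth by (intro DERIV_sum) (auto intro!: derivative_eq_intros)
  then have "d3 f (pt u t) = (\<Sum>i<N. poly (pderiv (w i)) t * a i u)" for u t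
    using d3_eqI tensor_differentiable[OF assms] by blast
  from this[of "horiz y" "y $ 3" for y]
  have d3: "d3 f = (\<lambda>y. \<Sum>i<N. poly (pderiv (w i)) (y $ 3) * a i (horiz y))" by (intro ext) simp
  have "continuous_on T (\<lambda>y. a i (horiz y))" if "i < N" for i
    using continuous_on_polymonial_function[OF a[OF that], of UNIV]
    by (rule continuous_on_compose2) (auto intro: continuous_intros)
  then show "continuous_on T (d3 f)"
    unfolding d3 by (intro continuous_intros) auto
  show "d3 f = (\<lambda>y. 0)" if "n = 0"
  proof -
    have "pderiv (w i) = 0" if "i < N" for i
      using w[OF that] \<open>n = 0\<close> by (simp add: pderiv_eq_0_iff)
    then show ?thesis unfolding d3 by (intro ext sum.neutral) simp
  qed
  show "f (pt u t) = (1 - t) * f (pt u 0) + t * f (pt u 1)" if "n \<le> 1"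
  proof -
    have "poly (w i) t * a i u = (1 - t) * (poly (w i) 0 * a i u) + t * (poly (w i) 1 * a i u)"
      if "i < N" for i
    proof -
      have "w i = [:coeff (w i) 0, coeff (w i) 1:]"
        using w[OF that] \<open>n \<le> 1\<close> by (intro poly_eqI) (auto simp: coeff_pCons coeff_eq_0 split: nat.split)
      then have "poly (w i) s = coeff (w i) 0 + coeff (w i) 1 * s" for s
        by (metis mult.commute poly_pCons poly_0 mult_zero_right add.right_neutral)
      from this[of t] this[of 0] this[of 1] show ?thesis by (simp add: algebra_simps)
    qed
    then show ?thesis
      unfolding f_eq horiz_pt pt_nth sum_distrib_left sum.distrib[symmetric]
      by (intro sum.cong refl) simp
  qed
qed

lemma d3_mult:
  assumes "f differentiable (at y)" "g differentiable (at y)"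
  shows "d3 (\<lambda>y. f y * g y) y = d3 f y * g y + f y * d3 g y"
proof -
  have "((\<lambda>y. f y * g y) has_derivative (\<lambda>h. f y * frechet_derivative g (at y) h + frechet_derivative f (at y) h * g y)) (at y)"
    using assms by (intro has_derivative_mult) (auto simp flip: frechet_derivative_works)
  from frechet_derivative_at[OF this, symmetric] show ?thesis
    unfolding d3_def by (simp only: add.commute)
qed

lemma ref_Vt_eq: "ref_Vt E = tensor (base_DG E) (interval_space (vdeg E))"
proof -
  have "\<theta> = f" if "(\<lambda>y. \<theta> y *\<^sub>R up) = (\<lambda>y. f y *\<^sub>R up)" for \<theta> f :: "real^3 \<Rightarrow> real"
    using that by (simp add: fun_eq_iff axis_eq_0_iff)
  then show ?thesis unfolding ref_Vt_def ref_V2v_def by blast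
qed

text \<open>\<open>p\<close> and \<open>q\<close> carry no layer index: matching faces force all
  cells of a column to have the same horizontal map, as \<open>mesh_column_exists\<close>
  proves.\<close>

locale mesh_column =
  fixes M :: "'c mesh" and E :: element and c :: 'c and p q :: "real^4" and r m :: "nat \<Rightarrow> real^4"
  assumes mesh: "column_mesh M" and elem: "compatible_element E" and c: "c \<in> columns M"
    and cell: "\<And>k. k < layers M c \<Longrightarrow> vertical_cell (shape M) (cell_map M (c, k)) p q (r k) (m k)"
    and stack: "\<And>k u. Suc k < layers M c \<Longrightarrow> u \<in> ref_base (shape M) \<Longrightarrow>
      bil (r (Suc k)) u = bil (r k) u + bil (m k) u"
begin

abbreviation "n \<equiv> layers M c"
abbreviation "S \<equiv> shape M"
abbreviation "R \<equiv> ref_cell (shape M)"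
abbreviation "B \<equiv> ref_base (shape M)"
abbreviation "F k \<equiv> cell_map M (c, k)"
abbreviation "D \<equiv> base_det p q"
abbreviation "C k \<equiv> cell M (c, k)"
abbreviation "vdet k y \<equiv> D (horiz y) * bil (m k) (horiz y)"
abbreviation "G \<equiv> base_map p q"
abbreviation "tens \<equiv> tensor (base_DG E) (interval_space (vdeg E))"

lemma n_pos: "0 < n"
  using mesh c unfolding column_mesh_def by fastforce

lemma DG: "polynomial_space (base_DG E)"
  using elem by (simp add: compatible_element_def)

lemma vdeg: "1 \<le> vdeg E"
  using elem by (simp add: compatible_element_def)

lemma in_cells: "k < n \<Longrightarrow> (c, k) \<in> cells M"
  using c by (simp add: cells_def)

lemma cell_eq: "C k = F k ` R"
  by (simp add: cell_def)

lemma ref_point_F: "k < n \<Longrightarrow> y \<in> R \<Longrightarrow> ref_point M (c, k) (F k y) = y"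
  using vertical_cell.F_inj[OF cell] by (simp add: ref_point_def)

lemma F_pt_Suc:
  assumes "Suc k < n" "u \<in> B" shows "F (Suc k) (pt u 0) = F k (pt u 1)"
  using vertical_cell.F_pt[OF cell] assms stack[OF assms] by simp

lemma D_nz: "u \<in> B \<Longrightarrow> D u \<noteq> 0"
  using vertical_cell.D_nz[OF cell[OF n_pos]] .

lemma m_pos: "k < n \<Longrightarrow> u \<in> B \<Longrightarrow> 0 < bil (m k) u"
  using vertical_cell.m_pos[OF cell] .

lemma horiz_R [simp]: "y \<in> R \<Longrightarrow> horiz y \<in> B"
  by (simp add: ref_cell_iff)

text \<open>A continuous function without zeros on a connected set keeps its sign, read off here at
  the corner \<open>0\<close>. Cell maps may reverse orientation; as \<open>D\<close> is shared by
  the layers, the sign is a common factor of all cell integrals in the column.\<close>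

lemma abs_D:
  assumes u: "u \<in> B" shows "\<bar>D u\<bar> = sgn (D 0) * D u"
proof -
  have "connected (D ` B)"
    by (intro connected_continuous_image continuous_intros convex_connected convex_ref_base)
  then have i: "0 \<in> D ` B" if "u \<in> B" "v \<in> B" "D u \<le> 0" "0 \<le> D v" for u v
    using that connectedD_interval by blast
  have 0: "0 \<in> B" by (rule corners_in_ref_base)
  have "0 \<notin> D ` B" using D_nz by force
  then have "D 0 < 0 \<longleftrightarrow> D u < 0"
    using i[OF 0 u] i[OF u 0] by linarith
  then have "sgn (D 0) = sgn (D u)"
    using D_nz[OF 0] D_nz[OF u] by (cases "D u < 0") (auto simp: sgn_if)
  then show ?thesis by (simp add: abs_sgn mult.commute)
qed

lemma sgn_D0: "sgn (D 0) \<noteq> 0"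
  using D_nz[OF corners_in_ref_base(1)] by (simp add: sgn_eq_0_iff)

lemma abs_det: "k < n \<Longrightarrow> y \<in> R \<Longrightarrow>
    \<bar>vdet k y\<bar> = sgn (D 0) * (vdet k y)"
  using abs_D[of "horiz y"] m_pos[of k "horiz y"] by (simp add: abs_mult)

text \<open>One space parametrises both temperatures and velocities. Its members are functions on
  the whole space and their entries from \<open>n\<close> on are arbitrary, so distinct members can
  describe the same field.\<close>

definition ring_space :: "(nat \<Rightarrow> real^3 \<Rightarrow> real) set" where
  "ring_space = {U. (\<forall>k<n. U k \<in> tens) \<and>
     (\<forall>k u. Suc k < n \<longrightarrow> u \<in> B \<longrightarrow> U k (pt u 1) = U (Suc k) (pt u 0)) \<and>
     (\<forall>u\<in>B. U 0 (pt u 0) = 0 \<and> U (n - 1) (pt u 1) = 0)}"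

definition temp :: "(nat \<Rightarrow> real^3 \<Rightarrow> real) \<Rightarrow> nat \<Rightarrow> real^3 \<Rightarrow> real" where
  "temp U = (\<lambda>k\<in>{..<n}. \<lambda>x\<in>C k. U k (ref_point M (c, k) x))"

definition vel :: "(nat \<Rightarrow> real^3 \<Rightarrow> real) \<Rightarrow> nat \<Rightarrow> real^3 \<Rightarrow> real^3" where
  "vel U = (\<lambda>k\<in>{..<n}. piola M (c, k) (\<lambda>y. U k y *\<^sub>R up))"

lemma temp_F: "k < n \<Longrightarrow> y \<in> R \<Longrightarrow> temp U k (F k y) = U k y"
  by (simp add: temp_def cell_eq ref_point_F)

text \<open>The thickness cancels: it is both the factor by which the Jacobian stretches
  \<open>up\<close> and a factor of the determinant \<open>D * m\<close>.\<close>

lemma piola_F: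
  assumes "k < n" "y \<in> R"
  shows "piola M (c, k) (\<lambda>y. f y *\<^sub>R up) (F k y) = (f y / D (horiz y)) *\<^sub>R up"
  using vertical_cell.jac_F_up[OF cell, of k y] vertical_cell.det_jac[OF cell, of k y] assms
    m_pos[of k "horiz y"] ref_cell_iff[of y S]
  by (simp add: piola_def cell_eq ref_point_F matrix_vector_mult_scaleR Let_def)

lemma vel_F: "k < n \<Longrightarrow> y \<in> R \<Longrightarrow> vel U k (F k y) = (U k y / D (horiz y)) *\<^sub>R up"
  by (simp add: vel_def piola_F)

lemma tens_differentiable: "f \<in> tens \<Longrightarrow> f differentiable (at y)"
  using tensor_differentiable DG by blast

lemma tens_continuous_on: "f \<in> tens \<Longrightarrow> continuous_on T f"
  using tensor_continuous_on DG by blast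

lemma tens_d3_continuous_on: "f \<in> tens \<Longrightarrow> continuous_on T (d3 f)"
  using tensor_d3(1) DG by blast

lemma Vt_ring_eq: "Vt_ring E M c = temp ` ring_space"
proof (intro equalityI subsetI)
  fix \<theta> assume \<theta>: "\<theta> \<in> Vt_ring E M c"
  then obtain \<theta>0 where \<theta>0: "\<theta>0 \<in> Vt E M" "\<theta> = column_restrict M c \<theta>0"
    unfolding Vt_ring_def Vt_col_def by blast
  have \<theta>k: "\<theta> k = \<theta>0 (c, k)" if "k < n" for k using that by (simp add: \<theta>0(2) column_restrict_def)
  have mem: "\<theta>0 (c, k) \<in> cell_Vt E M (c, k)" if "k < n" for k
    using \<theta>0(1) in_cells[OF that] unfolding Vt_def by blast
  then have "\<exists>U. k < n \<longrightarrow> U \<in> tens \<and> (\<forall>y\<in>R. \<theta>0 (c, k) (F k y) = U y)" for k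
    unfolding cell_Vt_def ref_Vt_eq by blast
  then obtain U where U: "\<And>k. k < n \<Longrightarrow> U k \<in> tens" "\<And>k y. k < n \<Longrightarrow> y \<in> R \<Longrightarrow> \<theta>0 (c, k) (F k y) = U k y"
    by metis
  have "U k (pt u 1) = U (Suc k) (pt u 0)" if "Suc k < n" "u \<in> B" for k u
  proof -
    have "\<theta>0 (c, k) (F k (pt u 1)) = \<theta>0 (c, Suc k) (F k (pt u 1))"
      using \<theta>0(1) c that unfolding Vt_def upper_face_def by auto
    also have "F k (pt u 1) = F (Suc k) (pt u 0)" using F_pt_Suc that by simp
    finally show ?thesis
      using U(2)[of k "pt u 1"] U(2)[of "Suc k" "pt u 0"] that F_pt_Suc[OF that] by (simp add: pt_in_ref_cell)
  qed
  moreover have "U 0 (pt u 0) = 0" "U (n - 1) (pt u 1) = 0" if "u \<in> B" for u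
  proof -
    have "\<theta> 0 (F 0 (pt u 0)) = 0" "\<theta> (n - 1) (F (n - 1) (pt u 1)) = 0"
      using \<theta> that unfolding Vt_ring_def upper_face_def lower_face_def by auto
    then show "U 0 (pt u 0) = 0" "U (n - 1) (pt u 1) = 0"
      using U(2)[of 0 "pt u 0"] U(2)[of "n - 1" "pt u 1"] that n_pos \<theta>k by (auto simp: pt_in_ref_cell)
  qed
  ultimately have "U \<in> ring_space" using U(1) by (simp add: ring_space_def)
  moreover have "\<theta> = temp U"
  proof
    fix k show "\<theta> k = temp U k"
    proof (cases "k < n")
      case True
      have "\<theta>0 (c, k) \<in> extensional (C k)" using mem[OF True] by (simp add: cell_Vt_def)
      then have "\<theta>0 (c, k) x = temp U k x" for x
        using True U(2) temp_F[OF True] unfolding temp_def cell_eq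
        by (cases "x \<in> F k ` R") (auto simp: extensional_def ref_point_F)
      then show ?thesis using \<theta>k[OF True] by auto
    qed (simp add: \<theta>0(2) column_restrict_def temp_def)
  qed
  ultimately show "\<theta> \<in> temp ` ring_space" by blast
next
  fix \<theta> assume "\<theta> \<in> temp ` ring_space"
  then obtain U where U: "U \<in> ring_space" and \<theta>: "\<theta> = temp U" by blast
  \<comment> \<open>A member of \<open>Vt_col\<close> has to come from a function on the whole mesh;
    zero on the other columns is admissible since nothing links columns.\<close>
  define \<theta>0 where "\<theta>0 = (\<lambda>K\<in>cells M. \<lambda>x\<in>cell M K. if fst K = c then U (snd K) (ref_point M K x) else 0)"
  have \<theta>0_F: "\<theta>0 (c, k) (F k y) = U k y" if "k < n" "y \<in> R" for k y
    using that by (simp add: \<theta>0_def in_cells cell_eq ref_point_F)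
  have "\<theta>0 \<in> Pi\<^sub>E (cells M) (cell_Vt E M)"
  proof (rule PiE_I)
    fix K assume K: "K \<in> cells M"
    obtain c' k where Kk: "K = (c', k)" by fastforce
    show "\<theta>0 K \<in> cell_Vt E M K"
    proof (cases "c' = c")
      case True
      then have "k < n" using K Kk by (simp add: cells_def)
      have "U k \<in> tens" using U \<open>k < n\<close> by (simp add: ring_space_def)
      moreover have "\<theta>0 (c, k) \<in> extensional (C k)"
        by (simp add: \<theta>0_def in_cells[OF \<open>k < n\<close>])
      ultimately show ?thesis
        using True Kk \<theta>0_F[OF \<open>k < n\<close>] unfolding cell_Vt_def ref_Vt_eq by blast
    next
      case False
      then show ?thesis
        using K Kk unfolding cell_Vt_def ref_Vt_eq
        by (auto simp: \<theta>0_def cell_def intro!: bexI[OF _ tensor_zero])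
    qed
  qed (simp add: \<theta>0_def)
  moreover have "\<theta>0 (c', k) x = \<theta>0 (c', Suc k) x"
    if c': "c' \<in> columns M" and k: "Suc k < layers M c'" and x: "x \<in> upper_face M (c', k)" for c' k x
  proof -
    obtain y where y: "y \<in> ref_slice B {1}" "x = cell_map M (c', k) y"
      using x unfolding upper_face_def by blast
    then have y1: "y = pt (horiz y) 1" and yB: "horiz y \<in> B" using pt_horiz[of y] by (simp_all)
    show ?thesis
    proof (cases "c' = c")
      case True
      then have "x = F k (pt (horiz y) 1)" "x = F (Suc k) (pt (horiz y) 0)"
        using y y1 F_pt_Suc[of k "horiz y"] k yB by auto
      then have "\<theta>0 (c, k) x = U k (pt (horiz y) 1)" "\<theta>0 (c, Suc k) x = U (Suc k) (pt (horiz y) 0)"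
        using \<theta>0_F[of k "pt (horiz y) 1"] \<theta>0_F[of "Suc k" "pt (horiz y) 0"] k True yB
        by (simp_all add: pt_in_ref_cell)
      then show ?thesis using U k True yB by (simp add: ring_space_def)
    next
      case False
      \<comment> \<open>Cellwise functions are \<open>undefined\<close> off their closed cell, so
        both traces are zero only once \<open>x\<close> is known to lie in both cells.\<close>
      have "x = cell_map M (c', Suc k) (y - up)"
        using mesh c' k y unfolding column_mesh_def by blast
      moreover have "y - up \<in> R" "y \<in> R"
        using y1 yB pt_diff_up[of "horiz y" 1] pt_in_ref_cell[of "horiz y" 0 S] pt_in_ref_cell[of "horiz y" 1 S] by auto
      ultimately have "x \<in> cell M (c', Suc k)" "x \<in> cell M (c', k)"
        using y(2) unfolding cell_def by (auto intro: rev_image_eqI)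
      moreover have "(c', k) \<in> cells M" "(c', Suc k) \<in> cells M" using c' k by (auto simp: cells_def)
      ultimately show ?thesis using False by (simp add: \<theta>0_def)
    qed
  qed
  ultimately have "\<theta>0 \<in> Vt E M" unfolding Vt_def by blast
  moreover have "\<theta> = column_restrict M c \<theta>0"
    unfolding \<theta> temp_def column_restrict_def by (intro restrict_ext) (simp add: \<theta>0_def in_cells)
  ultimately have "\<theta> \<in> Vt_col E M c" unfolding Vt_col_def by blast
  moreover have "\<theta> j (F j y) = 0"
    if j: "j < n" and y: "horiz y \<in> B" "y $ 3 = t" and ends: "j = 0 \<and> t = 0 \<or> j = n - 1 \<and> t = 1" for j y t
  proof -
    have yR: "y \<in> R" and y_eq: "y = pt (horiz y) t" using y ends pt_horiz[of y] by (auto simp: ref_cell_iff)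
    have "U j (pt (horiz y) t) = 0" using U y ends by (auto simp: ring_space_def)
    then have "U j y = 0" by (subst y_eq)
    then show ?thesis using temp_F[OF j yR] by (simp add: \<theta>)
  qed
  ultimately show "\<theta> \<in> Vt_ring E M c"
    unfolding Vt_ring_def upper_face_def lower_face_def using n_pos by auto
qed

end

section \<open>The energy form\<close>

text \<open>At the upper and lower faces a vertical derivative involves values outside the cell, so
  the claim is carried there from the interior by continuity.\<close>

lemma d3_eq_0_of_zero:
  assumes f: "\<And>y. f differentiable (at y)" and c: "continuous_on (ref_cell S) (d3 f)"
    and z: "\<And>y. y \<in> ref_cell S \<Longrightarrow> f y = 0" and y: "y \<in> ref_cell S"
  shows "d3 f y = 0"
proof (rule ref_cell_ext[OF c _ y])
  fix x assume x: "x \<in> interior (ref_cell S)"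
  let ?u = "horiz x" and ?t = "x $ 3"
  have u: "?u \<in> ref_base S" "0 < ?t" "?t < 1"
    using x interior_subset by (auto simp: interior_ref_cell)
  have "\<forall>\<^sub>F s in nhds ?t. f (pt ?u s) = 0"
    using u by (intro eventually_mono[OF eventually_nhds_in_open[of "{0<..<1}"]])
      (auto simp: pt_in_ref_cell intro!: z)
  then have "((\<lambda>s. f (pt ?u s)) has_real_derivative 0) (at ?t)"
    by (subst DERIV_cong_ev[OF refl _ refl, where g = "\<lambda>s. 0"]) auto
  from d3_eqI[OF f this] show "d3 f x = 0" by simp
qed

lemma d3_add:
  assumes "f differentiable (at y)" "g differentiable (at y)"
  shows "d3 (\<lambda>y. f y + g y) y = d3 f y + d3 g y"
proof -
  have "((\<lambda>y. f y + g y) has_derivative (\<lambda>h. frechet_derivative f (at y) h + frechet_derivative g (at y) h)) (at y)"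
    using assms by (intro has_derivative_add) (auto simp flip: frechet_derivative_works)
  from frechet_derivative_at[OF this, symmetric] show ?thesis
    unfolding d3_def by simp
qed

lemma sum_fun_apply: "(\<Sum>i\<in>I. f i) x = (\<Sum>i\<in>I. f i x)"
  for f :: "'i \<Rightarrow> 'x \<Rightarrow> real"
  by (induction I rule: infinite_finite_induct) auto

context mesh_column
begin

section \<open>The balance pulled back to the reference cell\<close>

lemma D_horiz_differentiable: "(\<lambda>y. D (horiz y)) differentiable (at y)"
  unfolding base_det_def bil1_def bil2_def horiz_nth
  by (intro differentiable_add differentiable_mult differentiable_diff differentiable_const
      bounded_linear_imp_differentiable bounded_linear_vec_nth)

definition pres :: "(nat \<Rightarrow> real^3 \<Rightarrow> real) \<Rightarrow> nat \<Rightarrow> real^3 \<Rightarrow> real" where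
  "pres \<rho> k y = \<rho> k y / (vdet k y)"

text \<open>The vertical derivative of \<open>pres \<rho> k\<close>, whose denominator does not
  depend on the height.\<close>

definition dpres :: "(nat \<Rightarrow> real^3 \<Rightarrow> real) \<Rightarrow> nat \<Rightarrow> real^3 \<Rightarrow> real" where
  "dpres \<rho> k y = d3 (\<rho> k) y / (vdet k y)"

lemma V3_bar_pres:
  assumes "P \<in> V3_bar E M c"
  shows "\<exists>\<rho>. \<forall>k<n. \<rho> k \<in> ref_V3 E \<and> (\<forall>y\<in>R. P k (F k y) = pres \<rho> k y)"
proof -
  obtain P0 where P0: "P0 \<in> V3 E M" "P = column_restrict M c P0"
    using assms unfolding V3_bar_def V3_col_def by blast
  have "\<exists>\<rho>. k < n \<longrightarrow> \<rho> \<in> ref_V3 E \<and> (\<forall>y\<in>R. P k (F k y) = \<rho> y / (vdet k y))" for k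
  proof (cases "k < n")
    case True
    then have "P0 (c, k) \<in> cell_V3 E M (c, k)"
      using P0(1) in_cells[OF True] unfolding V3_def by blast
    then obtain \<rho> where \<rho>: "\<rho> \<in> ref_V3 E"
      "P0 (c, k) = (\<lambda>x\<in>C k. let y = ref_point M (c, k) x in \<rho> y / det (jac (F k) y))"
      unfolding cell_V3_def by blast
    have "P k (F k y) = \<rho> y / (vdet k y)" if "y \<in> R" for y
      using True that vertical_cell.det_jac[OF cell[OF True]]
      by (simp add: P0(2) column_restrict_def \<rho>(2) cell_eq ref_point_F)
    with \<rho>(1) show ?thesis by blast
  qed blast
  then show ?thesis unfolding pres_def by metis
qed

lemma denominator_nz: "k < n \<Longrightarrow> y \<in> R \<Longrightarrow> vdet k y \<noteq> 0"
  using D_nz[of "horiz y"] m_pos[of k "horiz y"] by (simp add: ref_cell_iff)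

lemma ref_V3_differentiable: "f \<in> ref_V3 E \<Longrightarrow> f differentiable (at y)"
  unfolding ref_V3_def using tensor_differentiable DG by blast

lemma pres_continuous_on:
  assumes "k < n" "\<rho> k \<in> ref_V3 E"
  shows "continuous_on R (pres \<rho> k)" "continuous_on R (dpres \<rho> k)"
proof -
  have \<rho>: "\<rho> k \<in> tensor (base_DG E) (interval_space (vdeg E - 1))"
    using assms(2) by (simp add: ref_V3_def)
  show "continuous_on R (pres \<rho> k)" "continuous_on R (dpres \<rho> k)"
    unfolding pres_def dpres_def using denominator_nz[OF assms(1)]
    by (intro continuous_on_divide continuous_on_mult continuous_intros
        tensor_continuous_on[OF \<rho> DG] tensor_d3(1)[OF \<rho> DG]; blast)+
qed

lemma DERIV_pres:
  assumes "k < n" "\<rho> k \<in> ref_V3 E"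
  shows "((\<lambda>s. pres \<rho> k (pt u s)) has_real_derivative dpres \<rho> k (pt u t)) (at t)"
  unfolding pres_def dpres_def horiz_pt
  by (intro DERIV_cdivide DERIV_d3 ref_V3_differentiable assms)

lemma ring_space_tens: "U \<in> ring_space \<Longrightarrow> k < n \<Longrightarrow> U k \<in> tens"
  by (simp add: ring_space_def)

lemma mult_differentiable: "f \<in> tens \<Longrightarrow> g \<in> tens \<Longrightarrow> (\<lambda>y. f y * g y) differentiable (at y)"
  by (intro differentiable_mult tens_differentiable)

lemma d3_mult_tens: "f \<in> tens \<Longrightarrow> g \<in> tens \<Longrightarrow> d3 (\<lambda>y. f y * g y) = (\<lambda>y. d3 f y * g y + f y * d3 g y)"
  by (intro ext d3_mult tens_differentiable)

lemma d3_mult_continuous_on: "f \<in> tens \<Longrightarrow> g \<in> tens \<Longrightarrow> continuous_on T (d3 (\<lambda>y. f y * g y))"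
  unfolding d3_mult_tens by (intro continuous_intros tens_continuous_on tens_d3_continuous_on)

lemma divergence_temp_vel:
  assumes k: "k < n" and U: "U k \<in> tens" and V: "V k \<in> tens" and y: "y \<in> interior R"
  shows "divergence (\<lambda>x. temp U k x *\<^sub>R vel V k x) (F k y)
    = d3 (\<lambda>y. U k y * V k y) y / (vdet k y)"
proof -
  have yR: "y \<in> R" using y interior_subset by blast
  let ?s = "\<lambda>z. U k z * V k z / D (horiz z)"
  have s: "?s differentiable (at y)"
    by (intro differentiable_divide mult_differentiable U V D_horiz_differentiable D_nz)
      (use yR in simp)
  have "((\<lambda>\<tau>. ?s (pt (horiz y) \<tau>)) has_real_derivative
      d3 (\<lambda>y. U k y * V k y) (pt (horiz y) (y $ 3)) / D (horiz y)) (at (y $ 3))"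
    unfolding horiz_pt by (intro DERIV_cdivide DERIV_d3 mult_differentiable U V)
  then have "d3 ?s y = d3 (\<lambda>y. U k y * V k y) y / D (horiz y)"
    using d3_eqI[of ?s "horiz y" "y $ 3"] s by simp
  moreover have "divergence (\<lambda>x. temp U k x *\<^sub>R vel V k x) (F k y) = d3 ?s y / bil (m k) (horiz y)"
    by (rule vertical_cell.divergence_vertical_field[OF cell[OF k] y s]) (simp add: temp_F vel_F k)
  ultimately show ?thesis by simp
qed

text \<open>No Jacobian appears: the factor \<open>1 / (D * m)\<close> of the divergence cancels the
  volume factor up to the sign of \<open>D\<close>. That sign is omitted here and in
  \<open>weight\<close>, and \<open>hydrostatic_balance_iff\<close> restores it as a common
  factor.\<close>

definition energy :: "(nat \<Rightarrow> real^3 \<Rightarrow> real) \<Rightarrow> (nat \<Rightarrow> real^3 \<Rightarrow> real) \<Rightarrow> (nat \<Rightarrow> real^3 \<Rightarrow> real) \<Rightarrow> real" where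
  "energy \<rho> U V = - (\<Sum>k<n. ref_int S (\<lambda>y. d3 (\<lambda>y. U k y * V k y) y * pres \<rho> k y))"

definition weight :: "(nat \<Rightarrow> real^3 \<Rightarrow> real) \<Rightarrow> real" where
  "weight V = (\<Sum>k<n. ref_int S (\<lambda>y. V k y * bil (m k) (horiz y)))"

lemma hydrostatic_balance_iff:
  assumes P: "\<And>k. k < n \<Longrightarrow> \<rho> k \<in> ref_V3 E" "\<And>k y. k < n \<Longrightarrow> y \<in> R \<Longrightarrow> P k (F k y) = pres \<rho> k y"
    and U: "U \<in> ring_space" and W: "V2v_col E M c = vel ` ring_space"
  shows "hydrostatic_balance E M c g P (temp U) \<longleftrightarrow> (\<forall>V\<in>ring_space. energy \<rho> U V = g * weight V)"
proof -
  let ?\<sigma> = "sgn (D 0)"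
  have 1: "column_integral M c (\<lambda>k x. divergence (\<lambda>x. temp U k x *\<^sub>R vel V k x) x * P k x) = - ?\<sigma> * energy \<rho> U V"
    if V: "V \<in> ring_space" for V
  proof -
    have "(LINT x:C k|lebesgue. divergence (\<lambda>x. temp U k x *\<^sub>R vel V k x) x * P k x)
       = ?\<sigma> * ref_int S (\<lambda>y. d3 (\<lambda>y. U k y * V k y) y * pres \<rho> k y)" if k: "k < n" for k
    proof -
      note UV = ring_space_tens[OF U k] ring_space_tens[OF V k]
      let ?h = "\<lambda>y. d3 (\<lambda>y. U k y * V k y) y / (vdet k y) * pres \<rho> k y"
      have "continuous_on R ?h"
        using denominator_nz[OF k]
        by (intro continuous_intros d3_mult_continuous_on UV pres_continuous_on k P) auto
      then have "(LINT x:C k|lebesgue. divergence (\<lambda>x. temp U k x *\<^sub>R vel V k x) x * P k x)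
        = ref_int S (\<lambda>y. \<bar>vdet k y\<bar> * ?h y)"
        unfolding cell_eq using interior_subset[of R]
        by (intro vertical_cell.cell_integral(2)[OF cell[OF k]]) (auto simp: divergence_temp_vel k UV P)
      also have "\<dots> = ref_int S (\<lambda>y. ?\<sigma> * (d3 (\<lambda>y. U k y * V k y) y * pres \<rho> k y))"
        by (intro ref_int_cong) (use abs_det[OF k] denominator_nz[OF k] in \<open>simp add: field_simps\<close>)
      finally show ?thesis by (simp only: ref_int_cmult)
    qed
    then show ?thesis by (simp add: column_integral_def energy_def sum_distrib_left sum_negf)
  qed
  have 2: "column_integral M c (\<lambda>k x. (vel V k x \<bullet> up) * g) = ?\<sigma> * (g * weight V)"
    if V: "V \<in> ring_space" for V
  proof -
    have "(LINT x:C k|lebesgue. (vel V k x \<bullet> up) * g)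
       = ?\<sigma> * (g * ref_int S (\<lambda>y. V k y * bil (m k) (horiz y)))" if k: "k < n" for k
    proof -
      note Vk = ring_space_tens[OF V k]
      let ?h = "\<lambda>y. V k y / D (horiz y) * g"
      have "continuous_on R ?h"
        using D_nz by (intro continuous_intros tens_continuous_on Vk) auto
      then have "(LINT x:C k|lebesgue. (vel V k x \<bullet> up) * g)
        = ref_int S (\<lambda>y. \<bar>vdet k y\<bar> * ?h y)"
        unfolding cell_eq using interior_subset[of R]
        by (intro vertical_cell.cell_integral(2)[OF cell[OF k]])
           (auto simp: vel_F k subset_iff inner_axis_axis)
      also have "\<dots> = ref_int S (\<lambda>y. (?\<sigma> * g) * (V k y * bil (m k) (horiz y)))"
        by (intro ref_int_cong) (use abs_det[OF k] D_nz in \<open>simp add: field_simps\<close>)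
      finally show ?thesis by (simp only: ref_int_cmult mult.assoc)
    qed
    then show ?thesis unfolding column_integral_def weight_def sum_distrib_left by (intro sum.cong) auto
  qed
  have "hydrostatic_balance E M c g P (temp U) \<longleftrightarrow>
      (\<forall>V\<in>ring_space. 0 = ?\<sigma> * energy \<rho> U V - ?\<sigma> * (g * weight V))"
    unfolding hydrostatic_balance_def W by (simp add: 1 2)
  then show ?thesis using sgn_D0 by auto
qed

text \<open>Integration by parts in each cell moves the derivative to the pressure and leaves terms
  on its two faces. The outermost ones vanish with \<open>U\<close>; the others are paired facet by
  facet, where the common value of \<open>U\<close> factors out and the jump of the pressure
  remains.\<close>

lemma energy_by_parts:
  assumes P: "\<And>k. k < n \<Longrightarrow> \<rho> k \<in> ref_V3 E" and U: "U \<in> ring_space"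
  shows "energy \<rho> U U = (\<Sum>k<n. ref_int S (\<lambda>y. (U k y)\<^sup>2 * dpres \<rho> k y)) +
    (\<Sum>k<n - 1. ref_int S (\<lambda>y. (U (Suc k) (pt (horiz y) 0))\<^sup>2 *
       (pres \<rho> (Suc k) (pt (horiz y) 0) - pres \<rho> k (pt (horiz y) 1))))"
proof -
  let ?H = "\<lambda>k y. (U k y)\<^sup>2 * pres \<rho> k y"
  let ?T = "\<lambda>k. ref_int S (\<lambda>y. ?H k (pt (horiz y) 1))" and ?L = "\<lambda>k. ref_int S (\<lambda>y. ?H k (pt (horiz y) 0))"
  let ?d = "\<lambda>k y. d3 (\<lambda>y. U k y * U k y) y * pres \<rho> k y"
  have c: "continuous_on R (?H k)" if "k < n" for k
    by (intro continuous_intros tens_continuous_on ring_space_tens U that pres_continuous_on P)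
  have parts: "ref_int S (?d k) + ref_int S (\<lambda>y. (U k y)\<^sup>2 * dpres \<rho> k y) = ?T k - ?L k" if k: "k < n" for k
  proof -
    note Uk = ring_space_tens[OF U k]
    have cd: "continuous_on R (?d k)" "continuous_on R (\<lambda>y. (U k y)\<^sup>2 * dpres \<rho> k y)"
      by (intro continuous_intros d3_mult_continuous_on tens_continuous_on Uk pres_continuous_on k P)+
    have "ref_int S (\<lambda>y. ?d k y + (U k y)\<^sup>2 * dpres \<rho> k y) = ?T k - ?L k"
    proof (rule ref_int_vertical_derivative[OF _ c[OF k]])
      show "((\<lambda>s. (U k (pt u s))\<^sup>2 * pres \<rho> k (pt u s)) has_real_derivative
           d3 (\<lambda>y. U k y * U k y) (pt u t) * pres \<rho> k (pt u t) + (U k (pt u t))\<^sup>2 * dpres \<rho> k (pt u t)) (at t)" for u t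
        using DERIV_mult[OF DERIV_d3[OF mult_differentiable[OF Uk Uk]] DERIV_pres[OF k, of \<rho> u t]] P[OF k]
        by (simp add: power2_eq_square algebra_simps)
    qed (rule continuous_on_add[OF cd])
    then show ?thesis using ref_int_add[OF cd] by simp
  qed
  \<comment> \<open>With \<open>n = Suc N\<close> the upper faces lose their last term and the lower
    faces their first, so both sums run over the \<open>N\<close> interior facets.\<close>
  obtain N where N: "n = Suc N" using n_pos gr0_implies_Suc by blast
  have T0: "?T N = 0" and L0: "?L 0 = 0"
    using U N by (auto intro!: ref_int_zero simp: ring_space_def)
  have jump: "?L (Suc k) - ?T k = ref_int S (\<lambda>y. (U (Suc k) (pt (horiz y) 0))\<^sup>2 *
       (pres \<rho> (Suc k) (pt (horiz y) 0) - pres \<rho> k (pt (horiz y) 1)))" if k: "k < N" for k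
  proof -
    have "?L (Suc k) - ?T k = ref_int S (\<lambda>y. ?H (Suc k) (pt (horiz y) 0) - ?H k (pt (horiz y) 1))"
      using k N by (intro ref_int_diff[symmetric] continuous_on_face c) auto
    also have "\<dots> = ref_int S (\<lambda>y. (U (Suc k) (pt (horiz y) 0))\<^sup>2 *
       (pres \<rho> (Suc k) (pt (horiz y) 0) - pres \<rho> k (pt (horiz y) 1)))"
      using U k N by (intro ref_int_cong) (simp add: ring_space_def algebra_simps)
    finally show ?thesis .
  qed
  have "energy \<rho> U U = (\<Sum>k<n. ref_int S (\<lambda>y. (U k y)\<^sup>2 * dpres \<rho> k y) - (?T k - ?L k))"
    unfolding energy_def sum_negf[symmetric] by (intro sum.cong refl) (use parts in \<open>force\<close>)
  also have "\<dots> = (\<Sum>k<n. ref_int S (\<lambda>y. (U k y)\<^sup>2 * dpres \<rho> k y)) - (\<Sum>k<Suc N. ?T k) + (\<Sum>k<Suc N. ?L k)"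
    unfolding N by (simp add: sum_subtractf)
  also have "(\<Sum>k<Suc N. ?T k) = (\<Sum>k<N. ?T k)" by (simp only: sum.lessThan_Suc T0 add_0_right)
  also have "(\<Sum>k<Suc N. ?L k) = (\<Sum>k<N. ?L (Suc k))"
    by (simp only: sum.lessThan_Suc_shift L0 add_0_left)
  finally have "energy \<rho> U U = (\<Sum>k<n. ref_int S (\<lambda>y. (U k y)\<^sup>2 * dpres \<rho> k y)) + (\<Sum>k<N. ?L (Suc k) - ?T k)"
    by (simp add: sum_subtractf)
  also have "(\<Sum>k<N. ?L (Suc k) - ?T k) = (\<Sum>k<N. ref_int S (\<lambda>y. (U (Suc k) (pt (horiz y) 0))\<^sup>2 *
       (pres \<rho> (Suc k) (pt (horiz y) 0) - pres \<rho> k (pt (horiz y) 1))))"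
    by (intro sum.cong refl jump) simp
  finally show ?thesis using N by simp
qed

text \<open>Every term in \<open>energy_by_parts\<close> is nonnegative and hence zero; what this
  says about \<open>U\<close> depends on the vertical degree of the pressure.\<close>

lemma energy_definite:
  assumes P: "\<And>k. k < n \<Longrightarrow> \<rho> k \<in> ref_V3 E" "\<And>k y. k < n \<Longrightarrow> y \<in> R \<Longrightarrow> P k (F k y) = pres \<rho> k y"
    and jump: "\<And>k x. Suc k < n \<Longrightarrow> x \<in> interior_facet M c k \<Longrightarrow> P (Suc k) x - P k x > 0"
    and incr: "\<And>k x. vdeg E - 1 \<ge> 1 \<Longrightarrow> k < n \<Longrightarrow> x \<in> interior (C k) \<Longrightarrow> vertical_derivative (P k) x > 0"
    and U: "U \<in> ring_space" and 0: "energy \<rho> U U = 0" and k: "k < n" and y: "y \<in> R"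
  shows "U k y = 0"
proof -
  \<comment> \<open>Strict positivity is given in the open cells and on facets without their edges.
    On the closed sets the weak inequality survives, which is enough for nonnegative
    integrands.\<close>
  have closure_ge: "0 \<le> f z" if c: "continuous_on R f" and p: "\<And>x. x \<in> interior R \<Longrightarrow> 0 < f x" and z: "z \<in> R"
    for f :: "real^3 \<Rightarrow> real" and z
    using continuous_ge_on_closure[of "interior R" f z 0] c p z
    by (simp add: ref_cell_closure less_imp_le)
  let ?J = "\<lambda>k y. pres \<rho> (Suc k) (pt (horiz y) 0) - pres \<rho> k (pt (horiz y) 1)"
  have J_cont: "continuous_on R (?J k)" if "Suc k < n" for k
  proof -
    have "continuous_on R (pres \<rho> j)" if "j < n" for j
      using pres_continuous_on(1)[where \<rho> = \<rho>, OF that P(1)[OF that]] .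
    then show ?thesis using that by (intro continuous_on_diff continuous_on_face) auto
  qed
  have J_pos: "0 < ?J k y" if k: "Suc k < n" and y: "y \<in> interior R" for k y
  proof -
    have u: "horiz y \<in> interior B" "horiz y \<in> B"
      using y interior_subset by (auto simp: interior_ref_cell)
    have "F k (pt (horiz y) 1) \<in> interior_facet M c k"
      unfolding interior_facet_def using u by auto
    from jump[OF k this] show ?thesis
      using P(2)[of k "pt (horiz y) 1"] P(2)[of "Suc k" "pt (horiz y) 0"] F_pt_Suc[OF k u(2)] k u
      by (simp add: pt_in_ref_cell)
  qed
  have J_nonneg: "0 \<le> ?J k y" if "Suc k < n" "y \<in> R" for k y
    using closure_ge[OF J_cont J_pos] that by blast
  have d_pos: "0 < dpres \<rho> k y" if s: "vdeg E - 1 \<ge> 1" and k: "k < n" and y: "y \<in> interior R" for k y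
  proof -
    have yR: "y \<in> R" using y interior_subset by blast
    let ?s = "pres \<rho> k"
    have "?s differentiable (at y)"
    proof -
      have "(\<lambda>y. bil (m k) (horiz y)) differentiable (at y)"
        using bil_has_derivative by (rule differentiableI)
      then have "(\<lambda>y. vdet k y) differentiable (at y)"
        by (rule differentiable_mult[OF D_horiz_differentiable])
      then show ?thesis unfolding pres_def[abs_def] using denominator_nz[OF k yR]
        by (rule differentiable_divide[OF ref_V3_differentiable[OF P(1)[OF k], of y]])
    qed
    then have "vertical_derivative (P k) (F k y) = d3 ?s y / bil (m k) (horiz y)"
      by (rule vertical_cell.vertical_derivative_cell[OF cell[OF k] y]) (rule P(2)[OF k])
    moreover have "d3 ?s y = dpres \<rho> k y"
      using d3_eqI[of ?s "horiz y" "y $ 3"] \<open>?s differentiable (at y)\<close> DERIV_pres[of k \<rho> "horiz y" "y $ 3"] k P by simp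
    moreover have "F k y \<in> interior (C k)"
      using vertical_cell.F_interior_subset[OF cell[OF k]] y unfolding cell_eq by blast
    ultimately have "0 < dpres \<rho> k y / bil (m k) (horiz y)" using incr[OF s k] by force
    then show ?thesis using m_pos[OF k, of "horiz y"] yR by (simp add: zero_less_divide_iff)
  qed
  have d_nonneg: "0 \<le> dpres \<rho> k y" if k: "k < n" and y: "y \<in> R" for k y
  proof (cases "vdeg E - 1 \<ge> 1")
    case True
    then show ?thesis using closure_ge[OF pres_continuous_on(2)[where \<rho> = \<rho>, OF k P(1)[OF k]] d_pos] k y by blast
  next
    case False
    then have "d3 (\<rho> k) = (\<lambda>y. 0)"
      using P(1)[OF k] DG unfolding ref_V3_def by (intro tensor_d3(2)) auto
    then show ?thesis by (simp add: dpres_def)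
  qed
  have sq_cont: "continuous_on R (\<lambda>y. (U j (pt (horiz y) 0))\<^sup>2)" if "j < n" for j
    by (intro continuous_on_power continuous_on_face tens_continuous_on ring_space_tens U that) simp
  have nn1: "0 \<le> ref_int S (\<lambda>y. (U k y)\<^sup>2 * dpres \<rho> k y)" if "k < n" for k
    using d_nonneg[OF that] by (intro ref_int_nonneg) simp
  have nn2: "0 \<le> ref_int S (\<lambda>y. (U (Suc k) (pt (horiz y) 0))\<^sup>2 * ?J k y)" if "Suc k < n" for k
    using J_nonneg[OF that] by (intro ref_int_nonneg) simp
  let ?A = "\<Sum>k<n. ref_int S (\<lambda>y. (U k y)\<^sup>2 * dpres \<rho> k y)"
  let ?B = "\<Sum>k<n - 1. ref_int S (\<lambda>y. (U (Suc k) (pt (horiz y) 0))\<^sup>2 * ?J k y)"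
  have "0 \<le> ?A" "0 \<le> ?B" using nn1 nn2 by (auto intro!: sum_nonneg)
  moreover have "?A + ?B = 0" using energy_by_parts[OF P(1) U] 0 by simp
  ultimately have AB: "?A = 0" "?B = 0" by linarith+
  have A0: "ref_int S (\<lambda>y. (U k y)\<^sup>2 * dpres \<rho> k y) = 0" if "k < n" for k
    using AB(1) nn1 that by (subst (asm) sum_nonneg_eq_0_iff) auto
  have B0: "ref_int S (\<lambda>y. (U (Suc k) (pt (horiz y) 0))\<^sup>2 * ?J k y) = 0" if "Suc k < n" for k
    using AB(2) nn2 that by (subst (asm) sum_nonneg_eq_0_iff) auto
  show ?thesis
  proof (cases "vdeg E - 1 \<ge> 1")
    case True
    have "U k x = 0" if x: "x \<in> interior R" for x
    proof -
      have "(U k x)\<^sup>2 * dpres \<rho> k x = 0"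
      proof (rule ref_int_eq_0[OF _ _ A0[OF k]])
        show "continuous_on R (\<lambda>y. (U k y)\<^sup>2 * dpres \<rho> k y)"
          by (intro continuous_intros tens_continuous_on ring_space_tens U k pres_continuous_on P)
        show "x \<in> R" using x interior_subset by blast
      qed (simp add: d_nonneg k)
      then show ?thesis using d_pos[OF True k x] by simp
    qed
    then show ?thesis
      using ref_cell_ext[OF tens_continuous_on[OF ring_space_tens[OF U k]] _ y] by blast
  next
    case False
    \<comment> \<open>Lowest order: the jump terms annihilate \<open>U\<close> on each interior
      facet. With the end condition this covers every lower face, and continuity then passes it to
      the upper faces.\<close>
    have bottom: "U j (pt u 0) = 0" if j: "j < n" and u: "u \<in> B" for j u
    proof (cases j)
      case 0
      then show ?thesis using U u by (simp add: ring_space_def)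
    next
      case (Suc i)
      have i: "Suc i < n" using Suc j by simp
      have "U (Suc i) (pt (horiz x) 0) = 0" if x: "x \<in> interior R" for x
      proof -
        have "(U (Suc i) (pt (horiz x) 0))\<^sup>2 * ?J i x = 0"
        proof (rule ref_int_eq_0[OF _ _ B0[OF i]])
          show "continuous_on R (\<lambda>y. (U (Suc i) (pt (horiz y) 0))\<^sup>2 * ?J i y)"
            by (intro continuous_on_mult sq_cont J_cont i)
          show "x \<in> R" using x interior_subset by blast
        qed (intro mult_nonneg_nonneg zero_le_power2 J_nonneg[OF i])
        then show ?thesis using J_pos[OF i x] by simp
      qed
      \<comment> \<open>The height \<open>1/2\<close> is an arbitrary interior one: the function
        depends on the base point alone.\<close>
      then have "U (Suc i) (pt v 0) = 0" if "v \<in> interior B" for v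
        using that by (auto simp: interior_ref_cell dest: spec[of _ "pt v (1/2)"] 
          intro: \<open>\<And>x. x \<in> interior R \<Longrightarrow> U (Suc i) (pt (horiz x) 0) = 0\<close>[of "pt v (1/2)", simplified])
      moreover have "continuous_on B (\<lambda>v. U (Suc i) (pt v 0))"
        by (rule continuous_on_compose2[OF tens_continuous_on[OF ring_space_tens[OF U i], of UNIV]])
           (auto intro!: continuous_intros)
      ultimately show ?thesis using ref_base_ext[of S "\<lambda>v. U (Suc i) (pt v 0)"] u Suc by blast
    qed
    have top: "U k (pt u 1) = 0" if u: "u \<in> B" for u
    proof (cases "Suc k < n")
      case True
      then have "U k (pt u 1) = U (Suc k) (pt u 0)" using U u by (simp add: ring_space_def)
      then show ?thesis using bottom[OF True u] by simp
    next
      case False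
      then have "k = n - 1" using k by simp
      then show ?thesis using U u by (simp add: ring_space_def)
    qed
    have "U k (pt (horiz y) (y $ 3)) = (1 - y $ 3) * U k (pt (horiz y) 0) + y $ 3 * U k (pt (horiz y) 1)"
      using False by (intro tensor_d3(3)[OF ring_space_tens[OF U k] DG]) auto
    then show ?thesis using bottom[OF k] top y by simp
  qed
qed

text \<open>A member of \<open>ring_space\<close> that vanishes on the cells lies in the radical of
  the form and in the kernel of the load. This is the degeneracy that
  \<open>representer_on_subspace\<close> tolerates.\<close>

lemma energy_zero:
  assumes P: "\<And>k. k < n \<Longrightarrow> \<rho> k \<in> ref_V3 E" and U: "U \<in> ring_space" "V \<in> ring_space"
    and z: "\<And>k y. k < n \<Longrightarrow> y \<in> R \<Longrightarrow> U k y = 0"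
  shows "energy \<rho> V U = 0" "weight U = 0"
proof -
  have "ref_int S (\<lambda>y. d3 (\<lambda>y. V k y * U k y) y * pres \<rho> k y) = 0" if k: "k < n" for k
  proof (rule ref_int_zero)
    fix y assume y: "y \<in> R"
    have "d3 (\<lambda>y. V k y * U k y) y = 0"
      by (rule d3_eq_0_of_zero[OF _ _ _ y])
        (auto intro!: mult_differentiable d3_mult_continuous_on ring_space_tens U k simp: z[OF k])
    then show "d3 (\<lambda>y. V k y * U k y) y * pres \<rho> k y = 0" by simp
  qed
  then show "energy \<rho> V U = 0" by (simp add: energy_def)
  have "ref_int S (\<lambda>y. U k y * bil (m k) (horiz y)) = 0" if k: "k < n" for k
    by (rule ref_int_zero) (simp add: z[OF k])
  then show "weight U = 0" by (simp add: weight_def)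
qed

section \<open>Linearity of the form and of the load\<close>

lemma energy_add:
  assumes P: "\<And>k. k < n \<Longrightarrow> \<rho> k \<in> ref_V3 E" and U: "U \<in> ring_space" "U' \<in> ring_space" "V \<in> ring_space"
  shows "energy \<rho> (\<lambda>k y. U k y + U' k y) V = energy \<rho> U V + energy \<rho> U' V"
proof -
  have "ref_int S (\<lambda>y. d3 (\<lambda>y. (U k y + U' k y) * V k y) y * pres \<rho> k y)
     = ref_int S (\<lambda>y. d3 (\<lambda>y. U k y * V k y) y * pres \<rho> k y)
       + ref_int S (\<lambda>y. d3 (\<lambda>y. U' k y * V k y) y * pres \<rho> k y)" if k: "k < n" for k
  proof -
    note UV = ring_space_tens[OF U(1) k] ring_space_tens[OF U(2) k] ring_space_tens[OF U(3) k]
    have "d3 (\<lambda>y. (U k y + U' k y) * V k y) y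
      = d3 (\<lambda>y. U k y * V k y) y + d3 (\<lambda>y. U' k y * V k y) y" for y
      unfolding distrib_right by (intro d3_add mult_differentiable UV)
    then have "d3 (\<lambda>y. (U k y + U' k y) * V k y) y * pres \<rho> k y
      = d3 (\<lambda>y. U k y * V k y) y * pres \<rho> k y + d3 (\<lambda>y. U' k y * V k y) y * pres \<rho> k y" for y
      by (simp only: distrib_right)
    then show ?thesis
      by (simp only:) (intro ref_int_add continuous_intros d3_mult_continuous_on UV pres_continuous_on k P)
  qed
  then show ?thesis by (simp add: energy_def sum.distrib)
qed

lemma energy_scale:
  assumes U: "U \<in> ring_space" "V \<in> ring_space"
  shows "energy \<rho> (\<lambda>k y. a * U k y) V = a * energy \<rho> U V"
proof -
  have "ref_int S (\<lambda>y. d3 (\<lambda>y. (a * U k y) * V k y) y * pres \<rho> k y)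
     = a * ref_int S (\<lambda>y. d3 (\<lambda>y. U k y * V k y) y * pres \<rho> k y)" if k: "k < n" for k
  proof -
    note UV = ring_space_tens[OF U(1) k] ring_space_tens[OF U(2) k]
    have dU: "(\<lambda>y. U k y * V k y) differentiable (at y)" for y by (intro mult_differentiable UV)
    have "((\<lambda>y. a * (U k y * V k y)) has_derivative (\<lambda>h. a * frechet_derivative (\<lambda>y. U k y * V k y) (at y) h)) (at y)" for y
      using dU unfolding frechet_derivative_works by (intro has_derivative_mult_right) blast
    from frechet_derivative_at[OF this, symmetric]
    have "d3 (\<lambda>y. (a * U k y) * V k y) y = a * d3 (\<lambda>y. U k y * V k y) y" for y
      by (simp add: d3_def mult.assoc)
    then show ?thesis by (simp add: mult.assoc ref_int_cmult)
  qed
  then show ?thesis by (simp add: energy_def sum_distrib_left)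
qed

lemma energy_sym: "energy \<rho> U V = energy \<rho> V U"
  by (simp add: energy_def mult.commute)

lemma weight_add:
  assumes "U \<in> ring_space" "V \<in> ring_space"
  shows "weight (\<lambda>k y. U k y + V k y) = weight U + weight V"
proof -
  have "ref_int S (\<lambda>y. (U k y + V k y) * bil (m k) (horiz y)) =
     ref_int S (\<lambda>y. U k y * bil (m k) (horiz y)) + ref_int S (\<lambda>y. V k y * bil (m k) (horiz y))" if k: "k < n" for k
    unfolding distrib_right
    by (intro ref_int_add continuous_intros tens_continuous_on ring_space_tens assms k)
  then show ?thesis by (simp add: weight_def sum.distrib)
qed

lemma weight_scale: "weight (\<lambda>k y. a * U k y) = a * weight U"
  by (simp add: weight_def sum_distrib_left mult.assoc ref_int_cmult)

section \<open>Finite dimension and solvability\<close>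

lemma ring_space_add: "U \<in> ring_space \<Longrightarrow> V \<in> ring_space \<Longrightarrow> (\<lambda>k y. U k y + V k y) \<in> ring_space"
  by (simp add: ring_space_def tensor_add)

lemma ring_space_scale: "U \<in> ring_space \<Longrightarrow> (\<lambda>k y. a * U k y) \<in> ring_space"
  using tensor_scale[of _ "base_DG E" "vdeg E" a] by (simp add: ring_space_def)

lemma ring_space_zero: "(\<lambda>k y. 0) \<in> ring_space"
  by (simp add: ring_space_def tensor_zero)

text \<open>Families in \<open>ring_space\<close>, uncurried and set to zero off the column, to fit them
  into a function space.\<close>

definition coded :: "(nat \<times> (real^3) \<Rightarrow> real) set" where
  "coded = {v. (\<lambda>k y. v (k, y)) \<in> ring_space \<and> (\<forall>k\<ge>n. \<forall>y. v (k, y) = 0)}"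

lemma coded_subspace: "fun_space.subspace coded"
  unfolding fun_space.subspace_def coded_def
  using ring_space_zero ring_space_add ring_space_scale by (auto simp: zero_fun_def plus_fun_def)

text \<open>The spanning set consists of the products of a power \<open>t ^ j\<close>,
  \<open>j \<le> vdeg E\<close>, with a generator of \<open>base_DG E\<close>, one copy for each
  layer.\<close>

lemma coded_finite_span:
  "\<exists>T. finite T \<and> coded \<subseteq> fun_space.span T"
proof -
  obtain Bs where Bs: "finite Bs" "base_DG E = {f. \<exists>e. f = (\<lambda>x. \<Sum>b\<in>Bs. e b *\<^sub>R b x)}"
    using DG unfolding polynomial_space_def by blast
  let ?e = "\<lambda>k j b (p :: nat \<times> (real^3)). if fst p = k then (snd p $ 3) ^ j * b (horiz (snd p)) else (0::real)"
  let ?T = "(\<lambda>(k, j, b). ?e k j b) ` ({..<n} \<times> {..vdeg E} \<times> Bs)"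
  have single: "(\<lambda>p. if fst p = k then f (snd p) else 0) \<in> fun_space.span ?T" if k: "k < n" and f: "f \<in> tens" for k f
  proof -
    obtain N :: nat and w :: "nat \<Rightarrow> real poly" and a where a: "\<And>i. i < N \<Longrightarrow> a i \<in> base_DG E"
      and "\<And>i. i < N \<Longrightarrow> polynomial_function (a i)"
      and w: "\<And>i. i < N \<Longrightarrow> degree (w i) \<le> vdeg E"
      and f_eq: "f = (\<lambda>y. \<Sum>i<N. poly (w i) (y $ 3) * a i (horiz y))"
      by (rule tensor_polynomial_form[OF f DG]) (rule that)
    have "\<exists>e. i < N \<longrightarrow> a i = (\<lambda>x. \<Sum>b\<in>Bs. e b *\<^sub>R b x)" for i using a Bs(2) by blast
    then obtain e where e: "\<And>i. i < N \<Longrightarrow> a i = (\<lambda>x. \<Sum>b\<in>Bs. e i b *\<^sub>R b x)" by metis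
    \<comment> \<open>Padding with zero coefficients gives all \<open>w i\<close> the same range of
      powers.\<close>
    have pw: "poly (w i) t = (\<Sum>j\<le>vdeg E. coeff (w i) j * t ^ j)" if "i < N" for i t
      unfolding poly_altdef
      by (rule sum.mono_neutral_left) (use w[OF that] in \<open>auto simp: coeff_eq_0\<close>)
    have "(\<lambda>p. if fst p = k then f (snd p) else 0)
        = (\<Sum>i<N. \<Sum>j\<le>vdeg E. \<Sum>b\<in>Bs. (\<lambda>p. (coeff (w i) j * e i b) * ?e k j b p))" (is "?l = ?r")
    proof
      fix x
      show "?l x = ?r x"
        unfolding sum_fun_apply f_eq
        by (cases "fst x = k")
          (auto simp: pw e sum_product mult_ac intro!: sum.cong,
           auto simp: mult_ac intro!: trans[OF sum.swap] sum.cong)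
    qed
    also have "\<dots> \<in> fun_space.span ?T"
      by (intro fun_space.span_sum fun_space.span_scale fun_space.span_base)
        (use k in \<open>auto intro!: rev_image_eqI\<close>)
    finally show ?thesis .
  qed
  have "v \<in> fun_space.span ?T" if v: "v \<in> coded" for v
  proof -
    have "v = (\<Sum>k<n. (\<lambda>p. if fst p = k then v (k, snd p) else 0))" (is "_ = ?r")
    proof
      fix x :: "nat \<times> (real^3)"
      have "?r x = (\<Sum>k<n. if k = fst x then v x else 0)"
        unfolding sum_fun_apply by (intro sum.cong refl) auto
      also have "\<dots> = v x"
        using v by (cases x) (auto simp: coded_def)
      finally show "v x = ?r x" by simp
    qed
    also have "\<dots> \<in> fun_space.span ?T"
      using v by (intro fun_space.span_sum single) (auto simp: coded_def dest: ring_space_tens)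
    finally show ?thesis .
  qed
  moreover have "finite ?T" using Bs(1) by simp
  ultimately show ?thesis by blast
qed

lemma energy_representer:
  assumes P: "\<And>k. k < n \<Longrightarrow> \<rho> k \<in> ref_V3 E"
    and pos: "\<And>U k y. U \<in> ring_space \<Longrightarrow> energy \<rho> U U = 0 \<Longrightarrow> k < n \<Longrightarrow> y \<in> R \<Longrightarrow> U k y = 0"
  shows "\<exists>U\<in>ring_space. \<forall>V\<in>ring_space. energy \<rho> U V = g * weight V"
proof -
  let ?c = "\<lambda>(v :: nat \<times> (real^3) \<Rightarrow> real) k y. v (k, y)"
  have rs: "?c v \<in> ring_space" if "v \<in> coded" for v using that by (simp add: coded_def)
  obtain T where T: "finite T" "coded \<subseteq> fun_space.span T" using coded_finite_span by blast
  have "\<exists>u\<in>coded. \<forall>v\<in>coded. energy \<rho> (?c u) (?c v) = g * weight (?c v)"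
  proof (rule fun_space.representer_on_subspace[OF coded_subspace T])
    fix x z assume xz: "x \<in> coded" "z \<in> coded" "energy \<rho> (?c x) (?c x) = 0"
    show "energy \<rho> (?c z) (?c x) = 0"
      by (intro energy_zero(1) P rs xz) (use pos[OF rs[OF xz(1)] xz(3)] in auto)
  next
    fix x assume x: "x \<in> coded" "energy \<rho> (?c x) (?c x) = 0"
    show "g * weight (?c x) = 0"
      using energy_zero(2)[where \<rho> = \<rho>, OF P rs[OF x(1)] rs[OF x(1)]] pos[OF rs[OF x(1)] x(2)] by simp
  next
    fix x y show "energy \<rho> (?c x) (?c y) = energy \<rho> (?c y) (?c x)" by (rule energy_sym)
  qed (simp_all add: energy_add[where \<rho> = \<rho>, OF P] energy_scale weight_add weight_scale rs algebra_simps)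
  then obtain u where u: "u \<in> coded" "\<And>v. v \<in> coded \<Longrightarrow> energy \<rho> (?c u) (?c v) = g * weight (?c v)"
    by blast
  have "energy \<rho> (?c u) V = g * weight V" if V: "V \<in> ring_space" for V
  proof -
    \<comment> \<open>Cutting \<open>V\<close> off above the column changes neither
      \<open>energy\<close> nor \<open>weight\<close>, which use the layers below \<open>n\<close>
      only.\<close>
    let ?v = "\<lambda>(k, y). if k < n then V k y else 0"
    have "?v \<in> coded" using V n_pos by (auto simp: coded_def ring_space_def)
    from u(2)[OF this] show ?thesis by (simp add: energy_def weight_def)
  qed
  then show ?thesis using rs[OF u(1)] by blast
qed

text \<open>For uniqueness the difference of two solutions is tested with itself; it vanishes on the
  reference cell, which is all that \<open>temp\<close> reads. The description \<open>W\<close> of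
  the test velocities is kept as a hypothesis, to separate the linear problem from the work on
  H(div).\<close>

lemma unique_solution:
  assumes P: "P \<in> V3_bar E M c"
    and jump: "\<And>k x. Suc k < n \<Longrightarrow> x \<in> interior_facet M c k \<Longrightarrow> P (Suc k) x - P k x > 0"
    and incr: "\<And>k x. vdeg E - 1 \<ge> 1 \<Longrightarrow> k < n \<Longrightarrow> x \<in> interior (C k) \<Longrightarrow> vertical_derivative (P k) x > 0"
    and W: "V2v_col E M c = vel ` ring_space"
  shows "\<exists>!\<theta>. \<theta> \<in> Vt_ring E M c \<and> hydrostatic_balance E M c g P \<theta>"
proof -
  obtain \<rho> where \<rho>: "\<And>k. k < n \<Longrightarrow> \<rho> k \<in> ref_V3 E" "\<And>k y. k < n \<Longrightarrow> y \<in> R \<Longrightarrow> P k (F k y) = pres \<rho> k y"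
    using V3_bar_pres[OF P] by blast
  note bal = hydrostatic_balance_iff[OF \<rho> _ W]
  have pos: "U k y = 0" if "U \<in> ring_space" "energy \<rho> U U = 0" "k < n" "y \<in> R" for U k y
    by (rule energy_definite[OF \<rho> jump incr that])
  obtain U where U: "U \<in> ring_space" "\<And>V. V \<in> ring_space \<Longrightarrow> energy \<rho> U V = g * weight V"
  proof -
    have "\<exists>U\<in>ring_space. \<forall>V\<in>ring_space. energy \<rho> U V = g * weight V"
      by (rule energy_representer) (use \<rho>(1) pos in auto)
    then show ?thesis using that by blast
  qed
  show ?thesis
  proof (rule ex1I[of _ "temp U"])
    show "temp U \<in> Vt_ring E M c \<and> hydrostatic_balance E M c g P (temp U)"
      using U by (simp add: bal Vt_ring_eq)
  next
    fix \<theta> assume \<theta>: "\<theta> \<in> Vt_ring E M c \<and> hydrostatic_balance E M c g P \<theta>"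
    then obtain U' where U': "U' \<in> ring_space" "\<theta> = temp U'" unfolding Vt_ring_eq by blast
    then have e': "energy \<rho> U' V = g * weight V" if "V \<in> ring_space" for V
      using \<theta> that by (simp add: bal)
    let ?d = "\<lambda>k y. U' k y + (- 1) * U k y"
    have d: "?d \<in> ring_space" using U U' by (intro ring_space_add ring_space_scale)
    have "energy \<rho> ?d ?d = energy \<rho> U' ?d + (- 1) * energy \<rho> U ?d"
      using energy_add[where \<rho> = \<rho>, OF \<rho>(1) U'(1) ring_space_scale[OF U(1), of "-1"] d] energy_scale[OF U(1) d, of \<rho> "-1"] by simp
    also have "\<dots> = 0" using U(2)[OF d] e'[OF d] by simp
    finally have "?d k y = 0" if "k < n" "y \<in> R" for k y using pos[OF d _ that] by blast
    then have "U' k y = U k y" if "k < n" "y \<in> R" for k y using that by fastforce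
    then show "\<theta> = temp U"
      unfolding U'(2) temp_def by (auto intro!: restrict_ext simp: cell_eq ref_point_F)
  qed
qed

end

section \<open>H(div) on a column\<close>

lemma continuous_on_compact_square_integrable:
  assumes C: "compact C" and f: "continuous_on C f"
  shows "square_integrable C f"
proof -
  have "integrable lborel (\<lambda>x. indicator C x *\<^sub>R f x)"
    by (rule borel_integrable_compact[OF C f])
  then have "(\<lambda>x. indicator C x *\<^sub>R f x) \<in> borel_measurable lebesgue"
    by (intro measurable_completion borel_measurable_integrable)
  moreover have "integrable lborel (\<lambda>x. indicator C x *\<^sub>R (norm (f x))\<^sup>2)"
    by (intro borel_integrable_compact[OF C] continuous_intros f)
  then have "integrable lebesgue (\<lambda>x. indicator C x *\<^sub>R (norm (f x))\<^sup>2)"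
    by (subst integrable_completion) (auto dest: borel_measurable_integrable)
  ultimately show ?thesis
    by (simp add: square_integrable_def set_borel_measurable_def set_integrable_def)
qed

lemma square_integrable_subset:
  assumes "square_integrable T f" "S \<in> sets lebesgue" "S \<subseteq> T"
  shows "square_integrable S f"
proof -
  have "(\<lambda>x. indicator S x *\<^sub>R f x) = (\<lambda>x. indicator S x *\<^sub>R (indicator T x *\<^sub>R f x))"
    using assms(3) by (auto simp: indicator_def fun_eq_iff)
  moreover have "(\<lambda>x. indicator S x *\<^sub>R (indicator T x *\<^sub>R f x)) \<in> borel_measurable lebesgue"
    using assms(1,2) unfolding square_integrable_def set_borel_measurable_def
    by (intro borel_measurable_scaleR[OF borel_measurable_indicator[OF assms(2)]]) auto
  ultimately show ?thesis
    using assms set_integrable_subset[of lebesgue T _ S]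
    unfolding square_integrable_def set_borel_measurable_def by metis
qed

lemma square_integrable_add:
  fixes f g :: "'a::euclidean_space \<Rightarrow> real"
  assumes "square_integrable S f" "square_integrable S g"
  shows "square_integrable S (\<lambda>x. f x + g x)"
proof -
  have m: "(\<lambda>x. indicator S x *\<^sub>R (f x + g x)) \<in> borel_measurable lebesgue"
    using assms unfolding square_integrable_def set_borel_measurable_def scaleR_add_right
    by (intro borel_measurable_add) auto
  have "integrable lebesgue (\<lambda>x. 2 * (indicator S x *\<^sub>R (norm (f x))\<^sup>2) + 2 * (indicator S x *\<^sub>R (norm (g x))\<^sup>2))"
    using assms unfolding square_integrable_def set_integrable_def by simp
  then have "integrable lebesgue (\<lambda>x. indicator S x *\<^sub>R (norm (f x + g x))\<^sup>2)"
  proof (rule Bochner_Integration.integrable_bound)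
    have "(\<lambda>x. (indicator S x *\<^sub>R (f x + g x))\<^sup>2) \<in> borel_measurable lebesgue"
      using m by (rule borel_measurable_power)
    moreover have "(\<lambda>x. (indicator S x *\<^sub>R (f x + g x))\<^sup>2) = (\<lambda>x. indicator S x *\<^sub>R (norm (f x + g x))\<^sup>2)"
      by (auto simp: indicator_def fun_eq_iff)
    ultimately show "(\<lambda>x. indicator S x *\<^sub>R (norm (f x + g x))\<^sup>2) \<in> borel_measurable lebesgue" by simp
    have "(f x + g x)\<^sup>2 \<le> 2 * (f x)\<^sup>2 + 2 * (g x)\<^sup>2" for x
      using zero_le_power2[of "f x - g x"] by (simp add: power2_eq_square algebra_simps)
    then show "AE x in lebesgue. norm (indicator S x *\<^sub>R (norm (f x + g x))\<^sup>2)
      \<le> norm (2 * (indicator S x *\<^sub>R (norm (f x))\<^sup>2) + 2 * (indicator S x *\<^sub>R (norm (g x))\<^sup>2))"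
      by (auto simp: indicator_def)
  qed
  with m show ?thesis by (simp add: square_integrable_def set_borel_measurable_def set_integrable_def)
qed

lemma square_integrable_zero:
  fixes f :: "'a::euclidean_space \<Rightarrow> 'b::euclidean_space"
  assumes "\<And>x. x \<in> S \<Longrightarrow> f x = 0"
  shows "square_integrable S f"
proof -
  have "(\<lambda>x. indicator S x *\<^sub>R f x) = (\<lambda>x. 0)" "(\<lambda>x. indicator S x *\<^sub>R (norm (f x))\<^sup>2) = (\<lambda>x. 0)"
    using assms by (auto simp: indicator_def fun_eq_iff)
  then show ?thesis by (simp add: square_integrable_def set_borel_measurable_def set_integrable_def)
qed

lemma square_integrable_indicator:
  fixes f :: "'a::euclidean_space \<Rightarrow> real"
  assumes "square_integrable S f"
  shows "square_integrable UNIV (\<lambda>x. indicator S x * f x)"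
proof -
  have "(\<lambda>x. indicator UNIV x *\<^sub>R (indicator S x * f x)) = (\<lambda>x. indicator S x *\<^sub>R f x)"
    "(\<lambda>x. indicator UNIV x *\<^sub>R (norm (indicator S x * f x))\<^sup>2) = (\<lambda>x. indicator S x *\<^sub>R (norm (f x))\<^sup>2)"
    by (auto simp: indicator_def fun_eq_iff)
  with assms show ?thesis
    unfolding square_integrable_def set_borel_measurable_def set_integrable_def by simp
qed

lemma square_integrable_sum:
  fixes f :: "'i \<Rightarrow> 'a::euclidean_space \<Rightarrow> real"
  assumes "\<And>i. i \<in> I \<Longrightarrow> square_integrable S (f i)"
  shows "square_integrable S (\<lambda>x. \<Sum>i\<in>I. f i x)"
  using assms
  by (induction I rule: infinite_finite_induct) (auto intro: square_integrable_add square_integrable_zero)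

lemma smooth_borel_measurable: "smooth f \<Longrightarrow> f \<in> borel_measurable lebesgue"
  by (intro measurable_completion)
    (simp add: borel_measurable_continuous_onI smooth_continuous_on)

text \<open>The elementary bound \<open>\<bar>d\<bar> \<le> 1 + d\<^sup>2\<close> on the compact
  support takes the place of Cauchy-Schwarz.\<close>

lemma square_integrable_times_test_function:
  fixes d :: "'a::euclidean_space \<Rightarrow> real"
  assumes d: "square_integrable S d" and \<phi>: "test_function U \<phi>"
  shows "set_integrable lebesgue S (\<lambda>x. d x * \<phi> x)"
proof -
  obtain C where C: "compact C" "\<And>x. x \<notin> C \<Longrightarrow> \<phi> x = 0"
    using \<phi> by (auto simp: test_function_def)
  obtain b where b: "b > 0" "\<And>x. \<bar>\<phi> x\<bar> \<le> b" by (rule test_function_bounded[OF \<phi>]) (rule that)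
  have "integrable lebesgue (\<lambda>x. b * (indicator C x + indicator S x *\<^sub>R (norm (d x))\<^sup>2))"
  proof -
    have "integrable lebesgue (indicator C :: 'a \<Rightarrow> real)"
      using lmeasurable_compact[OF C(1)] by (intro integrable_real_indicator) (auto simp: fmeasurable_def)
    then show ?thesis
      using d unfolding square_integrable_def set_integrable_def
      by (intro Bochner_Integration.integrable_mult_right Bochner_Integration.integrable_add) auto
  qed
  then have "integrable lebesgue (\<lambda>x. (indicator S x *\<^sub>R d x) * \<phi> x)"
  proof (rule Bochner_Integration.integrable_bound)
    show "(\<lambda>x. (indicator S x *\<^sub>R d x) * \<phi> x) \<in> borel_measurable lebesgue"
      using d \<phi> unfolding square_integrable_def set_borel_measurable_def
      by (intro borel_measurable_times[OF _ smooth_borel_measurable]) (auto simp: test_function_def)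
    show "AE x in lebesgue. norm ((indicator S x *\<^sub>R d x) * \<phi> x)
        \<le> norm (b * (indicator C x + indicator S x *\<^sub>R (norm (d x))\<^sup>2))"
    proof (intro always_eventually allI)
      fix x
      have 1: "\<bar>d x\<bar> \<le> 1 + (d x)\<^sup>2"
        using zero_le_power2[of "\<bar>d x\<bar> - 1"] by (simp add: power2_eq_square algebra_simps)
      show "norm ((indicator S x *\<^sub>R d x) * \<phi> x)
        \<le> norm (b * (indicator C x + indicator S x *\<^sub>R (norm (d x))\<^sup>2))"
      proof (cases "x \<in> S \<and> x \<in> C")
        case True
        have "\<bar>d x\<bar> * \<bar>\<phi> x\<bar> \<le> (1 + (d x)\<^sup>2) * b"
          using 1 b by (intro mult_mono) auto
        then show ?thesis using True b(1) by (simp add: abs_mult mult.commute)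
      next
        case False
        then show ?thesis using C(2) by (auto simp: indicator_def)
      qed
    qed
  qed
  then show ?thesis by (simp add: set_integrable_def mult.assoc)
qed

lemma test_function_derivative_outside:
  assumes \<phi>: "test_function U \<phi>" and x: "x \<notin> U"
  shows "frechet_derivative \<phi> (at x) = (\<lambda>h. 0)"
proof -
  obtain C where C: "compact C" "C \<subseteq> U" "\<And>x. x \<notin> C \<Longrightarrow> \<phi> x = 0"
    using \<phi> by (auto simp: test_function_def)
  have "((\<lambda>x. 0) has_derivative (\<lambda>h. 0)) (at x)" by simp
  then have "(\<phi> has_derivative (\<lambda>h. 0)) (at x)"
    by (rule has_derivative_transform_within_open[OF _ open_Compl[OF compact_imp_closed[OF C(1)]]])
      (use C x in auto)
  then show ?thesis by (rule frechet_derivative_at[symmetric])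
qed

lemma integral_smooth_approx:
  fixes g :: "'a::euclidean_space \<Rightarrow> real"
  assumes g: "integrable lebesgue g" and U: "open U"
    and \<eta>: "\<And>i. smooth (\<eta> i)" "\<And>i x. 0 \<le> \<eta> i x" "\<And>i x. \<eta> i x \<le> 1" "\<And>x. (\<lambda>i. \<eta> i x) \<longlonglongrightarrow> indicator U x"
  shows "(\<lambda>i. LINT x|lebesgue. g x * \<eta> i x) \<longlonglongrightarrow> (LINT x|lebesgue. g x * indicator U x)"
proof (rule integral_dominated_convergence[where w = "\<lambda>x. \<bar>g x\<bar>"])
  show "(\<lambda>x. g x * indicator U x) \<in> borel_measurable lebesgue"
    using g U by (intro borel_measurable_times borel_measurable_indicator) auto
  show "(\<lambda>x. g x * \<eta> i x) \<in> borel_measurable lebesgue" for i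
    by (rule borel_measurable_times[OF borel_measurable_integrable[OF g] smooth_borel_measurable[OF \<eta>(1)]])
  show "AE x in lebesgue. (\<lambda>i. g x * \<eta> i x) \<longlonglongrightarrow> g x * indicator U x"
    by (intro always_eventually allI tendsto_mult tendsto_const \<eta>)
  show "AE x in lebesgue. norm (g x * \<eta> i x) \<le> \<bar>g x\<bar>" for i
    using \<eta>(2,3) by (intro always_eventually) (simp add: abs_mult mult_left_le)
qed (use g in auto)

lemma column_mesh_vertical_cell:
  assumes "column_mesh M" "K \<in> cells M"
  shows "\<exists>p q r m. vertical_cell (shape M) (cell_map M K) p q r m"
proof -
  have "column_cell_map (shape M) (cell_map M K)" using assms by (simp add: column_mesh_def)
  from column_cell_map_form[OF this] show ?thesis unfolding vertical_cell_def by blast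
qed

lemma finite_cells: "column_mesh M \<Longrightarrow> finite (cells M)"
  unfolding cells_def column_mesh_def by (intro finite_SigmaI) auto

context mesh_column
begin

text \<open>The divergence, inside the cell, of the Piola image of \<open>f\<close> times
  \<open>up\<close>.\<close>

definition cell_div :: "nat \<Rightarrow> (real^3 \<Rightarrow> real) \<Rightarrow> real^3 \<Rightarrow> real" where
  "cell_div k f x = (let y = ref_point M (c, k) x in d3 f y / (vdet k y))"

lemma continuous_on_ref_point:
  assumes "k < n" shows "continuous_on (C k) (ref_point M (c, k))"
  unfolding cell_eq
  by (rule continuous_on_inv[OF vertical_cell.F_continuous[OF cell[OF assms]] compact_ref_cell])
    (use ref_point_F[OF assms] in auto)

lemma ref_point_in: "k < n \<Longrightarrow> x \<in> C k \<Longrightarrow> ref_point M (c, k) x \<in> R"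
  using ref_point_F by (auto simp: cell_eq)

lemma continuous_on_pullback:
  assumes "k < n" "continuous_on R h"
  shows "continuous_on (C k) (\<lambda>x. h (ref_point M (c, k) x))"
  by (rule continuous_on_compose2[OF assms(2) continuous_on_ref_point[OF assms(1)]])
    (use ref_point_in[OF assms(1)] in auto)

lemma compact_cell: "k < n \<Longrightarrow> compact (C k)"
  unfolding cell_eq by (rule vertical_cell.compact_cell[OF cell])

lemma cell_div_continuous_on:
  assumes "k < n" "f \<in> tens" shows "continuous_on (C k) (cell_div k f)"
  unfolding cell_div_def Let_def
  by (rule continuous_on_pullback[OF assms(1), of "\<lambda>y. d3 f y / (vdet k y)"])
     (use denominator_nz[OF assms(1)] in \<open>auto intro!: continuous_on_divide continuous_on_mult
        continuous_intros tens_d3_continuous_on assms(2)\<close>)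

lemma cell_div_integrable:
  assumes k: "k < n" and f: "f \<in> tens" and \<phi>: "smooth \<phi>"
  shows "set_integrable lebesgue (C k) (\<lambda>x. cell_div k f x * \<phi> x)"
    and "(LINT x:C k|lebesgue. cell_div k f x * \<phi> x)
      = sgn (D 0) * ref_int S (\<lambda>y. d3 f y * \<phi> (F k y))"
proof -
  let ?h = "\<lambda>y. d3 f y / (vdet k y) * \<phi> (F k y)"
  have "continuous_on R (\<lambda>y. \<phi> (F k y))"
    by (rule continuous_on_compose2[OF smooth_continuous_on[OF \<phi>, of UNIV] vertical_cell.F_continuous[OF cell[OF k]]]) auto
  then have c: "continuous_on R ?h"
    using denominator_nz[OF k] by (intro continuous_on_mult continuous_on_divide continuous_intros
      tens_d3_continuous_on f) auto
  have h: "cell_div k f (F k y) * \<phi> (F k y) = ?h y" if "y \<in> interior R" for y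
    using that interior_subset[of R] ref_point_F[OF k, of y] by (auto simp: cell_div_def)
  show "set_integrable lebesgue (C k) (\<lambda>x. cell_div k f x * \<phi> x)"
    unfolding cell_eq by (rule vertical_cell.cell_integral(1)[OF cell[OF k] c h])
  have "(LINT x:C k|lebesgue. cell_div k f x * \<phi> x)
      = ref_int S (\<lambda>y. \<bar>vdet k y\<bar> * ?h y)"
    unfolding cell_eq by (rule vertical_cell.cell_integral(2)[OF cell[OF k] c h])
  also have "\<dots> = ref_int S (\<lambda>y. sgn (D 0) * (d3 f y * \<phi> (F k y)))"
    by (intro ref_int_cong) (use abs_det[OF k] denominator_nz[OF k] in \<open>simp add: field_simps\<close>)
  finally show "(LINT x:C k|lebesgue. cell_div k f x * \<phi> x)
      = sgn (D 0) * ref_int S (\<lambda>y. d3 f y * \<phi> (F k y))" by (simp only: ref_int_cmult)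
qed

text \<open>The upward flux of \<open>\<phi>\<close> times the velocity through the face at
  reference height \<open>t\<close>. The Piola transform preserves normal fluxes, so apart from the
  orientation sign no area factor occurs.\<close>

definition face_flux :: "(real^3 \<Rightarrow> real) \<Rightarrow> nat \<Rightarrow> (real^3 \<Rightarrow> real) \<Rightarrow> real \<Rightarrow> real" where
  "face_flux \<phi> k f t = sgn (D 0) * ref_int S (\<lambda>y. \<phi> (F k (pt (horiz y) t)) * f (pt (horiz y) t))"

text \<open>The divergence theorem in one cell, from the product rule for
  \<open>\<phi> (F k y) * f y\<close> along vertical lines. A vertical field has no flux through the
  side walls, so only the two faces contribute.\<close>

lemma cell_flux:
  assumes k: "k < n" and f: "f \<in> tens" and \<phi>: "smooth \<phi>"
  shows "(LINT x:C k|lebesgue. frechet_derivative \<phi> (at x) (piola M (c, k) (\<lambda>y. f y *\<^sub>R up) x))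
    = face_flux \<phi> k f 1 - face_flux \<phi> k f 0
      - (LINT x:C k|lebesgue. cell_div k f x * \<phi> x)"
proof -
  interpret K: vertical_cell S "F k" p q "r k" "m k" by (rule cell[OF k])
  let ?\<phi>' = "\<lambda>x. frechet_derivative \<phi> (at x) up"
  have d\<phi>: "(\<phi> has_derivative frechet_derivative \<phi> (at x)) (at x)" for x
    using smooth_differentiable[OF \<phi>] by (simp add: frechet_derivative_works)
  have lin: "frechet_derivative \<phi> (at x) (a *\<^sub>R up) = a * ?\<phi>' x" for x a
    using linear_scale[OF has_derivative_linear[OF d\<phi>]] by simp
  have "smooth ?\<phi>'" by (rule smooth_partial[OF \<phi>]) (simp add: axis_in_Basis_iff)
  then have c\<phi>': "continuous_on R (\<lambda>y. ?\<phi>' (F k y))"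
    by (intro continuous_on_compose2[OF smooth_continuous_on[of _ UNIV] K.F_continuous]) auto
  have c\<phi>: "continuous_on R (\<lambda>y. \<phi> (F k y))"
    by (intro continuous_on_compose2[OF smooth_continuous_on[OF \<phi>, of UNIV] K.F_continuous]) auto
  let ?h = "\<lambda>y. f y / D (horiz y) * ?\<phi>' (F k y)"
  have "continuous_on R ?h"
    using D_nz by (intro continuous_on_mult continuous_on_divide continuous_intros c\<phi>' tens_continuous_on f) auto
  moreover have "frechet_derivative \<phi> (at (F k y)) (piola M (c, k) (\<lambda>y. f y *\<^sub>R up) (F k y)) = ?h y"
    if "y \<in> interior R" for y
    using that interior_subset[of R] by (auto simp: piola_F[OF k] lin)
  ultimately have "(LINT x:C k|lebesgue. frechet_derivative \<phi> (at x) (piola M (c, k) (\<lambda>y. f y *\<^sub>R up) x))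
     = ref_int S (\<lambda>y. \<bar>vdet k y\<bar> * ?h y)"
    unfolding cell_eq by (rule K.cell_integral(2))
  also have "\<dots> = ref_int S (\<lambda>y. sgn (D 0) * (bil (m k) (horiz y) * ?\<phi>' (F k y) * f y))"
    by (intro ref_int_cong) (use abs_det[OF k] D_nz in \<open>simp add: field_simps\<close>)
  also have "\<dots> = sgn (D 0) * ref_int S (\<lambda>y. bil (m k) (horiz y) * ?\<phi>' (F k y) * f y)"
    by (simp only: ref_int_cmult)
  finally have 1: "(LINT x:C k|lebesgue. frechet_derivative \<phi> (at x) (piola M (c, k) (\<lambda>y. f y *\<^sub>R up) x))
     = sgn (D 0) * ref_int S (\<lambda>y. bil (m k) (horiz y) * ?\<phi>' (F k y) * f y)" .
  have c1: "continuous_on R (\<lambda>y. bil (m k) (horiz y) * ?\<phi>' (F k y) * f y)"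
    by (intro continuous_intros c\<phi>' tens_continuous_on f)
  have c2: "continuous_on R (\<lambda>y. d3 f y * \<phi> (F k y))"
    by (intro continuous_intros c\<phi> tens_d3_continuous_on f)
  have "ref_int S (\<lambda>y. bil (m k) (horiz y) * ?\<phi>' (F k y) * f y + d3 f y * \<phi> (F k y))
     = ref_int S (\<lambda>y. \<phi> (F k (pt (horiz y) 1)) * f (pt (horiz y) 1))
       - ref_int S (\<lambda>y. \<phi> (F k (pt (horiz y) 0)) * f (pt (horiz y) 0))"
  proof (rule ref_int_vertical_derivative)
    fix u t
    have "((\<lambda>s. pt w (a + s * b)) has_derivative (\<lambda>h. h *\<^sub>R (b *\<^sub>R up))) (at t)" for w a b
      unfolding pt_alt by (auto intro!: derivative_eq_intros simp: algebra_simps)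
    then have "((\<lambda>s. F k (pt u s)) has_derivative (\<lambda>h. h *\<^sub>R (bil (m k) u *\<^sub>R up))) (at t)"
      by (simp only: K.F_pt)
    from has_derivative_compose[OF this d\<phi>]
    have "((\<lambda>s. \<phi> (F k (pt u s))) has_derivative (\<lambda>h. bil (m k) u * ?\<phi>' (F k (pt u t)) * h)) (at t)"
      by (simp add: lin mult_ac)
    then have "((\<lambda>s. \<phi> (F k (pt u s))) has_real_derivative bil (m k) u * ?\<phi>' (F k (pt u t))) (at t)"
      by (simp add: has_field_derivative_def)
    from DERIV_mult[OF this DERIV_d3[OF tens_differentiable[OF f]]]
    show "((\<lambda>s. \<phi> (F k (pt u s)) * f (pt u s)) has_real_derivative
      bil (m k) (horiz (pt u t)) * ?\<phi>' (F k (pt u t)) * f (pt u t) + d3 f (pt u t) * \<phi> (F k (pt u t))) (at t)"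
      by simp
  qed (intro continuous_intros c\<phi> c\<phi>' tens_continuous_on tens_d3_continuous_on f)+
  then have 2: "ref_int S (\<lambda>y. bil (m k) (horiz y) * ?\<phi>' (F k y) * f y)
     = ref_int S (\<lambda>y. \<phi> (F k (pt (horiz y) 1)) * f (pt (horiz y) 1))
       - ref_int S (\<lambda>y. \<phi> (F k (pt (horiz y) 0)) * f (pt (horiz y) 0))
       - ref_int S (\<lambda>y. d3 f y * \<phi> (F k y))"
    unfolding ref_int_add[OF c1 c2] by linarith
  show ?thesis
    unfolding 1 2 cell_div_integrable(2)[OF assms] face_flux_def by (simp only: right_diff_distrib)
qed

lemma sum_cells_column:
  assumes "\<And>K. K \<in> cells M \<Longrightarrow> fst K \<noteq> c \<Longrightarrow> h K = (0::real)"
  shows "(\<Sum>K\<in>cells M. h K) = (\<Sum>k<n. h (c, k))"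
proof -
  have "(\<Sum>K\<in>cells M. h K) = (\<Sum>K\<in>(\<lambda>k. (c, k)) ` {..<n}. h K)"
    by (rule sum.mono_neutral_right[OF finite_cells[OF mesh]])
      (use assms in \<open>force simp: cells_def c\<close>)+
  also have "\<dots> = (\<Sum>k<n. h (c, k))"
    by (simp add: sum.reindex inj_on_def)
  finally show ?thesis .
qed

lemma negligible_cell_diff: "k < n \<Longrightarrow> negligible (C k - interior (C k))"
  unfolding cell_eq
  by (rule negligible_subset[OF vertical_cell.negligible_cell_diff[OF cell]])
    (use vertical_cell.F_interior_subset[OF cell] in auto)

lemma AE_cell_interior:
  assumes "k < n"
  shows "AE x in lebesgue. x \<in> C k \<longrightarrow> x \<in> interior (C k)"
proof -
  have "C k - interior (C k) \<in> null_sets lebesgue"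
    using negligible_cell_diff[OF assms] by (simp add: negligible_iff_null_sets)
  from AE_not_in[OF this] show ?thesis by eventually_elim blast
qed

lemma interior_cell_subset_domain: "k < n \<Longrightarrow> interior (C k) \<subseteq> domain M"
  unfolding domain_def using in_cells[of k] by (intro interior_mono) blast

text \<open>The weak divergence is the piecewise one: when \<open>cell_flux\<close> is summed over
  the column, the fluxes cancel at each facet and vanish at both ends. Extension by zero to the
  other columns is harmless, since a vertical field is tangential to the side walls.\<close>

lemma ring_space_Hdiv:
  assumes U: "U \<in> ring_space"
  shows "in_Hdiv M (\<lambda>K\<in>cells M. piola M K (\<lambda>y. (if fst K = c then U (snd K) y else 0) *\<^sub>R up))"
    (is "in_Hdiv M ?w")
proof -
  have zero: "?w K x = 0" if "K \<in> cells M" "fst K \<noteq> c" "x \<in> cell M K" for K x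
    using that by (simp add: piola_def)
  have w: "?w (c, k) = piola M (c, k) (\<lambda>y. U k y *\<^sub>R up)" if "k < n" for k
    using that by (simp add: in_cells)
  have sq: "square_integrable (cell M K) (?w K)" if K: "K \<in> cells M" for K
  proof (cases "fst K = c")
    case False
    then show ?thesis using zero K by (intro square_integrable_zero) auto
  next
    case True
    then obtain k where k: "K = (c, k)" "k < n" using K by (cases K) (auto simp: cells_def)
    have "continuous_on (C k) (\<lambda>x. (U k (ref_point M (c, k) x) / D (horiz (ref_point M (c, k) x))) *\<^sub>R up)"
      by (intro continuous_on_scaleR continuous_on_const
          continuous_on_pullback[OF k(2), of "\<lambda>y. U k y / D (horiz y)"])
        (use D_nz in \<open>auto intro!: continuous_on_divide continuous_intros tens_continuous_on[OF ring_space_tens[OF U k(2)]]\<close>)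
    then have "continuous_on (C k) (?w (c, k))"
      by (rule continuous_on_eq)
        (use k in \<open>auto simp: in_cells[OF k(2)] cell_eq piola_F[OF k(2)] ref_point_F[OF k(2)]\<close>)
    then show ?thesis
      unfolding k(1) by (rule continuous_on_compact_square_integrable[OF compact_cell[OF k(2)]])
  qed
  \<comment> \<open>A sum over the cells, so that it can be integrated term by term, whatever its
    values where closed cells meet.\<close>
  define d where "d x = (\<Sum>k<n. indicator (C k) x * cell_div k (U k) x)" for x
  have d_sq: "square_integrable (domain M) d"
    unfolding d_def
  proof (rule square_integrable_sum)
    fix k assume "k \<in> {..<n}"
    then have k: "k < n" by simp
    have "square_integrable (C k) (cell_div k (U k))"
      by (intro continuous_on_compact_square_integrable compact_cell k cell_div_continuous_on ring_space_tens U)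
    then have "square_integrable UNIV (\<lambda>x. indicator (C k) x * cell_div k (U k) x)"
      by (rule square_integrable_indicator)
    then show "square_integrable (domain M) (\<lambda>x. indicator (C k) x * cell_div k (U k) x)"
      by (rule square_integrable_subset) (auto simp: domain_def)
  qed
  have "(\<Sum>K\<in>cells M. LINT x:cell M K|lebesgue. frechet_derivative \<phi> (at x) (?w K x))
             = - (LINT x:domain M|lebesgue. d x * \<phi> x)" if \<phi>: "test_function (domain M) \<phi>" for \<phi>
  proof -
    have sm: "smooth \<phi>" using \<phi> by (rule test_function_smooth)
    let ?I = "\<lambda>k. LINT x:C k|lebesgue. cell_div k (U k) x * \<phi> x"
    have "(\<Sum>K\<in>cells M. LINT x:cell M K|lebesgue. frechet_derivative \<phi> (at x) (?w K x))
       = (\<Sum>k<n. LINT x:C k|lebesgue. frechet_derivative \<phi> (at x) (?w (c, k) x))"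
    proof (rule sum_cells_column)
      fix K assume K: "K \<in> cells M" "fst K \<noteq> c"
      have z: "frechet_derivative \<phi> (at x) 0 = 0" for x
        using linear_0[OF linear_frechet_derivative[OF smooth_differentiable[OF sm]]] .
      have "(\<lambda>x. indicator (cell M K) x *\<^sub>R frechet_derivative \<phi> (at x) (?w K x)) = (\<lambda>x. 0)"
        using zero[OF K] z by (auto simp: fun_eq_iff indicator_def)
      then show "(LINT x:cell M K|lebesgue. frechet_derivative \<phi> (at x) (?w K x)) = 0"
        unfolding set_lebesgue_integral_def by simp
    qed
    also have "\<dots> = (\<Sum>k<n. face_flux \<phi> k (U k) 1 - face_flux \<phi> k (U k) 0 - ?I k)"
      by (intro sum.cong refl) (simp add: in_cells cell_flux sm ring_space_tens[OF U])
    also have "\<dots> = (\<Sum>k<n. face_flux \<phi> k (U k) 1) - (\<Sum>k<n. face_flux \<phi> k (U k) 0) - (\<Sum>k<n. ?I k)"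
      by (simp add: sum_subtractf)
    also have "(\<Sum>k<n. face_flux \<phi> k (U k) 1) = (\<Sum>k<n. face_flux \<phi> k (U k) 0)"
    proof -
      obtain N where N: "n = Suc N" using n_pos gr0_implies_Suc by blast
      have top: "face_flux \<phi> N (U N) 1 = 0" and bot: "face_flux \<phi> 0 (U 0) 0 = 0"
        using U N unfolding face_flux_def by (simp_all add: ref_int_zero ring_space_def)
      have "face_flux \<phi> k (U k) 1 = face_flux \<phi> (Suc k) (U (Suc k)) 0" if "k < N" for k
        unfolding face_flux_def using U N that
        by (intro arg_cong[where f = "\<lambda>x. sgn (D 0) * x"] ref_int_cong) (simp add: ring_space_def F_pt_Suc)
      then have "(\<Sum>k<N. face_flux \<phi> k (U k) 1) = (\<Sum>k<N. face_flux \<phi> (Suc k) (U (Suc k)) 0)" by simp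
      then show ?thesis
        unfolding N sum.lessThan_Suc[of _ N] sum.lessThan_Suc_shift[of "\<lambda>k. face_flux \<phi> k (U k) 0"] top bot by simp
    qed
    \<comment> \<open>The domain contains the interior of each cell, hence almost all of the
      cell.\<close>
    also have "(\<Sum>k<n. ?I k) = (LINT x:domain M|lebesgue. d x * \<phi> x)"
    proof -
      let ?g = "\<lambda>k x. indicator (C k) x *\<^sub>R (cell_div k (U k) x * \<phi> x)"
      have int: "integrable lebesgue (?g k)" if "k < n" for k
        using cell_div_integrable(1)[OF that ring_space_tens[OF U that] sm] by (simp add: set_integrable_def)
      have dm: "domain M \<in> sets lebesgue" by (simp add: domain_def)
      have intd: "integrable lebesgue (\<lambda>x. indicator (domain M) x *\<^sub>R ?g k x)" if "k < n" for k
        by (rule integrable_mult_indicator[OF dm int[OF that]])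
      have "(LINT x:domain M|lebesgue. d x * \<phi> x) = (LINT x|lebesgue. (\<Sum>k<n. indicator (domain M) x *\<^sub>R ?g k x))"
        unfolding set_lebesgue_integral_def d_def
        unfolding real_scaleR_def sum_distrib_left sum_distrib_right
        by (intro Bochner_Integration.integral_cong refl sum.cong) (simp only: mult_ac)
      also have "\<dots> = (\<Sum>k<n. LINT x|lebesgue. indicator (domain M) x *\<^sub>R ?g k x)"
        by (rule Bochner_Integration.integral_sum) (use intd in auto)
      also have "\<dots> = (\<Sum>k<n. ?I k)"
      proof (intro sum.cong refl)
        fix k assume "k \<in> {..<n}"
        then have k: "k < n" by simp
        show "(LINT x|lebesgue. indicator (domain M) x *\<^sub>R ?g k x) = ?I k"
          unfolding set_lebesgue_integral_def
        proof (rule integral_cong_AE)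
          show "AE x in lebesgue. indicator (domain M) x *\<^sub>R ?g k x = ?g k x"
            using AE_cell_interior[OF k]
            by eventually_elim (use interior_cell_subset_domain[OF k] in \<open>auto simp: indicator_def\<close>)
        qed (use int[OF k] intd[OF k] in auto)
      qed
      finally show ?thesis by simp
    qed
    finally show ?thesis by simp
  qed
  with d_sq sq show ?thesis unfolding in_Hdiv_def by blast
qed

lemma ref_V2v_subset: "ref_V2v E \<subseteq> ref_V2 E"
proof
  fix v assume v: "v \<in> ref_V2v E"
  have "(\<lambda>y. horiz_embed 0) \<in> ref_V2h E"
    unfolding ref_V2h_def by (intro CollectI exI[of _ "\<lambda>y. 0"] conjI refl tensor_zero)
  moreover have "horiz_embed 0 = 0" by (intro vec3_eqI) (simp_all add: horiz_embed_def)
  ultimately show "v \<in> ref_V2 E"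
    unfolding ref_V2_def using v
    by (intro CollectI, rule_tac exI[of _ v], rule_tac exI[of _ "\<lambda>y. 0"]) simp
qed

lemma vel_in_V2v_col:
  assumes U: "U \<in> ring_space"
  shows "vel U \<in> V2v_col E M c"
proof -
  let ?f = "\<lambda>K y. if fst K = c then U (snd K) y else 0"
  let ?w = "\<lambda>K\<in>cells M. piola M K (\<lambda>y. ?f K y *\<^sub>R up)"
  have f: "?f K \<in> tens" if "K \<in> cells M" for K
    using that U tensor_zero[of "base_DG E"] by (cases "fst K = c") (auto simp: cells_def ring_space_def)
  have v: "?w K \<in> cell_V2v E M K" if "K \<in> cells M" for K
  proof -
    have "(\<lambda>y. ?f K y *\<^sub>R up) \<in> ref_V2v E" using f[OF that] unfolding ref_V2v_def by (intro CollectI exI[of _ "?f K"] conjI refl)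
    then show ?thesis using that by (simp add: cell_V2v_def)
  qed
  then have "?w K \<in> cell_V2 E M K" if "K \<in> cells M" for K
    using that ref_V2v_subset unfolding cell_V2_def cell_V2v_def by blast
  then have V2: "?w \<in> V2 E M"
    unfolding V2_def using ring_space_Hdiv[OF U] by auto
  have "?w (c', j) (cell_map M (c', j) y) = 0"
    if j: "(c', j) \<in> cells M" and y: "horiz y \<in> B" "y $ 3 = t"
      and ends: "j = 0 \<and> t = 0 \<or> j = layers M c' - 1 \<and> t = 1" for c' j y t
  proof -
    have yR: "y \<in> R" and y_eq: "y = pt (horiz y) t" using y ends pt_horiz[of y] by (auto simp: ref_cell_iff)
    show ?thesis
    proof (cases "c' = c")
      case True
      have "U j (pt (horiz y) t) = 0" using U y ends True by (auto simp: ring_space_def)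
      then have "U j y = 0" by (subst y_eq)
      then show ?thesis using True j piola_F[OF _ yR, of j "U j"] by (simp add: cells_def)
    next
      case False
      then show ?thesis using j yR by (simp add: piola_def cell_def)
    qed
  qed
  moreover have "(c', 0) \<in> cells M" "(c', layers M c' - 1) \<in> cells M" if "c' \<in> columns M" for c'
    using mesh that unfolding column_mesh_def cells_def by (auto simp: Suc_le_eq)
  ultimately have "rigid_lid M ?w" unfolding rigid_lid_def by auto
  then have "?w \<in> V2v E M" using V2 v unfolding V2v_def by blast
  moreover have "vel U = column_restrict M c ?w"
    unfolding vel_def column_restrict_def by (intro restrict_ext) (simp add: in_cells)
  ultimately show ?thesis unfolding V2v_col_def by blast
qed

text \<open>Two stacked cells form one larger vertical cell; its interior is the neighbourhood of the
  facet on which the test functions live.\<close>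

definition pair_map :: "nat \<Rightarrow> real^3 \<Rightarrow> real^3" where
  "pair_map k y = pt (G (horiz y)) (bil (r k) (horiz y) + y $ 3 * bil (m k + m (Suc k)) (horiz y))"

definition pair_nhd :: "nat \<Rightarrow> (real^3) set" where
  "pair_nhd k = pair_map k ` interior R"

section \<open>Geometry around an interior facet\<close>

lemma pair_cell:
  assumes "Suc k < n" shows "vertical_cell S (pair_map k) p q (r k) (m k + m (Suc k))"
  using assms by unfold_locales (auto simp: pair_map_def bil_add D_nz intro!: add_pos_pos m_pos)

lemma open_pair_nhd: "Suc k < n \<Longrightarrow> open (pair_nhd k)"
  unfolding pair_nhd_def by (rule vertical_cell.open_F_interior[OF pair_cell])

lemma pair_nhd_iff:
  assumes k: "Suc k < n" and u: "u \<in> B"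
  shows "pt (G u) z \<in> pair_nhd k \<longleftrightarrow>
    u \<in> interior B \<and> bil (r k) u < z \<and> z < bil (r k) u + bil (m k) u + bil (m (Suc k)) u"
proof
  assume "pt (G u) z \<in> pair_nhd k"
  then obtain y where y: "y \<in> interior R" "pt (G u) z = pair_map k y"
    unfolding pair_nhd_def by blast
  then have yB: "horiz y \<in> interior B" "horiz y \<in> B" "0 < y $ 3" "y $ 3 < 1"
    using interior_subset by (auto simp: interior_ref_cell)
  have "G u = G (horiz y)"
    and z: "z = bil (r k) (horiz y) + y $ 3 * bil (m k + m (Suc k)) (horiz y)"
    using y(2) by (simp_all add: pair_map_def)
  then have u_eq: "u = horiz y"
    using vertical_cell.G_inj[OF cell[OF n_pos]] u yB(2) by (auto dest: inj_onD)
  have "0 < bil (m k + m (Suc k)) u"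
    using k u by (auto simp: bil_add intro!: add_pos_pos m_pos)
  then have "0 < y $ 3 * bil (m k + m (Suc k)) u" "y $ 3 * bil (m k + m (Suc k)) u < bil (m k + m (Suc k)) u"
    using yB by simp_all
  then show "u \<in> interior B \<and> bil (r k) u < z \<and> z < bil (r k) u + bil (m k) u + bil (m (Suc k)) u"
    using yB(1) unfolding u_eq[symmetric] z by (simp add: u_eq[symmetric] bil_add)
next
  assume a: "u \<in> interior B \<and> bil (r k) u < z \<and> z < bil (r k) u + bil (m k) u + bil (m (Suc k)) u"
  have p: "0 < bil (m k + m (Suc k)) u"
    using k u by (auto simp: bil_add intro!: add_pos_pos m_pos)
  let ?t = "(z - bil (r k) u) / bil (m k + m (Suc k)) u"
  have "pt u ?t \<in> interior R" using a p by (auto simp: interior_ref_cell bil_add)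
  moreover have "pair_map k (pt u ?t) = pt (G u) z" using p by (simp add: pair_map_def)
  ultimately show "pt (G u) z \<in> pair_nhd k" unfolding pair_nhd_def by force
qed

lemma in_cell_iff:
  assumes k: "k < n" and u: "u \<in> B"
  shows "pt (G u) z \<in> C k \<longleftrightarrow> bil (r k) u \<le> z \<and> z \<le> bil (r k) u + bil (m k) u"
proof
  interpret K: vertical_cell S "F k" p q "r k" "m k" by (rule cell[OF k])
  {
    assume "pt (G u) z \<in> C k"
    then obtain y where y: "y \<in> R" "pt (G u) z = F k y" unfolding cell_eq by blast
    then have "G u = G (horiz y)" and z: "z = bil (r k) (horiz y) + y $ 3 * bil (m k) (horiz y)"
      by (simp_all add: K.F)
    then have "u = horiz y" using K.G_inj u y(1) by (auto dest: inj_onD)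
    then show "bil (r k) u \<le> z \<and> z \<le> bil (r k) u + bil (m k) u"
      using z y(1) K.m_pos[OF u] by (auto simp: ref_cell_iff intro: mult_left_le_one_le)
  next
    assume a: "bil (r k) u \<le> z \<and> z \<le> bil (r k) u + bil (m k) u"
    let ?t = "(z - bil (r k) u) / bil (m k) u"
    have "pt u ?t \<in> R" using a K.m_pos[OF u] u by (auto simp: pt_in_ref_cell divide_le_eq)
    moreover have "F k (pt u ?t) = pt (G u) z" using K.m_pos[OF u] by (simp add: K.F)
    ultimately show "pt (G u) z \<in> C k" unfolding cell_eq by force
  }
qed

lemma pair_nhd_horiz:
  assumes "Suc k < n" "x \<in> pair_nhd k"
  obtains u where "u \<in> interior B" "u \<in> B" "x = pt (G u) (x $ 3)"
proof -
  obtain y where y: "y \<in> interior R" "x = pair_map k y" using assms(2) unfolding pair_nhd_def by blast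
  then have "horiz y \<in> interior B" by (simp add: interior_ref_cell)
  moreover have "x = pt (G (horiz y)) (x $ 3)" unfolding y(2) pair_map_def by simp
  ultimately show ?thesis using that interior_subset by blast
qed

lemma pair_nhd_subset:
  assumes k: "Suc k < n"
  shows "pair_nhd k \<subseteq> C k \<union> C (Suc k)"
proof
  fix x assume x: "x \<in> pair_nhd k"
  obtain u where u: "u \<in> B" "x = pt (G u) (x $ 3)" by (rule pair_nhd_horiz[OF k x]) (rule that)
  have "bil (r k) u < x $ 3 \<and> x $ 3 < bil (r k) u + bil (m k) u + bil (m (Suc k)) u"
    using pair_nhd_iff[OF k u(1), of "x $ 3"] x u(2) by simp
  then have "pt (G u) (x $ 3) \<in> C k \<union> C (Suc k)"
    using in_cell_iff[of k u "x $ 3"] in_cell_iff[of "Suc k" u "x $ 3"] stack[OF k u(1)] k u(1) by auto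
  then show "x \<in> C k \<union> C (Suc k)" using u(2) by simp
qed

lemma pair_nhd_domain: "Suc k < n \<Longrightarrow> pair_nhd k \<subseteq> domain M"
  unfolding domain_def
  using pair_nhd_subset[of k] in_cells[of k] in_cells[of "Suc k"]
  by (intro interior_maximal open_pair_nhd) auto

lemma heights_mono:
  assumes "u \<in> B" "i < j" "j < n"
  shows "bil (r i) u + bil (m i) u \<le> bil (r j) u"
  using assms(2,3)
proof (induction j)
  case (Suc j)
  show ?case
  proof (cases "i = j")
    case True
    then show ?thesis using stack[of j u] Suc assms(1) by simp
  next
    case False
    then have "bil (r i) u + bil (m i) u \<le> bil (r j) u" using Suc by simp
    also have "\<dots> \<le> bil (r (Suc j)) u" using stack[of j u] m_pos[of j u] Suc assms(1) by simp
    finally show ?thesis .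
  qed
qed simp

lemma pair_nhd_same_column:
  assumes k: "Suc k < n" and j: "j < n" "j \<noteq> k" "j \<noteq> Suc k"
  shows "pair_nhd k \<inter> cell M (c, j) = {}"
proof (rule ccontr)
  assume "pair_nhd k \<inter> cell M (c, j) \<noteq> {}"
  then obtain x where x: "x \<in> pair_nhd k" "x \<in> cell M (c, j)" by blast
  obtain u where u: "u \<in> B" "x = pt (G u) (x $ 3)" by (rule pair_nhd_horiz[OF k x(1)]) (rule that)
  have 1: "bil (r k) u < x $ 3" "x $ 3 < bil (r k) u + bil (m k) u + bil (m (Suc k)) u"
    using pair_nhd_iff[OF k u(1), of "x $ 3"] x(1) u(2) by simp_all
  have 2: "bil (r j) u \<le> x $ 3" "x $ 3 \<le> bil (r j) u + bil (m j) u"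
    using in_cell_iff[OF j(1) u(1), of "x $ 3"] x(2) u(2) by simp_all
  consider "j < k" | "Suc k < j" using j by linarith
  then show False
  proof cases
    case 1
    then show False using heights_mono[OF u(1) 1, of] k 2 \<open>bil (r k) u < x $ 3\<close> by simp
  next
    case 2
    then show False
      using heights_mono[OF u(1) 2 j(1)] stack[OF k u(1)] \<open>bil (r j) u \<le> x $ 3\<close>
        \<open>x $ 3 < bil (r k) u + bil (m k) u + bil (m (Suc k)) u\<close> by simp
  qed
qed

text \<open>The mesh keeps columns apart through the shadows of their bottom cells; vertical walls
  and matching faces give every cell of a column the same shadow.\<close>

lemma horiz_cell_column:
  assumes c': "c' \<in> columns M" and k: "k < layers M c'"
  shows "horiz ` cell M (c', k) = horiz ` cell M (c', 0)"
  using k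
proof (induction k)
  case (Suc k)
  have K: "(c', k) \<in> cells M" "(c', Suc k) \<in> cells M" using c' Suc.prems by (auto simp: cells_def)
  obtain p1 q1 r1 m1 where V1: "vertical_cell S (cell_map M (c', k)) p1 q1 r1 m1"
    using column_mesh_vertical_cell[OF mesh K(1)] by blast
  obtain p2 q2 r2 m2 where V2: "vertical_cell S (cell_map M (c', Suc k)) p2 q2 r2 m2"
    using column_mesh_vertical_cell[OF mesh K(2)] by blast
  have img: "horiz ` cell M K = base_map p' q' ` B" if "vertical_cell S (cell_map M K) p' q' r' m'" for K p' q' r' m'
  proof -
    have "horiz ` cell M K = (\<lambda>y. base_map p' q' (horiz y)) ` R"
      unfolding cell_def image_image vertical_cell.F[OF that] horiz_pt ..
    also have "\<dots> = base_map p' q' ` horiz ` R" by (simp add: image_image)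
    also have "horiz ` R = B"
    proof (intro equalityI subsetI)
      fix u assume "u \<in> B"
      then have "pt u 0 \<in> R" by (simp add: pt_in_ref_cell)
      then show "u \<in> horiz ` R" by (rule rev_image_eqI) simp
    qed auto
    finally show ?thesis .
  qed
  have "base_map p1 q1 u = base_map p2 q2 u" if u: "u \<in> B" for u
  proof -
    have "cell_map M (c', k) (pt u 1) = cell_map M (c', Suc k) (pt u 1 - up)"
      using mesh c' Suc.prems u unfolding column_mesh_def by auto
    then show ?thesis
      unfolding pt_diff_up vertical_cell.F_pt[OF V1] vertical_cell.F_pt[OF V2] by simp
  qed
  then have "base_map p1 q1 ` B = base_map p2 q2 ` B" by (rule image_cong[OF refl])
  then show ?case using img[OF V1] img[OF V2] Suc by simp
qed simp

text \<open>An open set that meets a cell also meets its open part, which is dense in it. As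
  \<open>horiz\<close> is open, projecting a common point gives a point interior to the shadows of
  both columns. Together with \<open>pair_nhd_same_column\<close> this lets a test function on
  \<open>pair_nhd k\<close> see two cells only.\<close>

lemma pair_nhd_other_column:
  assumes k: "Suc k < n" and K: "K \<in> cells M" "fst K \<noteq> c"
  shows "pair_nhd k \<inter> cell M K = {}"
proof (rule ccontr)
  assume ne: "pair_nhd k \<inter> cell M K \<noteq> {}"
  obtain c' j where Kj: "K = (c', j)" by fastforce
  then have c': "c' \<in> columns M" "j < layers M c'" using K by (auto simp: cells_def)
  obtain p' q' r' m' where V: "vertical_cell S (cell_map M K) p' q' r' m'"
    using column_mesh_vertical_cell[OF mesh K(1)] by blast
  let ?I = "cell_map M K ` interior R"
  have "pair_nhd k \<inter> closure ?I \<noteq> {}"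
    using ne vertical_cell.cell_subset_closure[OF V] by (auto simp: cell_def)
  then have "pair_nhd k \<inter> ?I \<noteq> {}"
    using open_Int_closure_eq_empty[OF open_pair_nhd[OF k]] by blast
  then obtain x where x: "x \<in> pair_nhd k" "x \<in> ?I" by blast
  have "horiz ` pair_nhd k \<subseteq> horiz ` C 0"
    using pair_nhd_subset[OF k] horiz_cell_column[OF c, of k] horiz_cell_column[OF c, of "Suc k"] k
    by (metis (no_types, lifting) Suc_lessD Un_absorb image_Un image_mono)
  then have 1: "horiz x \<in> interior (horiz ` C 0)"
    using x(1) interior_maximal[OF _ open_horiz_image[OF open_pair_nhd[OF k]]] by blast
  have "horiz ` ?I \<subseteq> horiz ` cell M (c', 0)"
  proof -
    have "horiz ` ?I \<subseteq> horiz ` cell M (c', j)"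
      unfolding Kj cell_def by (intro image_mono interior_subset)
    then show ?thesis by (simp only: horiz_cell_column[OF c'])
  qed
  then have 2: "horiz x \<in> interior (horiz ` cell M (c', 0))"
    using x(2) interior_maximal[OF _ open_horiz_image[OF vertical_cell.open_F_interior[OF V]]] by blast
  have "interior (horiz ` C 0) \<inter> interior (horiz ` cell M (c', 0)) = {}"
    using mesh c c' K(2) Kj unfolding column_mesh_def by auto
  with 1 2 show False by blast
qed

text \<open>On test functions vanishing near the facet between two cells the distributional divergence
  of a field in H(div) is its piecewise divergence; by approximation this extends to all test
  functions, so the facet contributions cancel.\<close>

lemma Hdiv_facet:
  assumes w: "in_Hdiv M w" and wk: "\<And>k. k < n \<Longrightarrow> w (c, k) = piola M (c, k) (\<lambda>y. U k y *\<^sub>R up)"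
    and U: "\<And>k. k < n \<Longrightarrow> U k \<in> tens"
    and k: "Suc k < n" and \<phi>: "test_function (pair_nhd k) \<phi>"
  shows "face_flux \<phi> k (U k) 1 = face_flux \<phi> (Suc k) (U (Suc k)) 0"
proof -
  obtain d where d: "square_integrable (domain M) d"
    and div: "\<And>\<phi>. test_function (domain M) \<phi> \<Longrightarrow>
      (\<Sum>K\<in>cells M. LINT x:cell M K|lebesgue. frechet_derivative \<phi> (at x) (w K x))
        = - (LINT x:domain M|lebesgue. d x * \<phi> x)"
    using w unfolding in_Hdiv_def by blast
  let ?C = "\<lambda>j. cell M (c, j)"
  let ?I = "\<lambda>\<phi> j. LINT x:?C j|lebesgue. cell_div j (U j) x * \<phi> x"
  have k': "k < n" using k by simp
  have F1: "F k (pt u 0) \<notin> pair_nhd k" "F (Suc k) (pt u 1) \<notin> pair_nhd k" if u: "u \<in> B" for u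
    using vertical_cell.F_pt[OF cell[OF k'], of u 0] vertical_cell.F_pt[OF cell[OF k], of u 1]
      pair_nhd_iff[OF k u] stack[OF k u] by auto
  \<comment> \<open>The outer faces of the pair lie off \<open>pair_nhd k\<close>, so of the face
    terms only the two sides of the middle facet remain.\<close>
  have key: "face_flux \<phi> k (U k) 1 - face_flux \<phi> (Suc k) (U (Suc k)) 0 - ?I \<phi> k - ?I \<phi> (Suc k)
      = - (LINT x:domain M|lebesgue. d x * \<phi> x)" if \<phi>: "test_function (pair_nhd k) \<phi>" for \<phi>
  proof -
    have sm: "smooth \<phi>" using \<phi> by (rule test_function_smooth)
    have z: "(LINT x:cell M K|lebesgue. frechet_derivative \<phi> (at x) (w K x)) = 0"
      if "pair_nhd k \<inter> cell M K = {}" for K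
    proof -
      have "(\<lambda>x. indicator (cell M K) x *\<^sub>R frechet_derivative \<phi> (at x) (w K x)) = (\<lambda>x. 0)"
        using test_function_derivative_outside[OF \<phi>] that by (auto simp: indicator_def fun_eq_iff)
      then show ?thesis unfolding set_lebesgue_integral_def by simp
    qed
    have "(\<Sum>K\<in>cells M. LINT x:cell M K|lebesgue. frechet_derivative \<phi> (at x) (w K x))
       = (\<Sum>j<n. LINT x:?C j|lebesgue. frechet_derivative \<phi> (at x) (w (c, j) x))"
      by (intro sum_cells_column z pair_nhd_other_column k)
    also have "\<dots> = (\<Sum>j\<in>{k, Suc k}. LINT x:?C j|lebesgue. frechet_derivative \<phi> (at x) (w (c, j) x))"
    proof (rule sum.mono_neutral_right)
      show "\<forall>j\<in>{..<n} - {k, Suc k}. (LINT x:?C j|lebesgue. frechet_derivative \<phi> (at x) (w (c, j) x)) = 0"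
        by (intro ballI z pair_nhd_same_column[OF k]) auto
    qed (use k in auto)
    also have "\<dots> = (face_flux \<phi> k (U k) 1 - face_flux \<phi> k (U k) 0 - ?I \<phi> k)
        + (face_flux \<phi> (Suc k) (U (Suc k)) 1 - face_flux \<phi> (Suc k) (U (Suc k)) 0 - ?I \<phi> (Suc k))"
      using k k' by (simp add: wk cell_flux U sm)
    also have "face_flux \<phi> k (U k) 0 = 0"
      using F1 test_function_outside[OF \<phi>] by (simp add: face_flux_def ref_int_zero)
    also have "face_flux \<phi> (Suc k) (U (Suc k)) 1 = 0"
      using F1 test_function_outside[OF \<phi>] by (simp add: face_flux_def ref_int_zero)
    finally show ?thesis
      using div[OF test_function_mono[OF \<phi> pair_nhd_domain[OF k]]] by simp
  qed
  let ?O = "interior (?C k) \<union> interior (?C (Suc k))"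
  have O: "open ?O" by auto
  \<comment> \<open>Cut-offs that vanish on the facet and tend to 1 in the interiors of the two
    cells.\<close>
  obtain \<eta> where \<eta>: "\<And>i. test_function ?O (\<eta> i)" "\<And>i x. 0 \<le> \<eta> i x" "\<And>i x. \<eta> i x \<le> 1"
    "\<And>x. (\<lambda>i. \<eta> i x) \<longlonglongrightarrow> indicator ?O x"
    by (rule smooth_indicator_approx[OF O]) (rule that)
  have \<eta>s: "smooth (\<eta> i)" for i using \<eta>(1) by (rule test_function_smooth)
  have face_out: "F k (pt u 1) \<notin> ?O" if u: "u \<in> B" for u
    using vertical_cell.face_notin_interior[OF cell[OF k'] u, of 1]
      vertical_cell.face_notin_interior[OF cell[OF k] u, of 0] F_pt_Suc[OF k u]
    by (simp add: cell_eq)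
  have sm: "smooth \<phi>" using \<phi> by (rule test_function_smooth)
  let ?a = "\<lambda>j x. indicator (?C j) x *\<^sub>R (cell_div j (U j) x * \<phi> x)"
  let ?b = "\<lambda>x. indicator (domain M) x *\<^sub>R (d x * \<phi> x)"
  have ia: "integrable lebesgue (?a j)" if "j < n" for j
    using cell_div_integrable(1)[OF that U[OF that] sm] by (simp add: set_integrable_def)
  have ib: "integrable lebesgue ?b"
    using square_integrable_times_test_function[OF d \<phi>] by (simp add: set_integrable_def)
  \<comment> \<open>For \<open>\<phi> x * \<eta> i x\<close> the facet terms in \<open>key\<close>
    drop out, leaving an identity between volume integrals.\<close>
  have eq: "(LINT x|lebesgue. ?a k x * \<eta> i x) + (LINT x|lebesgue. ?a (Suc k) x * \<eta> i x)
      = (LINT x|lebesgue. ?b x * \<eta> i x)" for i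
  proof -
    let ?\<psi> = "\<lambda>x. \<phi> x * \<eta> i x"
    have 0: "?\<psi> (F k (pt u 1)) = 0" if "u \<in> B" for u
      using test_function_outside[OF \<eta>(1) face_out[OF that]] by simp
    have "face_flux ?\<psi> k (U k) 1 = 0" "face_flux ?\<psi> (Suc k) (U (Suc k)) 0 = 0"
      using 0 F_pt_Suc[OF k] by (simp_all add: face_flux_def ref_int_zero)
    then have "?I ?\<psi> k + ?I ?\<psi> (Suc k) = (LINT x:domain M|lebesgue. d x * ?\<psi> x)"
      using key[OF test_function_mult[OF \<phi> \<eta>s[of i]]] by linarith
    then show ?thesis by (simp add: set_lebesgue_integral_def mult.assoc)
  qed
  have "(\<lambda>i. (LINT x|lebesgue. ?a k x * \<eta> i x) + (LINT x|lebesgue. ?a (Suc k) x * \<eta> i x))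
     \<longlonglongrightarrow> (LINT x|lebesgue. ?a k x * indicator ?O x) + (LINT x|lebesgue. ?a (Suc k) x * indicator ?O x)"
    by (intro tendsto_add integral_smooth_approx ia k k' O \<eta>s \<eta>)
  moreover have "(\<lambda>i. LINT x|lebesgue. ?b x * \<eta> i x) \<longlonglongrightarrow> (LINT x|lebesgue. ?b x * indicator ?O x)"
    by (intro integral_smooth_approx ib O \<eta>s \<eta>)
  ultimately have lim: "(LINT x|lebesgue. ?a k x * indicator ?O x) + (LINT x|lebesgue. ?a (Suc k) x * indicator ?O x)
      = (LINT x|lebesgue. ?b x * indicator ?O x)"
    unfolding eq using LIMSEQ_unique by blast
  have Om: "?O \<in> sets lebesgue" by auto
  have mult_ind: "integrable lebesgue (\<lambda>x. h x * indicator ?O x)" if "integrable lebesgue h" for h :: "real^3 \<Rightarrow> real"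
    using integrable_mult_indicator[OF Om that] by (simp add: mult.commute)
  \<comment> \<open>The part of each cell that the limit indicator leaves out is a null set.\<close>
  have a_eq: "(LINT x|lebesgue. ?a j x * indicator ?O x) = (LINT x|lebesgue. ?a j x)" if j: "j = k \<or> j = Suc k" for j
  proof (rule integral_cong_AE)
    have jn: "j < n" using j k by auto
    show "AE x in lebesgue. ?a j x * indicator ?O x = ?a j x"
      using AE_cell_interior[OF jn] by eventually_elim (use j in \<open>auto simp: indicator_def\<close>)
    show "?a j \<in> borel_measurable lebesgue" "(\<lambda>x. ?a j x * indicator ?O x) \<in> borel_measurable lebesgue"
      using ia[OF jn] mult_ind[OF ia[OF jn]] by (auto dest: borel_measurable_integrable)
  qed
  have b_eq: "(LINT x|lebesgue. ?b x * indicator ?O x) = (LINT x|lebesgue. ?b x)"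
  proof (rule integral_cong_AE)
    show "AE x in lebesgue. ?b x * indicator ?O x = ?b x"
      using AE_cell_interior[OF k'] AE_cell_interior[OF k]
    proof eventually_elim
      case (elim x)
      show ?case
      proof (cases "x \<in> pair_nhd k")
        case True
        then have "x \<in> ?O" using pair_nhd_subset[OF k] elim by blast
        then show ?thesis by simp
      qed (simp add: test_function_outside[OF \<phi>])
    qed
    show "?b \<in> borel_measurable lebesgue" "(\<lambda>x. ?b x * indicator ?O x) \<in> borel_measurable lebesgue"
      using ib mult_ind[OF ib] by (auto dest: borel_measurable_integrable)
  qed
  have "?I \<phi> k + ?I \<phi> (Suc k) = (LINT x:domain M|lebesgue. d x * \<phi> x)"
    using lim a_eq[of k] a_eq[of "Suc k"] b_eq by (simp add: set_lebesgue_integral_def)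
  then show ?thesis using key[OF \<phi>] by linarith
qed

text \<open>The fundamental lemma of the calculus of variations on a facet: were the jump nonzero at
  an interior base point, a bump near its image, placed over base points with a jump of the same
  sign, would give different fluxes on the two sides.\<close>

lemma facet_continuous:
  assumes flux: "\<And>\<phi>. test_function (pair_nhd k) \<phi> \<Longrightarrow> face_flux \<phi> k (U k) 1 = face_flux \<phi> (Suc k) (U (Suc k)) 0"
    and U: "\<And>k. k < n \<Longrightarrow> U k \<in> tens" and k: "Suc k < n" and u: "u \<in> B"
  shows "U k (pt u 1) = U (Suc k) (pt u 0)"
proof -
  let ?J = "\<lambda>u. U k (pt u 1) - U (Suc k) (pt u 0)"
    have k': "k < n" using k by simp
  have cU: "continuous_on A (\<lambda>u. U j (pt u t))" if "j < n" for A j t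
    by (rule continuous_on_compose2[OF tens_continuous_on[OF U[OF that], of UNIV]])
       (auto intro!: continuous_intros)
  have cJ: "continuous_on A ?J" for A
    by (intro continuous_on_diff cU k k')
  have "?J v = 0" if v: "v \<in> interior B" for v
  proof (rule ccontr)
    assume J: "?J v \<noteq> 0"
    define s where "s = sgn (?J v)"
    have sJ: "s * ?J v > 0" using J by (simp add: s_def sgn_mult_self_eq abs_sgn[symmetric] mult.commute)
    \<comment> \<open>The base points where the jump has the sign that it has at
      \<open>v\<close>.\<close>
    let ?W = "interior B \<inter> {u. 0 < s * ?J u}"
    have "open {u. 0 < s * ?J u}"
      by (intro open_Collect_less continuous_on_const continuous_on_mult cJ)
    then have oW: "open ?W" by (intro open_Int open_interior)
    have WB: "?W \<subseteq> B" using interior_subset by blast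
    have inj: "inj_on G B" by (rule vertical_cell.G_inj[OF cell[OF n_pos]])
    have "continuous_on ?W G"
    proof -
      have "G = (\<lambda>u. horiz (F 0 (pt u 0)))"
        by (simp add: vertical_cell.F_pt[OF cell[OF n_pos]])
      moreover have "continuous_on ?W (\<lambda>u. horiz (F 0 (pt u 0)))"
        by (intro continuous_on_horiz continuous_on_compose2[OF vertical_cell.F_continuous[OF cell[OF n_pos], of UNIV]]
            continuous_intros) auto
      ultimately show ?thesis by simp
    qed
    \<comment> \<open>Invariance of domain makes the image of \<open>?W\<close> open, so the
      vertical cylinder over it is a neighbourhood of \<open>?x\<close> in which a box can be
      placed.\<close>
    then have oGW: "open (G ` ?W)"
      by (rule invariance_of_domain[OF _ oW inj_on_subset[OF inj WB]])
    let ?x = "F k (pt v 1)"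
    have vB: "v \<in> B" using v interior_subset by blast
    have x_eq: "?x = pt (G v) (bil (r k) v + bil (m k) v)"
      by (simp add: vertical_cell.F_pt[OF cell[OF k']])
    have "?x \<in> pair_nhd k"
      unfolding x_eq using pair_nhd_iff[OF k vB] v m_pos[OF k' vB] m_pos[OF k vB] by simp
    moreover have "horiz ?x \<in> G ` ?W" using v sJ by (simp add: x_eq)
    ultimately have x_in: "?x \<in> pair_nhd k \<inter> horiz -` (G ` ?W)" by (intro IntI vimageI2)
    have "open (pair_nhd k \<inter> horiz -` (G ` ?W))"
      by (intro open_Int open_pair_nhd k open_vimage oGW continuous_on_horiz continuous_on_id)
    then obtain a b where ab: "cbox a b \<subseteq> pair_nhd k \<inter> horiz -` (G ` ?W)" "?x \<in> box a b"
      by (rule open_contains_cbox[OF _ x_in]) (rule that)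
    define \<phi> where "\<phi> = box_bump 1 a b"
    have t\<phi>: "test_function (pair_nhd k) \<phi>"
      unfolding \<phi>_def using ab(1) by (intro test_function_box_bump) auto
    have c\<phi>: "continuous_on A (\<lambda>y. \<phi> (F k (pt (horiz y) 1)))" for A
      by (intro continuous_on_compose2[OF smooth_continuous_on[OF test_function_smooth[OF t\<phi>], of UNIV]]
          continuous_on_compose2[OF vertical_cell.F_continuous[OF cell[OF k'], of UNIV]] continuous_intros) auto
    let ?h = "\<lambda>y. \<phi> (F k (pt (horiz y) 1)) * (s * ?J (horiz y))"
    have ch: "continuous_on R ?h"
      by (intro continuous_on_mult c\<phi> continuous_on_const
          continuous_on_compose2[OF cJ[of UNIV]] continuous_on_horiz continuous_on_id) auto
    have nn: "0 \<le> ?h y" if y: "y \<in> R" for y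
    proof (cases "F k (pt (horiz y) 1) \<in> box a b")
      case True
      then have "horiz (F k (pt (horiz y) 1)) \<in> G ` ?W" using ab(1) box_subset_cbox by blast
      then have "G (horiz y) \<in> G ` ?W" by (simp add: vertical_cell.F_pt[OF cell[OF k']])
      then have "horiz y \<in> ?W" using inj_on_image_mem_iff[OF inj _ WB] y by simp
      then show ?thesis by (simp add: \<phi>_def box_bump_bounds)
    next
      case False
      then show ?thesis by (simp add: \<phi>_def box_bump_outside)
    qed
    have "ref_int S ?h = s * (ref_int S (\<lambda>y. \<phi> (F k (pt (horiz y) 1)) * U k (pt (horiz y) 1))
       - ref_int S (\<lambda>y. \<phi> (F k (pt (horiz y) 1)) * U (Suc k) (pt (horiz y) 0)))"
    proof -
      have cU': "continuous_on R (\<lambda>y. U j (pt (horiz y) t))" if "j < n" "t = 0 \<or> t = 1" for j t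
        by (intro continuous_on_face tens_continuous_on U that)
      have "?h = (\<lambda>y. s * (\<phi> (F k (pt (horiz y) 1)) * U k (pt (horiz y) 1)
          - \<phi> (F k (pt (horiz y) 1)) * U (Suc k) (pt (horiz y) 0)))"
        by (simp add: fun_eq_iff algebra_simps)
      then show ?thesis
        by (simp add: ref_int_cmult ref_int_diff continuous_on_mult c\<phi> cU' k k')
    qed
    also have "ref_int S (\<lambda>y. \<phi> (F k (pt (horiz y) 1)) * U (Suc k) (pt (horiz y) 0))
       = ref_int S (\<lambda>y. \<phi> (F (Suc k) (pt (horiz y) 0)) * U (Suc k) (pt (horiz y) 0))"
      by (intro ref_int_cong) (simp add: F_pt_Suc[OF k])
    also have "s * (ref_int S (\<lambda>y. \<phi> (F k (pt (horiz y) 1)) * U k (pt (horiz y) 1)) - \<dots>) = 0"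
      using flux[OF t\<phi>] sgn_D0 by (simp add: face_flux_def)
    finally have i0: "ref_int S ?h = 0" .
    \<comment> \<open>The integrand does not depend on the height, so any point over
      \<open>v\<close> will do.\<close>
    have "pt v 0 \<in> R" using vB by (simp add: pt_in_ref_cell)
    from ref_int_eq_0[OF ch nn i0 this] have "?h (pt v 0) = 0" .
    moreover have "0 < \<phi> ?x" unfolding \<phi>_def box_bump_pos_iff[OF zero_less_one] by (rule ab(2))
    ultimately show False using mult_pos_pos[OF _ sJ, of "\<phi> ?x"] unfolding horiz_pt by linarith
  qed
  then have "?J u = 0" using ref_base_ext[OF cJ _ u] by blast
  then show ?thesis by simp
qed

text \<open>H(div) gives agreement at the facets, and the rigid lid gives zero at both ends because
  the normal of a sloping face has a nonzero vertical component.\<close>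

lemma V2v_col_eq: "V2v_col E M c = vel ` ring_space"
proof (intro equalityI subsetI)
  fix w assume "w \<in> V2v_col E M c"
  then obtain w0 where w0: "w0 \<in> V2v E M" "w = column_restrict M c w0" unfolding V2v_col_def by blast
  have "\<exists>U. k < n \<longrightarrow> U \<in> tens \<and> w0 (c, k) = piola M (c, k) (\<lambda>y. U y *\<^sub>R up)" for k
  proof (cases "k < n")
    case True
    then have "w0 (c, k) \<in> cell_V2v E M (c, k)" using w0(1) in_cells[OF True] by (simp add: V2v_def)
    then show ?thesis unfolding cell_V2v_def ref_V2v_def by blast
  qed blast
  then obtain U where U: "\<And>k. k < n \<Longrightarrow> U k \<in> tens"
    and wk: "\<And>k. k < n \<Longrightarrow> w0 (c, k) = piola M (c, k) (\<lambda>y. U k y *\<^sub>R up)" by metis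
  have hdiv: "in_Hdiv M w0" and lid: "rigid_lid M w0" using w0(1) by (auto simp: V2v_def V2_def)
  have inner: "U k (pt u 1) = U (Suc k) (pt u 0)" if "Suc k < n" "u \<in> B" for k u
    by (rule facet_continuous[OF Hdiv_facet[OF hdiv wk U that(1)] U that])
  have ends: "U k (pt u t) = 0"
    if k: "k < n" and u: "u \<in> B" and t: "t = 0 \<or> t = 1"
      and 0: "w0 (c, k) (F k (pt u t)) \<bullet> face_normal M (c, k) (pt u t) = 0" for k u t
  proof -
    have "pt u t \<in> R" using u t by (auto simp: pt_in_ref_cell)
    then have "(U k (pt u t) / D u) * (face_normal M (c, k) (pt u t) $ 3) = 0"
      using 0 by (simp add: wk[OF k] piola_F[OF k] inner_axis')
    then show ?thesis
      using vertical_cell.face_normal_nth3[OF cell[OF k] refl, of "pt u t"] D_nz[OF u] u by simp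
  qed
  have "U 0 (pt u 0) = 0" "U (n - 1) (pt u 1) = 0" if u: "u \<in> B" for u
    using lid c u n_pos unfolding rigid_lid_def by (auto intro!: ends)
  with inner have "U \<in> ring_space" using U by (simp add: ring_space_def)
  moreover have "w = vel U"
    unfolding w0(2) vel_def column_restrict_def by (intro restrict_ext) (simp add: wk)
  ultimately show "w \<in> vel ` ring_space" by blast
next
  fix w assume "w \<in> vel ` ring_space"
  then show "w \<in> V2v_col E M c" using vel_in_V2v_col by blast
qed

end

text \<open>Matching faces make consecutive base maps agree on the base; by \<open>bil_eqI\<close>
  their coefficients are equal, and induction from the bottom extends this to all layers. The
  vertical component of the same condition gives the stacking of heights.\<close>

lemma mesh_column_exists:
  assumes M: "column_mesh M" and E: "compatible_element E" and c: "c \<in> columns M"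
  shows "\<exists>p q r m. mesh_column M E c p q r m"
proof -
  let ?B = "ref_base (shape M)" and ?F = "\<lambda>k. cell_map M (c, k)" and ?n = "layers M c"
  let ?form = "\<lambda>k p q r m. (\<forall>y. ?F k y = pt (base_map p q (horiz y)) (bil r (horiz y) + y $ 3 * bil m (horiz y)))
     \<and> (shape M = Triangle \<longrightarrow> p $ 4 = 0 \<and> q $ 4 = 0 \<and> r $ 4 = 0 \<and> m $ 4 = 0)
     \<and> (\<forall>u\<in>?B. bil m u > 0) \<and> (\<forall>u\<in>?B. base_det p q u \<noteq> 0)"
  have "\<exists>p q r m. k < ?n \<longrightarrow> ?form k p q r m" for k
  proof (cases "k < ?n")
    case True
    then have "column_cell_map (shape M) (?F k)" using M c by (auto simp: column_mesh_def cells_def)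
    then show ?thesis using column_cell_map_form by blast
  qed blast
  then obtain p q r m where f: "\<And>k. k < ?n \<Longrightarrow> ?form k (p k) (q k) (r k) (m k)" by metis
  have F: "?F k (pt u t) = pt (base_map (p k) (q k) u) (bil (r k) u + t * bil (m k) u)" if "k < ?n" for k u t
    using f[OF that] by simp
  have match: "base_map (p k) (q k) u = base_map (p (Suc k)) (q (Suc k)) u \<and>
      bil (r (Suc k)) u = bil (r k) u + bil (m k) u" if k: "Suc k < ?n" and u: "u \<in> ?B" for k u
  proof -
    have "?F k (pt u 1) = ?F (Suc k) (pt u 1 - up)"
      using M c k u unfolding column_mesh_def by auto
    then show ?thesis unfolding pt_diff_up using F[of k u 1] F[of "Suc k" u 0] k by simp
  qed
  have pq: "p k = p 0 \<and> q k = q 0" if "k < ?n" for k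
    using that
  proof (induction k)
    case (Suc k)
    have "bil (p k) u = bil (p (Suc k)) u" "bil (q k) u = bil (q (Suc k)) u" if "u \<in> ?B" for u
      using match[OF Suc.prems that] base_map_nth by metis+
    then have "p k = p (Suc k)" "q k = q (Suc k)"
      using f[of k] f[of "Suc k"] Suc.prems by (auto intro!: bil_eqI[of "shape M"])
    then show ?case using Suc by simp
  qed simp
  have "vertical_cell (shape M) (?F k) (p 0) (q 0) (r k) (m k)" if "k < ?n" for k
    using f[OF that] pq[OF that] unfolding vertical_cell_def by simp
  then have "mesh_column M E c (p 0) (q 0) r m"
    unfolding mesh_column_def using M E c match by blast
  then show ?thesis by blast
qed

theorem theorem7p2:
  fixes M :: "'c mesh" and E :: element and c :: 'c and g :: real
    and P :: "nat \<Rightarrow> real^3 \<Rightarrow> real"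
  assumes "column_mesh M" and "compatible_element E" and "c \<in> columns M" and "g > 0"
    and "P \<in> V3_bar E M c"
    and "\<And>k x. \<lbrakk>Suc k < layers M c; x \<in> interior_facet M c k\<rbrakk> \<Longrightarrow> P (Suc k) x - P k x > 0"
    and "\<And>k x. \<lbrakk>vdeg E - 1 \<ge> 1; k < layers M c; x \<in> interior (cell M (c, k))\<rbrakk>
           \<Longrightarrow> vertical_derivative (P k) x > 0"
  shows "\<exists>!\<theta>. \<theta> \<in> Vt_ring E M c \<and> hydrostatic_balance E M c g P \<theta>"
proof -
  obtain p q r m where "mesh_column M E c p q r m"
    using mesh_column_exists[OF assms(1-3)] by blast
  then interpret mesh_column M E c p q r m .
  show ?thesis by (rule unique_solution[OF assms(5-7) V2v_col_eq])
qed

end
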